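(* Let $\varepsilon>0$ be fixed and sufficiently small, with $u_\varepsilon$ and $\Omega_-$ as in the context, and let $$q(m,z)=1-\frac{i\sqrt2}{(1-z^2)^m(1-z)^{\frac12}(1+z)^{\frac12}}.$$ Each zero of $\pi_m(z)$ in the region $\Omega_-\setminus u_\varepsilon$ approaches a zero of $q(m,z)$ as $m\to\infty$, i.e. the maximum, over the zeros $z$ of $\pi_m$ in $\Omega_-\setminus u_\varepsilon$, of the distance from $z$ to the set of zeros of $q(m,\cdot)$ tends to $0$ as $m\to\infty$. More specifically, introduce the parametrization $1-z^2=\rho e^{i\theta}$, $0\le\theta<2\pi$. The zeros $z_k^*$ of $q(m,z)$ have $\rho=2^{\frac{1}{2m+1}}$ and can be enumerated according to $\theta_k=\mathrm{Arg}(1-(z_k^* )^2)$, for $k=1,2,\ldots,m$, where $$\left(m+\tfrac12\right)\theta_k=\frac{\pi}{2}+2\pi k .$$ There exist an integer $M>0$ and a constant $C>0$ such that if $m\ge M$, then for each zero $z_k^*\in\Omega_-$ of $q(m,z)$ outside $u_\varepsilon$, there is exactly one zero $z_k$ of $\pi_m(z)$ satisfying $$|z_k^*-z_k|\le\frac{C}{m}.$$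
   Context: **Polynomials.** For an integer $m\ge 1$ let $$P_m(z)=P_m^{(m+\frac12,-m-\frac12)}(z)=2^{-m}\sum_{k=0}^m\binom{2m+\frac12}{m-k}\binom{-\frac12}{k}(z-1)^k(z+1)^{m-k}$$ (generalized binomial coefficients), which is the Jacobi polynomial $P_m^{(\alpha,\beta)}$ with $\alpha=m+\frac12$, $\beta=-m-\frac12$. Let $\pi_m(z)=P_m(z)/\kappa_m$ with $\kappa_m=2^{-m}\binom{2m}{m}$, so that $\pi_m$ is monic of degree $m$. **Branches.** The square roots are $$(1+z)^{\frac12}=|1+z|^{\frac12}e^{i\vartheta/2},\quad \vartheta=\mathrm{Arg}(z+1)\in[0,2\pi),$$ $$(1-z)^{\frac12}=|1-z|^{\frac12}e^{i(\phi+\pi)/2},\quad \phi=\mathrm{Arg}(z-1)\in[0,2\pi).$$ **Region.** $u_\varepsilon=\{z\in\mathbb{C}:|z|<\varepsilon\}$. Let $\Sigma_{-1}=\{z:|1-z^2|=1,\ \mathrm{Re}\,z\le 0\}$, a simple closed curve through the origin encircling $-1$. Let $\Sigma_{1/r}$ be a fixed (independent of $m$) simple closed curve consisting of the segment $[-i\varepsilon,i\varepsilon]$ of the imaginary axis together with a simple differentiable arc in the open left half-plane joining the endpoints of this segment, such that $\Sigma_{-1}\setminus\{0\}$ lies inside $\Sigma_{1/r}$ and this arc stays at a positive distance from $\Sigma_{-1}$. Then $\Omega_-$ is the open region of points inside $\Sigma_{1/r}$ and outside $\Sigma_{-1}$.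
   Formalization: The displayed enumeration fails for the given branches (m=1: the left zero of q has θ=π); corrected to (m+1/2)θ_k=-π/2+2πk, k=1..m, for zeros with Re z<0, and π/2+2πk, k=0..m, for those with Re z≥0. *)

theory Defs
  imports "HOL-Analysis.Analysis" "HOL-Computational_Algebra.Polynomial"
begin

text \<open>The Jacobi polynomial with parameters m + 1/2 and -m - 1/2, as a complex polynomial.\<close>

definition jacobi_P :: "nat \<Rightarrow> complex poly" where
  "jacobi_P m = smult (1 / 2 ^ m)
     (\<Sum>k\<le>m. smult (((2 * of_nat m + 1/2) gchoose (m - k)) * ((- 1/2) gchoose k))
        ([:-1, 1:] ^ k * [:1, 1:] ^ (m - k)))"

definition kappa :: "nat \<Rightarrow> complex" where
  "kappa m = of_nat ((2 * m) choose m) / 2 ^ m"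

definition pi_poly :: "nat \<Rightarrow> complex poly" where
  "pi_poly m = smult (1 / kappa m) (jacobi_P m)"

text \<open>The branches of the square roots of 1 + z and 1 - z. The library function
  \<^const>\<open>Arg2pi\<close> is the argument with values in [0, 2 pi).\<close>

definition sqrt_1_plus :: "complex \<Rightarrow> complex" where
  "sqrt_1_plus z = of_real (sqrt (cmod (1 + z))) * cis (Arg2pi (z + 1) / 2)"

definition sqrt_1_minus :: "complex \<Rightarrow> complex" where
  "sqrt_1_minus z = of_real (sqrt (cmod (1 - z))) * cis ((Arg2pi (z - 1) + pi) / 2)"

text \<open>At z = 1 and z = -1, where the formula is undefined, division by zero makes the value 1,
  so that no spurious zeros arise.\<close>

definition q :: "nat \<Rightarrow> complex \<Rightarrow> complex" where
  "q m z = 1 - \<i> * of_real (sqrt 2) / ((1 - z\<^sup>2) ^ m * sqrt_1_minus z * sqrt_1_plus z)"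

definition u_disc :: "real \<Rightarrow> complex set" where
  "u_disc \<epsilon> = {z. cmod z < \<epsilon>}"

definition Sigma_minus1 :: "complex set" where
  "Sigma_minus1 = {z. cmod (1 - z\<^sup>2) = 1 \<and> Re z \<le> 0}"

definition Sigma_r :: "real \<Rightarrow> (real \<Rightarrow> complex) \<Rightarrow> complex set" where
  "Sigma_r \<epsilon> \<gamma> =
     closed_segment (- (\<i> * of_real \<epsilon>)) (\<i> * of_real \<epsilon>) \<union> path_image \<gamma>"

text \<open>The arcs \<gamma> that complete the segment to an admissible outer curve. The arc
  meets the imaginary axis exactly in its two end points.\<close>

definition outer_arc :: "real \<Rightarrow> (real \<Rightarrow> complex) \<Rightarrow> bool" where
  "outer_arc \<epsilon> \<gamma> \<longleftrightarrow>
     arc \<gamma> \<and> \<gamma> differentiable_on {0..1} \<and>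
     {pathstart \<gamma>, pathfinish \<gamma>} = {\<i> * of_real \<epsilon>, - (\<i> * of_real \<epsilon>)} \<and>
     (\<forall>t. 0 < t \<and> t < 1 \<longrightarrow> Re (\<gamma> t) < 0) \<and>
     Sigma_minus1 - {0} \<subseteq> inside (Sigma_r \<epsilon> \<gamma>) \<and>
     setdist (path_image \<gamma>) Sigma_minus1 > 0"

definition Omega_minus :: "real \<Rightarrow> (real \<Rightarrow> complex) \<Rightarrow> complex set" where
  "Omega_minus \<epsilon> \<gamma> = inside (Sigma_r \<epsilon> \<gamma>) \<inter> outside Sigma_minus1"

text \<open>The maximal distance from the points of a finite set A to the set Z; it is 0 if A is
  empty.\<close>

definition max_dist_to :: "complex set \<Rightarrow> complex set \<Rightarrow> real" where
  "max_dist_to A Z = Max (insert 0 ((\<lambda>z. infdist z Z) ` A))"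

text \<open>Enumeration of the zeros of q by the argument of 1 - z^2. Since z and -z have the same
  value of 1 - z^2, the argument determines a zero only after a half-plane is chosen. With the
  branches above, the product of the two square roots is -(1 - z^2)^(1/2) at the zeros in the left
  half-plane and +(1 - z^2)^(1/2) at those in the right half-plane, where the root of 1 - z^2 is
  taken with half the argument in [0, 2 pi). Hence the equation reads
  (m + 1/2) \<theta> = -pi/2 + 2 pi k on the left, with k = 1, ..., m, and
  (m + 1/2) \<theta> = pi/2 + 2 pi k on the right, with k = 0, ..., m. The zeros on the left are
  those near the zeros of the Jacobi polynomial.\<close>

definition enumerates_left_zeros :: "nat \<Rightarrow> (nat \<Rightarrow> complex) \<Rightarrow> bool" where
  "enumerates_left_zeros m zs \<longleftrightarrow>
     bij_betw zs {1..m} {z. q m z = 0 \<and> Re z < 0} \<and>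
     (\<forall>k\<in>{1..m}. (real m + 1/2) * Arg2pi (1 - (zs k)\<^sup>2) = - pi / 2 + 2 * pi * real k)"

definition enumerates_right_zeros :: "nat \<Rightarrow> (nat \<Rightarrow> complex) \<Rightarrow> bool" where
  "enumerates_right_zeros m zs \<longleftrightarrow>
     bij_betw zs {0..m} {z. q m z = 0 \<and> Re z \<ge> 0} \<and>
     (\<forall>k\<in>{0..m}. (real m + 1/2) * Arg2pi (1 - (zs k)\<^sup>2) = pi / 2 + 2 * pi * real k)"

end

theory Submission
  imports Defs "HOL-Complex_Analysis.Complex_Analysis"
begin

text \<open>
  Put w = 1/(1 - z^2) and y = (1 - x)^(1/2). The Jacobi polynomial P_m(z) is, up to an elementary factor
  without zeros, the coefficient of x^m in the algebraic function
  G(x) = (y - z)^(1/2) / (y (1 - w x)^(1/2)) (\<open>jacobi_gf_coeff\<close>). For Re z < 0 and |1 - z^2| > 1 its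
  nearest singularities are x = 1 and x = 1/w, both of inverse square root type. Each contributes the
  coefficients of a binomial series, so the coefficient of x^m is c_m (a + b w^m) plus an error, where c_m
  is the coefficient of (1 - x)^(-1/2); and a, b are such that 1 + (b/a) w^m is exactly q(m, z). So the
  Jacobi polynomial divided by the contribution of x = 1 converges to q, and its zeros are where the two
  contributions cancel (\<open>normalized_P_asymptotics\<close>).

  The error has to be uniform in z as long as z stays away from 0, where the two singularities
  meet. After subtraction of the two singular parts, the remainder is an explicit algebraic function
  (\<open>singular_parts\<close>) whose derivative is bounded by inverse square roots at the two points. Such
  families are closed under the algebraic operations, and Cauchy's formula bounds their coefficients
  by a multiple of m^(-3/4) (\<open>tame_coeff_bound\<close>), against the order m^(-1/2) of c_m.

  For the zeros, let q be small at z0, let N = m + 1/2 and 1 - z^2 = (1 - z0^2)(1 + d). Then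
  q(m, z) = 1 - (1 - q(m, z0)) (1 + d)^(-N), which is close to N d on discs of radius c/m. By Rouche's theorem
  every function close to q has exactly one zero in such a disc
  (\<open>unique_zero_near_approx_zero\<close>). With z0 a zero of q, this gives the unique nearby zero of the
  Jacobi polynomial; with z0 a zero of the Jacobi polynomial, applied to q itself, it gives a zero of
  q at distance O(1/m). The radius is chosen so small that the discs remain in the domain
  |1 - z^2| > 1: the zeros of q have |1 - z^2| = 2^(1/(2m+1)), which exceeds 1 by a multiple of 1/m.

  The enumeration of the zeros of q is a computation with arguments (\<open>enumerate_zeros\<close>).
\<close>

section \<open>The branch of the square root and the zeros of q\<close>

lemma Re_csqrt_pos: assumes "u \<notin> \<real>\<^sub>\<le>\<^sub>0" shows "Re (csqrt u) > 0"
proof (rule ccontr)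
  assume "\<not> Re (csqrt u) > 0"
  then have "Re (csqrt u) = 0" using Re_csqrt[of u] by linarith
  moreover have "u = (csqrt u)\<^sup>2" by simp
  ultimately have "Re u = - (Im (csqrt u))\<^sup>2" "Im u = 0"
    by (metis Re_power2 diff_0 zero_power2, metis Im_power2 mult_zero_left mult_zero_right)
  then have "u \<in> \<real>\<^sub>\<le>\<^sub>0" unfolding complex_nonpos_Reals_iff by (metis neg_le_0_iff_le zero_le_power2)
  then show False using assms by simp
qed

definition root_prod :: "complex \<Rightarrow> complex" where
  "root_prod z = sqrt_1_minus z * sqrt_1_plus z"

lemma root_prod_polar:
  "root_prod z = of_real (sqrt (cmod (1 - z\<^sup>2))) * cis ((Arg2pi (z + 1) + Arg2pi (z - 1) + pi) / 2)"
proof -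
  have "1 - z\<^sup>2 = (1 - z) * (1 + z)" by (simp add: algebra_simps power2_eq_square)
  then have "sqrt (cmod (1 - z\<^sup>2)) = sqrt (cmod (1 - z)) * sqrt (cmod (1 + z))"
    by (simp add: norm_mult real_sqrt_mult)
  moreover have "cis ((Arg2pi (z - 1) + pi) / 2) * cis (Arg2pi (z + 1) / 2)
      = cis ((Arg2pi (z + 1) + Arg2pi (z - 1) + pi) / 2)"
    by (simp add: cis_mult add_divide_distrib algebra_simps)
  moreover have "of_real a * c * (of_real b * d) = of_real (a * b) * (c * d)" for a b and c d :: complex
    by simp
  ultimately show ?thesis
    unfolding root_prod_def sqrt_1_minus_def sqrt_1_plus_def by (simp only:)
qed

lemma polar_Arg2pi: "z = of_real (cmod z) * cis (Arg2pi z)"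
  using Arg2pi_eq[of z] by (simp add: cis_conv_exp)

lemma one_minus_square_polar:
  "1 - z\<^sup>2 = of_real (cmod (1 - z\<^sup>2)) * cis (Arg2pi (z + 1) + Arg2pi (z - 1) + pi)"
proof -
  have "1 - z\<^sup>2 = - ((z + 1) * (z - 1))" by (simp add: algebra_simps power2_eq_square)
  also have "\<dots> = - (of_real (cmod (z+1)) * cis (Arg2pi (z + 1)) * (of_real (cmod (z-1)) * cis (Arg2pi (z - 1))))"
    by (rule arg_cong2[where f="\<lambda>a b. - (a * b)", OF polar_Arg2pi polar_Arg2pi])
  also have "\<dots> = of_real (cmod (z+1) * cmod (z-1)) * cis (Arg2pi (z + 1) + Arg2pi (z - 1) + pi)"
  proof -
    have "cis (Arg2pi (z + 1) + Arg2pi (z - 1) + pi) = - (cis (Arg2pi (z + 1)) * cis (Arg2pi (z - 1)))"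
      by (simp only: cis_mult[symmetric] cis_pi) simp
    then show ?thesis by simp
  qed
  also have "cmod (z+1) * cmod (z-1) = cmod (1 - z\<^sup>2)"
  proof -
    have "(z + 1) * (z - 1) = - (1 - z\<^sup>2)" by (simp add: algebra_simps power2_eq_square)
    then show ?thesis by (metis norm_minus_cancel norm_mult)
  qed
  finally show ?thesis .
qed

lemma root_prod_square: "(root_prod z)\<^sup>2 = 1 - z\<^sup>2"
proof -
  have "(root_prod z)\<^sup>2 = of_real ((sqrt (cmod (1 - z\<^sup>2)))\<^sup>2) * (cis ((Arg2pi (z + 1) + Arg2pi (z - 1) + pi) / 2))\<^sup>2"
    unfolding root_prod_polar by (simp only: power_mult_distrib of_real_power)
  also have "\<dots> = of_real (cmod (1 - z\<^sup>2)) * cis (Arg2pi (z + 1) + Arg2pi (z - 1) + pi)"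
    by (simp only: Complex.DeMoivre real_sqrt_pow2[OF norm_ge_zero]) (simp add: add_divide_distrib)
  finally show ?thesis using one_minus_square_polar by simp
qed

lemma Arg2pi_polar: "\<lbrakk>w = of_real (cmod w) * cis a; w \<noteq> 0; 0 \<le> a; a < 2 * pi\<rbrakk> \<Longrightarrow> Arg2pi w = a"
  by (rule Arg2pi_unique[of "cmod w"]) (auto simp: cis_conv_exp)

lemma half_turn_of_sin_sign:
  assumes "0 < t" "t < 2*pi" shows "sin t > 0 \<Longrightarrow> t < pi" "sin t < 0 \<Longrightarrow> t > pi"
proof -
  show "sin t > 0 \<Longrightarrow> t < pi" using assms sin_le_zero[of t] by force
  show "sin t < 0 \<Longrightarrow> t > pi" using assms sin_ge_zero[of t] by force
qed

lemma Im_gt_0_Arg2pi: "Im z > 0 \<Longrightarrow> 0 < Arg2pi z \<and> Arg2pi z < pi"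
  using Arg2pi_lt_pi by blast

lemma Im_lt_0_Arg2pi: assumes "Im z < 0" shows "pi < Arg2pi z \<and> Arg2pi z < 2*pi"
proof -
  have "\<not> Arg2pi z \<le> pi" using assms Arg2pi_le_pi[of z] by auto
  then show ?thesis using Arg2pi_lt_2pi by auto
qed

lemma sin_Arg2pi_sum: "sgn (sin (Arg2pi (z + 1) + Arg2pi (z - 1))) = sgn (Re z * Im z)" if "1 - z\<^sup>2 \<noteq> 0"
proof -
  have "Im (1 - z\<^sup>2) = - cmod (1 - z\<^sup>2) * sin (Arg2pi (z + 1) + Arg2pi (z - 1))"
  proof -
    have "Im (of_real c * cis (s + pi)) = - c * sin s" for c s by simp
    then show ?thesis using arg_cong[OF one_minus_square_polar[of z], of Im] by metis
  qed
  then have "2 * (Re z * Im z) = cmod (1 - z\<^sup>2) * sin (Arg2pi (z + 1) + Arg2pi (z - 1))"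
    by (simp add: power2_eq_square algebra_simps)
  moreover have "cmod (1 - z\<^sup>2) > 0" using that by simp
  ultimately have "sgn (2 * (Re z * Im z)) = sgn (sin (Arg2pi (z + 1) + Arg2pi (z - 1)))"
    by (simp only: sgn_mult) simp
  then show ?thesis by (simp add: sgn_mult)
qed

text \<open>The phase of the product is (A + B + \<pi>)/2, where A and B are the arguments of z + 1 and z - 1,
  and 1 - z^2 has phase A + B + \<pi>. Here \<pi> \<le> A + B < 3\<pi>, by the sign of sin (A + B), so the argument of
  1 - z^2 in [0, 2\<pi>) is A + B - \<pi>; its half differs from the phase of the product by \<pi>.\<close>

lemma root_prod_left:
  assumes "Re z < 0" "1 - z\<^sup>2 \<noteq> 0"
  shows "root_prod z = - of_real (sqrt (cmod (1 - z\<^sup>2))) * cis (Arg2pi (1 - z\<^sup>2) / 2)"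
proof -
  define t where "t = Arg2pi (z + 1) + Arg2pi (z - 1)"
  have sg: "sgn (sin t) = sgn (Re z * Im z)" using sin_Arg2pi_sum[OF assms(2)] by (simp add: t_def)
  have "pi \<le> t \<and> t < 3 * pi"
  proof -
    consider "Im z > 0" | "Im z < 0" | "Im z = 0" by linarith
    then show ?thesis
    proof cases
      case 1
      then have "Re z * Im z < 0" using assms by (simp add: mult_neg_pos)
      then have "sin t < 0" using sg by (metis sgn_less)
      moreover have "0 < t" "t < 2*pi" using Im_gt_0_Arg2pi[of "z+1"] Im_gt_0_Arg2pi[of "z-1"] 1 by (auto simp: t_def)
      ultimately show ?thesis using half_turn_of_sin_sign[of t] by auto
    next
      case 2
      then have "Re z * Im z > 0" using assms by (simp add: mult_neg_neg)
      then have "sin (t - 2*pi) > 0" using sg by (metis sgn_greater sin_2pi_minus sin_minus minus_diff_eq minus_minus)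
      moreover have "0 < t - 2*pi" "t - 2*pi < 2*pi" using Im_lt_0_Arg2pi[of "z+1"] Im_lt_0_Arg2pi[of "z-1"] 2 by (auto simp: t_def)
      ultimately show ?thesis using half_turn_of_sin_sign[of "t - 2*pi"] by auto
    next
      case 3
      have "Arg2pi (z - 1) = pi"
        using Arg2pi_eq_pi[of "z - 1"] 3 assms by (auto simp: complex_is_Real_iff)
      moreover have "Arg2pi (z + 1) = 0 \<or> Arg2pi (z + 1) = pi"
        using Arg2pi_eq_0_pi[of "z + 1"] 3 by (auto simp: complex_is_Real_iff)
      ultimately show ?thesis by (auto simp: t_def)
    qed
  qed
  have "1 - z\<^sup>2 = of_real (cmod (1 - z\<^sup>2)) * cis (t - pi)"
  proof -
    have "t + pi = (t - pi) + 2 * pi" by simp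
    then have "cis (t + pi) = cis (t - pi)" by (simp only: cis_mult[symmetric] cis_2pi) simp
    then show ?thesis using one_minus_square_polar[of z] unfolding t_def[symmetric] by metis
  qed
  then have "Arg2pi (1 - z\<^sup>2) = t - pi" using assms \<open>pi \<le> t \<and> t < 3 * pi\<close> by (intro Arg2pi_polar) auto
  moreover have "cis ((t + pi) / 2) = - cis ((t - pi) / 2)"
  proof -
    have "(t + pi) / 2 = (t - pi)/2 + pi" by (simp add: field_simps)
    then show ?thesis by (simp only: cis_mult[symmetric] cis_pi) simp
  qed
  ultimately show ?thesis unfolding root_prod_polar by (simp add: t_def)
qed

lemma root_prod_right:
  assumes "Re z > 0" "1 - z\<^sup>2 \<notin> \<real>\<^sub>\<ge>\<^sub>0"
  shows "root_prod z = of_real (sqrt (cmod (1 - z\<^sup>2))) * cis (Arg2pi (1 - z\<^sup>2) / 2)"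
proof -
  have nz: "1 - z\<^sup>2 \<noteq> 0" using assms(2) by (metis nonneg_Reals_zero_I)
  define t where "t = Arg2pi (z + 1) + Arg2pi (z - 1)"
  have sg: "sgn (sin t) = sgn (Re z * Im z)" using sin_Arg2pi_sum[OF nz] by (simp add: t_def)
  have "0 \<le> t \<and> t < pi \<or> 3 * pi \<le> t \<and> t < 5 * pi"
  proof -
    consider "Im z > 0" | "Im z < 0" | "Im z = 0" by linarith
    then show ?thesis
    proof cases
      case 1
      then have "Re z * Im z > 0" using assms by simp
      then have "sin t > 0" using sg by (metis sgn_greater)
      moreover have "0 < t" "t < 2*pi" using Im_gt_0_Arg2pi[of "z+1"] Im_gt_0_Arg2pi[of "z-1"] 1 by (auto simp: t_def)
      ultimately show ?thesis using half_turn_of_sin_sign[of t] by auto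
    next
      case 2
      then have "Re z * Im z < 0" using assms by (simp add: mult_pos_neg)
      then have "sin (t - 2*pi) < 0" using sg by (metis sgn_less sin_2pi_minus sin_minus minus_diff_eq minus_minus)
      moreover have "0 < t - 2*pi" "t - 2*pi < 2*pi" using Im_lt_0_Arg2pi[of "z+1"] Im_lt_0_Arg2pi[of "z-1"] 2 by (auto simp: t_def)
      ultimately show ?thesis using half_turn_of_sin_sign[of "t - 2*pi"] by auto
    next
      case 3
      have "Re z > 1"
      proof (rule ccontr)
        assume "\<not> Re z > 1"
        then have "(Re z)\<^sup>2 \<le> 1" using assms by (simp add: power_le_one)
        then have "1 - z\<^sup>2 \<in> \<real>\<^sub>\<ge>\<^sub>0" using 3 by (simp add: complex_nonneg_Reals_iff power2_eq_square)
        then show False using assms by simp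
      qed
      then have "Arg2pi (z - 1) = 0" "Arg2pi (z + 1) = 0"
        using Arg2pi_eq_0[of "z - 1"] Arg2pi_eq_0[of "z + 1"] 3 by (auto simp: complex_is_Real_iff)
      then show ?thesis by (auto simp: t_def)
    qed
  qed
  then show ?thesis
  proof
    assume t: "0 \<le> t \<and> t < pi"
    have "1 - z\<^sup>2 = of_real (cmod (1 - z\<^sup>2)) * cis (t + pi)"
      using one_minus_square_polar[of z] unfolding t_def[symmetric] .
    then have "Arg2pi (1 - z\<^sup>2) = t + pi" using nz t by (intro Arg2pi_polar) auto
    then show ?thesis unfolding root_prod_polar by (simp add: t_def)
  next
    assume t: "3 * pi \<le> t \<and> t < 5 * pi"
    have c: "cis (t + pi) = cis (t - 3 * pi)"
    proof -
      have "t + pi = (t - 3 * pi) + (2 * pi + 2 * pi)" by simp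
      then show ?thesis by (simp only: cis_mult[symmetric] cis_2pi) simp
    qed
    have "1 - z\<^sup>2 = of_real (cmod (1 - z\<^sup>2)) * cis (t - 3 * pi)"
      using one_minus_square_polar[of z] unfolding t_def[symmetric] c .
    then have "Arg2pi (1 - z\<^sup>2) = t - 3 * pi" using nz t by (intro Arg2pi_polar) auto
    moreover have "cis ((t + pi) / 2) = cis ((t - 3 * pi) / 2)"
    proof -
      have "(t + pi) / 2 = (t - 3 * pi)/2 + 2 * pi" by (simp add: field_simps)
      then show ?thesis by (simp only: cis_mult[symmetric] cis_2pi) simp
    qed
    ultimately show ?thesis unfolding root_prod_polar by (simp add: t_def)
  qed
qed

lemma q_altdef: "q m z = 1 - \<i> * of_real (sqrt 2) / ((1 - z\<^sup>2) ^ m * root_prod z)"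
  by (simp add: q_def root_prod_def mult.assoc)

lemma q_eq_0_iff: "q m z = 0 \<longleftrightarrow> (1 - z\<^sup>2) ^ m * root_prod z = \<i> * of_real (sqrt 2)"
proof -
  have *: "1 - a / b = 0 \<longleftrightarrow> b = a" if "a \<noteq> 0" for a b :: complex
    using that by (cases "b = 0") auto
  show ?thesis unfolding q_altdef by (rule *) simp
qed

lemma q_zero_power: assumes "q m z = 0" shows "(1 - z\<^sup>2) ^ (2 * m + 1) = -2"
proof -
  have "((1 - z\<^sup>2) ^ m * root_prod z)\<^sup>2 = (\<i> * of_real (sqrt 2))\<^sup>2"
    using assms q_eq_0_iff by simp
  then have "((1 - z\<^sup>2) ^ m)\<^sup>2 * (1 - z\<^sup>2) = -2"
    by (simp add: power_mult_distrib root_prod_square flip: of_real_power)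
  moreover have "((1 - z\<^sup>2) ^ m)\<^sup>2 = (1 - z\<^sup>2) ^ (2 * m)" by (simp add: power_mult[symmetric] mult.commute)
  ultimately show ?thesis by (simp add: mult.commute)
qed

lemma q_zero_modulus: assumes "q m z = 0" shows "cmod (1 - z\<^sup>2) = 2 powr (1 / (2 * real m + 1))"
proof -
  have "cmod (1 - z\<^sup>2) ^ (2 * m + 1) = 2" using q_zero_power[OF assms] by (metis norm_power norm_minus_cancel norm_numeral)
  then have p: "cmod (1 - z\<^sup>2) > 0" by (metis norm_le_zero_iff not_le norm_zero power_0_left zero_neq_numeral add_is_0 one_neq_zero)
  have "cmod (1 - z\<^sup>2) powr (2 * real m + 1) = 2" using \<open>cmod (1 - z\<^sup>2) ^ (2 * m + 1) = 2\<close> p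
    by (metis (no_types, opaque_lifting) of_nat_1 of_nat_add of_nat_mult of_nat_numeral powr_realpow)
  then have "(cmod (1 - z\<^sup>2) powr (2 * real m + 1)) powr (1 / (2 * real m + 1)) = 2 powr (1 / (2 * real m + 1))" by simp
  then show ?thesis using p by (simp add: powr_powr)
qed

text \<open>An odd power of 1 - z^2 is negative at a zero of q.\<close>

lemma q_zero_not_nonneg: assumes "q m z = 0" shows "1 - z\<^sup>2 \<notin> \<real>\<^sub>\<ge>\<^sub>0" "Re z \<noteq> 0"
proof -
  show *: "1 - z\<^sup>2 \<notin> \<real>\<^sub>\<ge>\<^sub>0"
  proof
    assume "1 - z\<^sup>2 \<in> \<real>\<^sub>\<ge>\<^sub>0"
    then obtain r where r: "1 - z\<^sup>2 = of_real r" "r \<ge> 0" by (metis nonneg_Reals_cases)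
    then have "complex_of_real (r ^ (2*m+1)) = of_real (-2)" using q_zero_power[OF assms] by simp
    then have "r ^ (2*m+1) = -2" using of_real_eq_iff by blast
    then show False using r by (metis zero_le_power neg_0_le_iff_le not_numeral_le_zero)
  qed
  show "Re z \<noteq> 0"
  proof
    assume "Re z = 0"
    then have "1 - z\<^sup>2 \<in> \<real>\<^sub>\<ge>\<^sub>0" by (simp add: complex_nonneg_Reals_iff power2_eq_square)
    then show False using * by simp
  qed
qed

lemma q_zero_phase:
  assumes "m \<ge> 1" "w \<noteq> 0" "cmod w = 2 powr (1 / (2 * real m + 1))" "\<theta> = Arg2pi w"
  shows "w ^ m * (of_real s * (of_real (sqrt (cmod w)) * cis (\<theta> / 2))) =
      of_real s * of_real (sqrt 2) * cis ((real m + 1/2) * \<theta>)"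
proof -
  have pos: "cmod w > 0" using assms by simp
  have "w ^ m = of_real (cmod w ^ m) * cis (real m * \<theta>)"
    using arg_cong[OF polar_Arg2pi[of w], of "\<lambda>u. u ^ m"] by (simp only: assms(4) power_mult_distrib Complex.DeMoivre of_real_power)
  moreover have "cmod w ^ m * sqrt (cmod w) = sqrt 2"
  proof -
    have "cmod w ^ m * sqrt (cmod w) = cmod w powr (real m + 1/2)"
      using pos by (simp add: powr_add powr_realpow powr_half_sqrt)
    also have "\<dots> = 2 powr (1 / (2 * real m + 1) * (real m + 1/2))"
      by (simp add: assms(3) powr_powr)
    also have "1 / (2 * real m + 1) * (real m + 1/2) = 1/2" by (simp add: field_simps)
    finally show ?thesis by (simp add: powr_half_sqrt)
  qed
  moreover have "cis (real m * \<theta>) * cis (\<theta>/2) = cis ((real m + 1/2) * \<theta>)"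
    by (simp add: cis_mult algebra_simps)
  moreover have "of_real a * c * (e * (of_real b * d)) = e * of_real (a * b) * (c * d)"
    for a b and c d e :: complex by simp
  ultimately show ?thesis by (simp only:)
qed

lemma cis_eq_iff_shift: "cis x = cis a \<longleftrightarrow> (\<exists>k::int. x = a + 2 * pi * real_of_int k)"
proof -
  have "cis x = cis a \<longleftrightarrow> exp (\<i> * of_real x) = exp (\<i> * of_real a)" by (simp add: cis_conv_exp)
  also have "\<dots> \<longleftrightarrow> (\<exists>n::int. \<i> * of_real x = \<i> * of_real a + of_int (2 * n) * of_real pi * \<i>)"
    by (simp add: exp_eq)
  also have "\<dots> \<longleftrightarrow> (\<exists>k::int. x = a + 2 * pi * real_of_int k)"
    by (auto simp: complex_eq_iff algebra_simps)
  finally show ?thesis .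
qed

text \<open>On the half-plane with sign \<sigma>, the product of the two roots is \<sigma> times the root of 1 - z^2 with half
  the argument \<theta> in [0, 2\<pi>), so q = 0 says that 1 - z^2 has modulus 2^(1/(2m+1)) and
  that cis ((m + 1/2) \<theta>) = \<sigma> i. The condition on I lists the solutions \<theta> in [0, 2\<pi>).\<close>

lemma enumerate_zeros:
  fixes \<sigma> :: real
  assumes m: "m \<ge> 1" and \<sigma>: "\<sigma> = 1 \<or> \<sigma> = -1"
    and range: "\<And>k::int. 0 \<le> \<sigma> * pi / 2 + 2 * pi * real_of_int k \<and>
        \<sigma> * pi / 2 + 2 * pi * real_of_int k < (2 * real m + 1) * pi \<longleftrightarrow> k \<in> int ` I"
  shows "\<exists>zs. bij_betw zs I {z. q m z = 0 \<and> 0 < \<sigma> * Re z} \<and>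
     (\<forall>k\<in>I. (real m + 1/2) * Arg2pi (1 - (zs k)\<^sup>2) = \<sigma> * pi / 2 + 2 * pi * real k)"
proof -
  define N where "N = real m + 1/2"
  have N: "N > 0" by (simp add: N_def)
  define \<rho> where "\<rho> = 2 powr (1 / (2 * real m + 1))"
  have \<rho>: "\<rho> > 0" by (simp add: \<rho>_def)
  define \<theta> where "\<theta> k = (\<sigma> * pi / 2 + 2 * pi * real k) / N" for k :: nat
  define w where "w k = of_real \<rho> * cis (\<theta> k)" for k :: nat
  define zs where "zs k = of_real \<sigma> * csqrt (1 - w k)" for k :: nat
  have \<sigma>2: "\<sigma>\<^sup>2 = 1" using \<sigma> by auto
  have wz: "1 - (zs k)\<^sup>2 = w k" for k
    using \<sigma>2 by (simp add: zs_def power_mult_distrib flip: of_real_power)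
  have root: "root_prod z = of_real \<sigma> * (of_real (sqrt (cmod (1 - z\<^sup>2))) * cis (Arg2pi (1 - z\<^sup>2) / 2))"
    if "0 < \<sigma> * Re z" "1 - z\<^sup>2 \<notin> \<real>\<^sub>\<ge>\<^sub>0" for z
  proof (cases "\<sigma> = 1")
    case True then show ?thesis using root_prod_right[of z] that by simp
  next
    case False
    have "1 - z\<^sup>2 \<noteq> 0" using that(2) by (metis nonneg_Reals_zero_I)
    then show ?thesis using root_prod_left[of z] that False \<sigma> by simp
  qed
  have \<theta>: "0 \<le> \<theta> k" "\<theta> k < 2 * pi" "\<theta> k \<noteq> 0" if "k \<in> I" for k
  proof -
    have r: "0 \<le> \<sigma> * pi / 2 + 2 * pi * real k" "\<sigma> * pi / 2 + 2 * pi * real k < (2 * real m + 1) * pi"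
      using range[of "int k"] that by auto
    show "0 \<le> \<theta> k" using r N by (simp add: \<theta>_def)
    show "\<theta> k < 2 * pi" using r N by (simp add: \<theta>_def divide_less_eq) (simp add: N_def algebra_simps)
    show "\<theta> k \<noteq> 0"
    proof
      assume "\<theta> k = 0"
      then have "pi * (\<sigma> + 4 * real k) = 0" using N by (simp add: \<theta>_def algebra_simps)
      then have "\<bar>\<sigma>\<bar> = 4 * real k" using \<sigma> by auto
      then have "real (4 * k) = real 1" using \<sigma> by auto
      then have "4 * k = 1" by (simp only: of_nat_eq_iff)
      then show False by presburger
    qed
  qed
  have cw: "cmod (w k) = \<rho>" for k using \<rho> by (simp add: w_def norm_mult)
  have w0: "w k \<noteq> 0" for k using cw[of k] \<rho> by auto
  have arg: "Arg2pi (w k) = \<theta> k" if "k \<in> I" for k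
    using \<theta>[OF that] by (intro Arg2pi_polar w0) (auto simp: cw, auto simp: w_def)
  have wnn: "w k \<notin> \<real>\<^sub>\<ge>\<^sub>0" if "k \<in> I" for k
    using arg[OF that] \<theta>[OF that] Arg2pi_eq_0[of "w k"] by (auto simp: complex_nonneg_Reals_iff complex_is_Real_iff)
  have Rez: "0 < \<sigma> * Re (zs k)" if "k \<in> I" for k
  proof -
    have "1 - w k \<notin> \<real>\<^sub>\<le>\<^sub>0" using wnn[OF that] by (auto simp: complex_nonneg_Reals_iff complex_nonpos_Reals_iff)
    then have "Re (csqrt (1 - w k)) > 0" by (rule Re_csqrt_pos)
    moreover have "\<sigma> * Re (zs k) = \<sigma>\<^sup>2 * Re (csqrt (1 - w k))" by (simp add: zs_def power2_eq_square)
    ultimately show ?thesis using \<sigma>2 by simp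
  qed
  have zero: "q m (zs k) = 0" if "k \<in> I" for k
  proof -
    have "(1 - (zs k)\<^sup>2) ^ m * root_prod (zs k) = of_real \<sigma> * of_real (sqrt 2) * cis (N * \<theta> k)"
      using q_zero_phase[OF m w0 cw[unfolded \<rho>_def], OF arg[OF that, symmetric], of "\<sigma>"] 
        root[OF Rez[OF that]] wnn[OF that] by (simp add: wz arg[OF that] N_def)
    also have "N * \<theta> k = \<sigma> * pi / 2 + 2 * pi * real k" using N by (simp add: \<theta>_def)
    also have "cis \<dots> = cis (\<sigma> * pi / 2)" using cis_eq_iff_shift by (metis of_int_of_nat_eq)
    also have "of_real \<sigma> * of_real (sqrt 2) * cis (\<sigma> * pi / 2) = \<i> * of_real (sqrt 2)"
      using \<sigma> by auto
    finally show ?thesis by (simp add: q_eq_0_iff)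
  qed
  have "inj_on zs I"
  proof (rule inj_onI)
    fix j k assume "j \<in> I" "k \<in> I" "zs j = zs k"
    then have "\<theta> j = \<theta> k" using arg wz by metis
    then show "j = k" using N by (simp add: \<theta>_def)
  qed
  moreover have "zs ` I = {z. q m z = 0 \<and> 0 < \<sigma> * Re z}"
  proof (intro equalityI subsetI)
    fix z assume "z \<in> zs ` I" then show "z \<in> {z. q m z = 0 \<and> 0 < \<sigma> * Re z}" using zero Rez by auto
  next
    fix z assume "z \<in> {z. q m z = 0 \<and> 0 < \<sigma> * Re z}"
    then have z: "q m z = 0" "0 < \<sigma> * Re z" by auto
    define t where "t = Arg2pi (1 - z\<^sup>2)"
    have nz: "1 - z\<^sup>2 \<noteq> 0" using q_zero_not_nonneg(1)[OF z(1)] by (metis nonneg_Reals_zero_I)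
    have "of_real \<sigma> * of_real (sqrt 2) * cis (N * t) = \<i> * of_real (sqrt 2)"
      using z(1) q_zero_phase[OF m nz q_zero_modulus[OF z(1)] t_def, of \<sigma>]
      unfolding q_eq_0_iff root[OF z(2) q_zero_not_nonneg(1)[OF z(1)]] t_def N_def by (rule trans[OF sym, rotated])
    then have "of_real \<sigma> * cis (N * t) = \<i>" by (simp add: field_simps)
    then have "cis (N * t) = of_real \<sigma> * \<i>" using \<sigma> by (auto simp: minus_equation_iff)
    also have "\<dots> = cis (\<sigma> * pi / 2)" using \<sigma> by auto
    finally obtain k :: int where k: "N * t = \<sigma> * pi / 2 + 2 * pi * real_of_int k"
      using cis_eq_iff_shift by blast
    have "0 \<le> N * t" "N * t < N * (2 * pi)" using N Arg2pi_ge_0 Arg2pi_lt_2pi by (auto simp: t_def)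
    then have "k \<in> int ` I" using range[of k] k by (simp add: N_def algebra_simps)
    then obtain j where j: "j \<in> I" "k = int j" by auto
    have "t = \<theta> j" using k j N by (simp add: \<theta>_def field_simps)
    then have "1 - z\<^sup>2 = w j" using polar_Arg2pi[of "1 - z\<^sup>2"] q_zero_modulus[OF z(1)]
      by (simp add: w_def t_def \<rho>_def)
    then have "csqrt ((of_real \<sigma> * z)\<^sup>2) = of_real \<sigma> * zs j" using \<sigma>2 wz[of j] 
      by (simp add: zs_def power_mult_distrib flip: of_real_power power2_eq_square mult.assoc of_real_mult)
         (metis diff_diff_eq2 diff_add_cancel add_diff_cancel_left')
    moreover have "csqrt ((of_real \<sigma> * z)\<^sup>2) = of_real \<sigma> * z"
      by (rule csqrt_unique) (use z(2) in auto)
    ultimately have "z = zs j" using \<sigma> by auto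
    then show "z \<in> zs ` I" using j by auto
  qed
  ultimately have "bij_betw zs I {z. q m z = 0 \<and> 0 < \<sigma> * Re z}" by (simp add: bij_betw_def)
  moreover have "(real m + 1/2) * Arg2pi (1 - (zs k)\<^sup>2) = \<sigma> * pi / 2 + 2 * pi * real k" if "k \<in> I" for k
    unfolding wz arg[OF that] using N by (simp add: \<theta>_def N_def)
  ultimately show ?thesis by blast
qed

lemma ex_left_enumeration: assumes "m \<ge> 1" shows "\<exists>zs. enumerates_left_zeros m zs"
proof -
  have "\<exists>zs. bij_betw zs {1..m} {z. q m z = 0 \<and> 0 < (-1) * Re z} \<and>
     (\<forall>k\<in>{1..m}. (real m + 1/2) * Arg2pi (1 - (zs k)\<^sup>2) = (-1) * pi / 2 + 2 * pi * real k)"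
  proof (rule enumerate_zeros[OF assms])
    fix k :: int
    have "0 \<le> - 1 * pi / 2 + 2 * pi * real_of_int k \<longleftrightarrow> 0 \<le> pi * (2 * real_of_int k - 1/2)"
      by (simp add: algebra_simps)
    also have "\<dots> \<longleftrightarrow> 1 \<le> k" using mult_le_cancel_left_pos[OF pi_gt_zero, of 0] by (simp, linarith)
    finally have 1: "0 \<le> - 1 * pi / 2 + 2 * pi * real_of_int k \<longleftrightarrow> 1 \<le> k" .
    have "- 1 * pi / 2 + 2 * pi * real_of_int k < (2 * real m + 1) * pi \<longleftrightarrow>
        pi * (2 * real_of_int k - 1/2) < pi * (2 * real m + 1)" by (simp add: algebra_simps)
    also have "\<dots> \<longleftrightarrow> k \<le> int m" by (subst mult_less_cancel_left_pos) (simp, linarith)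
    finally show "0 \<le> - 1 * pi / 2 + 2 * pi * real_of_int k \<and>
      - 1 * pi / 2 + 2 * pi * real_of_int k < (2 * real m + 1) * pi \<longleftrightarrow> k \<in> int ` {1..m}"
      using 1 by (auto simp: image_iff intro!: bexI[of _ "nat k"])
  qed auto
  then show ?thesis by (simp add: enumerates_left_zeros_def)
qed

lemma ex_right_enumeration: assumes "m \<ge> 1" shows "\<exists>zs. enumerates_right_zeros m zs"
proof -
  have "\<exists>zs. bij_betw zs {0..m} {z. q m z = 0 \<and> 0 < 1 * Re z} \<and>
     (\<forall>k\<in>{0..m}. (real m + 1/2) * Arg2pi (1 - (zs k)\<^sup>2) = 1 * pi / 2 + 2 * pi * real k)"
  proof (rule enumerate_zeros[OF assms])
    fix k :: int
    have "0 \<le> 1 * pi / 2 + 2 * pi * real_of_int k \<longleftrightarrow> 0 \<le> pi * (2 * real_of_int k + 1/2)"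
      by (simp add: algebra_simps)
    also have "\<dots> \<longleftrightarrow> 0 \<le> k" using mult_le_cancel_left_pos[OF pi_gt_zero, of 0] by (simp, linarith)
    finally have 1: "0 \<le> 1 * pi / 2 + 2 * pi * real_of_int k \<longleftrightarrow> 0 \<le> k" .
    have "1 * pi / 2 + 2 * pi * real_of_int k < (2 * real m + 1) * pi \<longleftrightarrow>
        pi * (2 * real_of_int k + 1/2) < pi * (2 * real m + 1)" by (simp add: algebra_simps)
    also have "\<dots> \<longleftrightarrow> k \<le> int m" by (subst mult_less_cancel_left_pos) (simp, linarith)
    finally show "0 \<le> 1 * pi / 2 + 2 * pi * real_of_int k \<and>
      1 * pi / 2 + 2 * pi * real_of_int k < (2 * real m + 1) * pi \<longleftrightarrow> k \<in> int ` {0..m}"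
      using 1 by (auto simp: image_iff intro!: bexI[of _ "nat k"])
  qed auto
  moreover have "{z. q m z = 0 \<and> 0 < 1 * Re z} = {z. q m z = 0 \<and> 0 \<le> Re z}"
    using q_zero_not_nonneg(2) by (auto simp: order_less_le)
  ultimately show ?thesis by (simp add: enumerates_right_zeros_def)
qed

section \<open>The Jacobi polynomial as a Taylor coefficient\<close>

text \<open>Expand (z - 1)^k = ((1 + z) - 2)^k and collect the powers of 1 + z. The inner sums are evaluated by
  trinomial revision and the Vandermonde identity, with upper index (-1/2 - j) + (2m + 1/2) = 2m - j.\<close>

lemma jacobi_P_expansion:
  "poly (jacobi_P m) z = (\<Sum>j\<le>m. ((-1/2) gchoose j) * (-2) ^ j * of_nat ((2 * m - j) choose m) * (1 + z) ^ (m - j)) / 2 ^ m"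
proof -
  define a :: complex where "a = 2 * of_nat m + 1/2"
  define h :: complex where "h = -1/2"
  have "poly (jacobi_P m) z * 2 ^ m = (\<Sum>k\<le>m. (a gchoose (m - k)) * (h gchoose k) * ((1 + z) + (-2)) ^ k * (1 + z) ^ (m - k))"
    by (simp add: jacobi_P_def a_def h_def poly_sum algebra_simps)
  also have "\<dots> = (\<Sum>k\<le>m. \<Sum>j\<le>k. (a gchoose (m - k)) * (h gchoose k) * of_nat (k choose j) * (-2) ^ j * (1 + z) ^ (m - j))"
  proof (rule sum.cong[OF refl])
    fix k assume k: "k \<in> {..m}"
    have "((1 + z) + (-2)) ^ k = (\<Sum>j\<le>k. of_nat (k choose j) * (-2) ^ j * (1 + z) ^ (k - j))"
      using binomial_ring[of "-2" "1 + z" k] by (simp only: add.commute)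
    then have "(a gchoose (m - k)) * (h gchoose k) * ((1 + z) + (-2)) ^ k * (1 + z) ^ (m - k) =
        (\<Sum>j\<le>k. (a gchoose (m - k)) * (h gchoose k) * (of_nat (k choose j) * (-2) ^ j * (1 + z) ^ (k - j)) * (1 + z) ^ (m - k))"
      by (simp only: sum_distrib_left sum_distrib_right)
    also have "\<dots> = (\<Sum>j\<le>k. (a gchoose (m - k)) * (h gchoose k) * of_nat (k choose j) * (-2) ^ j * (1 + z) ^ (m - j))"
    proof (rule sum.cong[OF refl])
      fix j assume "j \<in> {..k}"
      then have "m - j = (k - j) + (m - k)" using k by auto
      then have "(1 + z) ^ (m - j) = (1 + z) ^ (k - j) * (1 + z) ^ (m - k)" by (simp only: power_add)
      then show "(a gchoose (m - k)) * (h gchoose k) * (of_nat (k choose j) * (-2) ^ j * (1 + z) ^ (k - j)) * (1 + z) ^ (m - k)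
        = (a gchoose (m - k)) * (h gchoose k) * of_nat (k choose j) * (-2) ^ j * (1 + z) ^ (m - j)"
        by (simp only: mult.assoc)
    qed
    finally show "(a gchoose (m - k)) * (h gchoose k) * ((1 + z) + (-2)) ^ k * (1 + z) ^ (m - k) =
        (\<Sum>j\<le>k. (a gchoose (m - k)) * (h gchoose k) * of_nat (k choose j) * (-2) ^ j * (1 + z) ^ (m - j))" .
  qed
  also have "\<dots> = (\<Sum>j\<le>m. \<Sum>k\<in>{j..m}. (a gchoose (m - k)) * (h gchoose k) * of_nat (k choose j) * (-2) ^ j * (1 + z) ^ (m - j))"
    unfolding sum.Sigma[OF finite_atMost ballI[OF finite_atMost]] sum.Sigma[OF finite_atMost ballI[OF finite_atLeastAtMost]]
    by (rule sum.reindex_bij_witness[of _ "\<lambda>(j, k). (k, j)" "\<lambda>(k, j). (j, k)"]) auto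
  also have "\<dots> = (\<Sum>j\<le>m. (h gchoose j) * (-2) ^ j * of_nat ((2 * m - j) choose m) * (1 + z) ^ (m - j))"
  proof (rule sum.cong[OF refl])
    fix j assume j: "j \<in> {..m}"
    have "(\<Sum>k\<in>{j..m}. (a gchoose (m - k)) * (h gchoose k) * of_nat (k choose j))
        = (\<Sum>k\<in>{j..m}. (h gchoose j) * (((h - of_nat j) gchoose (k - j)) * (a gchoose (m - k))))"
    proof (rule sum.cong[OF refl])
      fix k assume "k \<in> {j..m}"
      then have "(h gchoose k) * of_nat (k choose j) = (h gchoose j) * ((h - of_nat j) gchoose (k - j))"
        using gbinomial_trinomial_revision[of j k h] by (simp add: binomial_gbinomial)
      then show "(a gchoose (m - k)) * (h gchoose k) * of_nat (k choose j) =
         (h gchoose j) * (((h - of_nat j) gchoose (k - j)) * (a gchoose (m - k)))"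
        by (simp add: mult_ac)
    qed
    also have "\<dots> = (h gchoose j) * (\<Sum>k\<in>{0..m-j}. ((h - of_nat j) gchoose k) * (a gchoose ((m - j) - k)))"
    proof -
      have "(\<Sum>k\<in>{j..m}. ((h - of_nat j) gchoose (k - j)) * (a gchoose (m - k)))
        = (\<Sum>k\<in>{0..m-j}. ((h - of_nat j) gchoose k) * (a gchoose ((m - j) - k)))"
        using j by (intro sum.reindex_bij_witness[of _ "\<lambda>k. k + j" "\<lambda>k. k - j"]) (auto simp: add.commute)
      then show ?thesis by (simp only: sum_distrib_left[symmetric])
    qed
    also have "\<dots> = (h gchoose j) * ((h - of_nat j + a) gchoose (m - j))"
      by (simp only: gbinomial_Vandermonde)
    also have "h - of_nat j + a = of_nat (2 * m - j)"
      using j by (simp add: h_def a_def of_nat_diff)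
    also have "of_nat (2 * m - j) gchoose (m - j) = of_nat ((2 * m - j) choose m)"
    proof -
      have "(2 * m - j) choose (m - j) = (2 * m - j) choose m"
        using j binomial_symmetric[of m "2 * m - j"] by (simp add: mult_2)
      then show ?thesis by (metis binomial_gbinomial)
    qed
    finally have *: "(\<Sum>k\<in>{j..m}. (a gchoose (m - k)) * (h gchoose k) * of_nat (k choose j)) = (h gchoose j) * of_nat ((2 * m - j) choose m)" .
    show "(\<Sum>k\<in>{j..m}. (a gchoose (m - k)) * (h gchoose k) * of_nat (k choose j) * (-2) ^ j * (1 + z) ^ (m - j))
      = (h gchoose j) * (-2) ^ j * of_nat ((2 * m - j) choose m) * (1 + z) ^ (m - j)"
      by (simp only: sum_distrib_right[symmetric] *) (simp add: mult_ac)
  qed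
  finally show ?thesis by (simp add: h_def eq_divide_eq)
qed

text \<open>The Taylor coefficients of (1 - x)^(-1/2).\<close>

definition half_coeff :: "nat \<Rightarrow> real" where
  "half_coeff n = real ((2 * n) choose n) / 4 ^ n"

lemma half_coeff_0 [simp]: "half_coeff 0 = 1" by (simp add: half_coeff_def)

lemma half_coeff_Suc: "half_coeff (Suc n) = half_coeff n * (2 * real n + 1) / (2 * real n + 2)"
proof -
  have "real ((2 * Suc n) choose Suc n) = fact (2 * Suc n) / (fact (Suc n) * fact (Suc n))"
  proof -
    have "2 * Suc n - Suc n = Suc n" "Suc n \<le> 2 * Suc n" by simp_all
    then show ?thesis using binomial_fact[of "Suc n" "2 * Suc n", where 'a=real] by metis
  qed
  also have "\<dots> = (2 * real n + 2) * (2 * real n + 1) * fact (2 * n) / ((real n + 1)\<^sup>2 * (fact n * fact n))"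
    by (simp add: power2_eq_square field_simps)
  also have "\<dots> = (2 * real n + 2) * (2 * real n + 1) / (real n + 1)\<^sup>2 * real ((2 * n) choose n)"
  proof -
    have "2 * n - n = n" "n \<le> 2 * n" by simp_all
    then have "real ((2 * n) choose n) = fact (2 * n) / (fact n * fact n)"
      using binomial_fact[of n "2 * n", where 'a=real] by metis
    then show ?thesis by simp
  qed
  also have "(2 * real n + 2) * (2 * real n + 1) / (real n + 1)\<^sup>2 = 4 * ((2 * real n + 1) / (2 * real n + 2))"
    by (simp add: power2_eq_square divide_simps) (simp add: algebra_simps)
  finally have e: "real ((2 * Suc n) choose Suc n) = 4 * ((2 * real n + 1) / (2 * real n + 2)) * real ((2 * n) choose n)" .
  have g: "4 * (u / v) * b / (4 * d) = b / d * u / v" for b d u v :: real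
    by (cases "v = 0 \<or> d = 0") (auto simp: field_simps)
  show ?thesis unfolding half_coeff_def e power_Suc by (rule g)
qed

lemma half_coeff_pos: "half_coeff n > 0" by (simp add: half_coeff_def)

text \<open>The sequence n a(n)^2 increases, and equals 1/4 at n = 1.\<close>

lemma half_coeff_lower: assumes "n \<ge> 1" shows "half_coeff n \<ge> 1 / (2 * sqrt (real n))"
proof -
  have "1/4 \<le> real n * (half_coeff n)\<^sup>2" using assms
  proof (induction n rule: dec_induct)
    case base
    have *: "half_coeff (Suc 0) = 1/2" using half_coeff_Suc[of 0] by simp
    show ?case unfolding One_nat_def * by (simp add: power2_eq_square)
  next
    case (step n)
    have "real n * (4 * real n + 4) \<le> (2 * real n + 1)\<^sup>2" by (simp add: power2_eq_square algebra_simps)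
    then have "real n \<le> (2 * real n + 1)\<^sup>2 / (4 * real n + 4)" by (simp add: le_divide_eq)
    also have "\<dots> = (real n + 1) * ((2 * real n + 1) / (2 * real n + 2))\<^sup>2"
      by (simp add: power2_eq_square divide_simps) (simp add: algebra_simps)
    finally have "real n \<le> (real n + 1) * ((2 * real n + 1) / (2 * real n + 2))\<^sup>2" .
    then have "real n * (half_coeff n)\<^sup>2 \<le> (real n + 1) * ((2 * real n + 1) / (2 * real n + 2))\<^sup>2 * (half_coeff n)\<^sup>2"
      by (rule mult_right_mono) simp
    also have "\<dots> = real (Suc n) * (half_coeff (Suc n))\<^sup>2"
      by (simp add: half_coeff_Suc power_divide power_mult_distrib)
    finally show ?case using step.IH by linarith
  qed
  then have "(1/2)\<^sup>2 \<le> (sqrt (real n) * half_coeff n)\<^sup>2"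
    by (simp add: power_mult_distrib power_divide)
  then have "1/2 \<le> sqrt (real n) * half_coeff n"
    by (rule power2_le_imp_le) (simp add: half_coeff_pos order_less_imp_le)
  then show ?thesis using assms by (simp add: field_simps)
qed

lemma gbinomial_minus_half: "((-1/2 :: complex) gchoose n) * (-1) ^ n = of_real (half_coeff n)"
proof (induction n)
  case (Suc n)
  have "of_nat (Suc n) * ((-1/2 :: complex) gchoose (Suc n)) = (-1/2 - of_nat n) * ((-1/2) gchoose n)"
    using gbinomial_mult_1[of "-1/2 :: complex" n] by (simp add: algebra_simps)
  then have "((-1/2 :: complex) gchoose (Suc n)) = (-1/2 - of_nat n) * ((-1/2) gchoose n) / of_nat (Suc n)"
    by (metis nonzero_mult_div_cancel_left of_nat_eq_0_iff nat.distinct(1))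
  then have "((-1/2 :: complex) gchoose (Suc n)) * (-1) ^ Suc n
     = (((-1/2) gchoose n) * (-1) ^ n) * ((1/2 + of_nat n) / of_nat (Suc n))"
    by (simp add: field_simps)
  also have "\<dots> = of_real (half_coeff n) * ((1/2 + of_nat n) / of_nat (Suc n))" by (simp only: Suc.IH)
  also have "(1/2 + of_nat n) / of_nat (Suc n) = complex_of_real ((2 * real n + 1) / (2 * real n + 2))"
  proof -
    have "(2 * real n + 1) / (2 * real n + 2) = (1/2 + real n) / real (Suc n)" by (simp add: field_simps)
    then show ?thesis by simp
  qed
  finally show ?case by (simp only: half_coeff_Suc of_real_mult[symmetric] times_divide_eq_right)
qed simp

definition inv_sqrt_fps :: "complex \<Rightarrow> complex fps" where
  "inv_sqrt_fps c = fps_binomial (-1/2) oo (fps_const (- c) * fps_X)"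

lemma inv_sqrt_fps_nth: "fps_nth (inv_sqrt_fps c) n = of_real (half_coeff n) * c ^ n"
proof -
  have "fps_nth (inv_sqrt_fps c) n = (- c) ^ n * ((-1/2) gchoose n)" 
    by (simp add: inv_sqrt_fps_def)
  also have "(- c) ^ n = (-1) ^ n * c ^ n" by (simp only: power_mult_distrib[symmetric]) simp
  finally show ?thesis using gbinomial_minus_half[of n] by (simp add: mult_ac)
qed

lemma has_fps_expansion_linear: "(\<lambda>x. c * x) has_fps_expansion (fps_const c * fps_X)" for c :: complex
  by (intro fps_expansion_intros)

lemma has_fps_expansion_inv_csqrt:
  "(\<lambda>x. 1 / csqrt (1 - c * x)) has_fps_expansion inv_sqrt_fps c"
proof -
  have "((\<lambda>x. (1 + x) powr (-1/2)) \<circ> (\<lambda>x. (- c) * x)) has_fps_expansion inv_sqrt_fps c"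
    unfolding inv_sqrt_fps_def
    by (intro has_fps_expansion_compose has_fps_expansion_binomial_complex has_fps_expansion_linear) auto
  moreover have "1 / csqrt u = u powr (-1/2)" if "u \<noteq> 0" for u
    using that powr_minus[of u "1/2"] by (simp add: csqrt_conv_powr field_simps)
  moreover have "eventually (\<lambda>x. 1 - c * x \<in> - {0}) (nhds 0)"
  proof -
    have "open {x. 1 - c * x \<noteq> 0}" by (intro open_Collect_neq continuous_intros)
    then have "eventually (\<lambda>x. x \<in> {x. 1 - c * x \<noteq> 0}) (nhds 0)" by (rule eventually_nhds_in_open) simp
    then show ?thesis by eventually_elim auto
  qed
  ultimately show ?thesis
    by (subst has_fps_expansion_cong[OF _ refl]) (auto elim!: eventually_mono)
qed

text \<open>The power series of t = (1 - y)/2, where y = (1 - x)^(1/2).\<close>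

definition tau_fps :: "complex fps" where
  "tau_fps = fps_const (1/2) * (1 - (1 - fps_X) * inv_sqrt_fps 1)"

lemma inv_sqrt_fps_square: "inv_sqrt_fps 1 ^ 2 * (1 - fps_X) = 1"
proof -
  have "(\<lambda>x. (1 / csqrt (1 - 1 * x))\<^sup>2 * (1 - x)) has_fps_expansion (inv_sqrt_fps 1 ^ 2 * (1 - fps_X))"
    by (intro fps_expansion_intros has_fps_expansion_power has_fps_expansion_inv_csqrt)
  moreover have "eventually (\<lambda>x. (1 / csqrt (1 - 1 * x))\<^sup>2 * (1 - x) = 1) (nhds 0)"
  proof -
    have "eventually (\<lambda>x::complex. x \<in> - {1}) (nhds 0)" by (intro eventually_nhds_in_open) auto
    then show ?thesis by eventually_elim (auto simp: power_divide)
  qed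
  ultimately have "(\<lambda>x. 1) has_fps_expansion (inv_sqrt_fps 1 ^ 2 * (1 - fps_X))"
    by (rule iffD1[OF has_fps_expansion_cong[OF _ refl], rotated])
  then show ?thesis using fps_expansion_unique_complex has_fps_expansion_1 by blast
qed

text \<open>The quadratic equation t^2 = t - x/4.\<close>

lemma tau_fps_square: "tau_fps ^ 2 = tau_fps - fps_const (1/4) * fps_X"
proof -
  let ?Y = "inv_sqrt_fps 1"
  have two: "(2 :: complex fps) = fps_const 2" by (rule numeral_fps_const)
  have c: "fps_const (1/2) * fps_const (1/2) = fps_const (1/4 :: complex)" "fps_const (1/2) = fps_const (1/4) * (2 :: complex fps)"
    unfolding two by simp_all
  have "tau_fps ^ 2 = fps_const (1/4) * (1 - 2 * (1 - fps_X) * ?Y + (1 - fps_X) * (?Y ^ 2 * (1 - fps_X)))"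
    unfolding tau_fps_def c(1)[symmetric] by (simp add: power2_eq_square algebra_simps)
  also have "\<dots> = fps_const (1/4) * (1 - 2 * (1 - fps_X) * ?Y + (1 - fps_X))"
    by (simp only: inv_sqrt_fps_square mult_1_right)
  also have "\<dots> = tau_fps - fps_const (1/4) * fps_X"
    unfolding tau_fps_def c(2) by (simp add: algebra_simps)
  finally show ?thesis .
qed

lemma tau_fps_nth_0: "fps_nth tau_fps 0 = 0"
  by (simp add: tau_fps_def inv_sqrt_fps_nth)

text \<open>By the quadratic equation for t, the coefficients of y^(-1) t^k satisfy a recursion in k that is
  Pascal's rule. The case distinction matters: for m = 0 < k the truncated difference 2m - k
  would give the value 1 instead of 0.\<close>

lemma inv_sqrt_tau_nth:
  "fps_nth (inv_sqrt_fps 1 * tau_fps ^ k) m = (if k \<le> m then of_nat ((2 * m - k) choose m) / 4 ^ m else 0)"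
proof (induction k arbitrary: m rule: induct_nat_012)
  case 0
  then show ?case by (simp add: inv_sqrt_fps_nth half_coeff_def)
next
  case 1
  have "inv_sqrt_fps 1 * tau_fps = fps_const (1/2) * (inv_sqrt_fps 1 - inv_sqrt_fps 1 ^ 2 * (1 - fps_X))"
    by (simp add: tau_fps_def algebra_simps power2_eq_square)
  then have *: "inv_sqrt_fps 1 * tau_fps ^ Suc 0 = fps_const (1/2) * (inv_sqrt_fps 1 - 1)"
    by (simp only: inv_sqrt_fps_square power_Suc0_right)
  show ?case
  proof (cases m)
    case 0 then show ?thesis unfolding * by (simp add: inv_sqrt_fps_nth tau_fps_nth_0)
  next
    case (Suc n)
    have "2 * ((2 * m - 1) choose m) = (2 * m) choose m"
      using Suc binomial_Suc_Suc[of "2 * n + 1" n] binomial_symmetric[of n "2 * n + 1"] by simp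
    then have "(of_nat ((2 * m) choose m) :: complex) = 2 * of_nat ((2 * m - 1) choose m)"
      by (metis of_nat_mult of_nat_numeral)
    then show ?thesis unfolding * using Suc by (simp add: inv_sqrt_fps_nth half_coeff_def field_simps)
  qed
next
  case (ge2 k)
  have "inv_sqrt_fps 1 * tau_fps ^ Suc (Suc k) = inv_sqrt_fps 1 * tau_fps ^ k * tau_fps ^ 2"
    by (simp add: power2_eq_square mult_ac)
  also have "\<dots> = inv_sqrt_fps 1 * tau_fps ^ Suc k - fps_const (1/4) * (fps_X * (inv_sqrt_fps 1 * tau_fps ^ k))"
    unfolding tau_fps_square by (simp add: algebra_simps)
  finally have *: "inv_sqrt_fps 1 * tau_fps ^ Suc (Suc k) = \<dots>" .
  show ?case
  proof (cases m)
    case 0 then show ?thesis unfolding * using ge2(2)[of m] by simp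
  next
    case (Suc n)
    have "fps_nth (inv_sqrt_fps 1 * tau_fps ^ Suc (Suc k)) m =
       (if Suc k \<le> m then of_nat ((2 * m - Suc k) choose m) / 4 ^ m else 0) -
       (if k \<le> n then of_nat ((2 * n - k) choose n) / 4 ^ n else 0) / 4"
      unfolding * Suc fps_sub_nth fps_mult_left_const_nth ge2(2) fps_X_mult_nth using ge2(1)[of n] by simp
    also have "\<dots> = (if Suc (Suc k) \<le> m then of_nat ((2 * m - Suc (Suc k)) choose m) / 4 ^ m else 0)"
    proof (cases "k \<le> n")
      case True
      have "(2 * m - Suc k) choose m = ((2 * n - k) choose n) + ((2 * n - k) choose m)"
      proof -
        have "2 * m - Suc k = Suc (2 * n - k)" using True Suc by simp
        then show ?thesis using Suc binomial_Suc_Suc by metis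
      qed
      then have 1: "(of_nat ((2 * m - Suc k) choose m) :: complex) = of_nat ((2 * n - k) choose n) + of_nat ((2 * n - k) choose m)"
        by (metis of_nat_add)
      have "(2 * n - k) choose m = (if Suc (Suc k) \<le> m then (2 * m - Suc (Suc k)) choose m else 0)"
        using True Suc by (auto simp: binomial_eq_0)
      then have 2: "(if Suc (Suc k) \<le> m then of_nat ((2 * m - Suc (Suc k)) choose m) / 4 ^ m else 0)
          = (of_nat ((2 * n - k) choose m) / 4 ^ m :: complex)" by auto
      have 3: "Suc k \<le> m" "(4::complex) ^ m = 4 ^ n * 4" using True Suc by auto
      have 4: "(p + r) / (c * 4) - p / c / 4 = r / (c * 4)" for p r c :: complex
        by (simp add: add_divide_distrib)
      show ?thesis unfolding 2 unfolding 1 if_P[OF 3(1)] if_P[OF True] 3(2) by (rule 4)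
    qed (use Suc in auto)
    finally show ?thesis .
  qed
qed

text \<open>The function (y - z)^(1/2) / (y (1 - x/(1 - z^2))^(1/2)) of x, where y = (1 - x)^(1/2). Because of
  (y - z)(y + z) = 1 - z^2 - x it is a constant multiple of 1 / (y (y + z)^(1/2)), but in this form each
  root is principal on the whole unit disc if Re z < 0 and |1 - z^2| > 1.\<close>

definition jacobi_gf :: "complex \<Rightarrow> complex \<Rightarrow> complex" where
  "jacobi_gf z x = csqrt (csqrt (1 - x) - z) / (csqrt (1 - x) * csqrt (1 - x / (1 - z\<^sup>2)))"

text \<open>Two local branches of a square root agree if they agree at one point where they do not vanish.\<close>

lemma eq_near_0_if_squares_eq:
  fixes f g :: "complex \<Rightarrow> complex"
  assumes "eventually (\<lambda>x. (f x)\<^sup>2 = (g x)\<^sup>2) (nhds 0)" "isCont f 0" "isCont g 0" "f 0 = g 0" "g 0 \<noteq> 0"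
  shows "eventually (\<lambda>x. f x = g x) (nhds 0)"
proof -
  have "isCont (\<lambda>x. f x + g x) 0" using assms by (intro continuous_intros)
  moreover have "f 0 + g 0 \<noteq> 0" using assms by simp
  ultimately have "eventually (\<lambda>x. f x + g x \<noteq> 0) (nhds 0)"
    unfolding isCont_def eventually_nhds_conv_at by (auto intro: tendsto_imp_eventually_ne)
  then show ?thesis using assms(1)
  proof eventually_elim
    case (elim x)
    have "(f x - g x) * (f x + g x) = 0" using elim(2) by (simp add: algebra_simps power2_eq_square)
    then show ?case using elim(1) by simp
  qed
qed

text \<open>With t = (1 - y)/2 we have y + z = (1 + z)(1 - 2t/(1 + z)), so the function is (1 - z)^(1/2) times
  y^(-1) (1 - 2t/(1 + z))^(-1/2).\<close>

lemma jacobi_gf_has_fps_expansion: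
  assumes z: "Re z < 0" "1 - z\<^sup>2 \<noteq> 0"
  shows "jacobi_gf z has_fps_expansion fps_const (csqrt (1 - z)) *
     (inv_sqrt_fps 1 * (fps_binomial (-1/2) oo (fps_const (-2 / (1 + z)) * tau_fps)))"
    (is "_ has_fps_expansion ?H")
proof -
  have z1: "1 + z \<noteq> 0" "1 - z \<noteq> 0" using z by (auto simp: power2_eq_square add_eq_0_iff)
  define tau where "tau x = 1/2 * (1 - (1 - x) * (1 / csqrt (1 - 1 * x)))" for x
  have tau: "tau has_fps_expansion tau_fps"
    unfolding tau_def tau_fps_def by (intro fps_expansion_intros has_fps_expansion_inv_csqrt)
  define F where "F x = csqrt (1 - z) * (1 / csqrt (1 - 1 * x) * ((\<lambda>u. (1 + u) powr (-1/2)) \<circ> (\<lambda>x. -2 / (1 + z) * tau x)) x)" for x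
  have F: "F has_fps_expansion ?H"
    unfolding F_def
    by (intro has_fps_expansion_mult has_fps_expansion_const has_fps_expansion_inv_csqrt
       has_fps_expansion_compose has_fps_expansion_binomial_complex tau) (simp add: tau_fps_nth_0)
  have F0: "F 0 = csqrt (1 - z)" by (simp add: F_def tau_def)
  have contF: "isCont F 0" using has_fps_expansion_imp_continuous[OF F, of UNIV] by simp
  have "jacobi_gf z 0 = csqrt (1 - z)" by (simp add: jacobi_gf_def)
  have contG: "isCont (jacobi_gf z) 0"
    unfolding jacobi_gf_def using z z1
    by (intro continuous_intros) (auto simp: complex_nonpos_Reals_iff)
  have sq: "eventually (\<lambda>x. (F x)\<^sup>2 = (jacobi_gf z x)\<^sup>2) (nhds 0)"
  proof -
    have "eventually (\<lambda>x::complex. x \<in> - {1}) (nhds 0)" by (intro eventually_nhds_in_open) auto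
    moreover have "eventually (\<lambda>x::complex. x \<in> - {1 - z\<^sup>2}) (nhds 0)"
      using z by (intro eventually_nhds_in_open) auto
    ultimately show ?thesis
    proof eventually_elim
      case (elim x)
      define y where "y = csqrt (1 - x)"
      have y2: "y\<^sup>2 = 1 - x" by (simp add: y_def)
      have y0: "y \<noteq> 0" using elim by (simp add: y_def)
      have prod: "(y - z) * (y + z) = 1 - z\<^sup>2 - x" using y2 by (simp add: algebra_simps power2_eq_square)
      then have nz: "y - z \<noteq> 0" "y + z \<noteq> 0" using elim by auto
      have t: "tau x = (1 - y) / 2"
      proof -
        have "(1 - x) * (1 / y) = y" using y2 y0 by (simp add: power2_eq_square field_simps)
        then show ?thesis by (simp add: tau_def y_def)
      qed
      have u: "1 + -2 / (1 + z) * tau x = (y + z) / (1 + z)"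
      proof -
        have "-2 * (1 - y) = 2 * (y - 1)" "(1 + z) * 2 = 2 * (1 + z)" by simp_all
        then have "-2 / (1 + z) * tau x = 2 * (y - 1) / (2 * (1 + z))" unfolding t times_divide_times_eq by metis
        then have "-2 / (1 + z) * tau x = (y - 1) / (1 + z)" by (simp only: mult_divide_mult_cancel_left_if) simp
        moreover have "1 + (y - 1) / (1 + z) = (y + z) / (1 + z)" using z1 by (simp add: field_simps)
        ultimately show ?thesis by (simp only:)
      qed
      have "(((y + z) / (1 + z)) powr (-1/2))\<^sup>2 = 1 / ((y + z) / (1 + z))"
      proof -
        have "((y + z) / (1 + z)) powr (-1/2) = 1 / csqrt ((y + z) / (1 + z))"
          using nz z1 powr_minus[of "(y + z) / (1 + z)" "1/2"] by (simp add: csqrt_conv_powr field_simps)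
        then show ?thesis by (simp add: power_divide)
      qed
      then have "(F x)\<^sup>2 = (1 - z) * (1 / (1 - x) * (1 / ((y + z) / (1 + z))))"
        unfolding F_def comp_def u by (simp only: power_mult_distrib power_divide power2_csqrt mult_1_left power_one)
      also have "\<dots> = (1 - z\<^sup>2) / ((1 - x) * (y + z))"
        using z1 nz elim by (simp add: field_simps power2_eq_square)
      also have "\<dots> = (y - z) * (1 - z\<^sup>2) / ((1 - x) * (1 - z\<^sup>2 - x))"
      proof -
        have "(1 - x) * ((y - z) * (y + z)) = (y - z) * ((1 - x) * (y + z))" by (simp only: mult_ac)
        then show ?thesis unfolding prod[symmetric] using nz(1) by (simp only: mult_divide_mult_cancel_left_if if_False)
      qed
      also have "\<dots> = (y - z) / ((1 - x) * (1 - x / (1 - z\<^sup>2)))"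
      proof -
        have "1 - z\<^sup>2 - x = (1 - z\<^sup>2) * (1 - x / (1 - z\<^sup>2))" using z(2) by (simp add: field_simps)
        then have e: "(1 - x) * (1 - z\<^sup>2 - x) = (1 - z\<^sup>2) * ((1 - x) * (1 - x / (1 - z\<^sup>2)))"
          by (metis mult.left_commute)
        have "(y - z) * c / (c * d) = (y - z) / d" if "c \<noteq> 0" for c d using that by simp
        then show ?thesis unfolding e using z(2) by metis
      qed
      also have "\<dots> = (jacobi_gf z x)\<^sup>2"
        by (simp only: jacobi_gf_def y_def power_divide power_mult_distrib power2_csqrt)
      finally show ?case .
    qed
  qed
  have "F 0 = jacobi_gf z 0" "jacobi_gf z 0 \<noteq> 0" using F0 \<open>jacobi_gf z 0 = _\<close> z1(2) by simp_all
  then have "eventually (\<lambda>x. F x = jacobi_gf z x) (nhds 0)"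
    by (rule eq_near_0_if_squares_eq[OF sq contF contG])
  then show ?thesis using F by (rule iffD1[OF has_fps_expansion_cong[OF _ refl]])
qed

text \<open>Expanding the outer binomial series gives the expansion of the Jacobi polynomial in powers of 1 + z,
  since t^k has no terms below x^k.\<close>

theorem jacobi_gf_coeff:
  assumes z: "Re z < 0" "1 - z\<^sup>2 \<noteq> 0"
  shows "fps_nth (fps_expansion (jacobi_gf z) 0) m = csqrt (1 - z) * poly (jacobi_P m) z / (2 * (1 + z)) ^ m"
proof -
  have z1: "1 + z \<noteq> 0" using z by (auto simp: power2_eq_square add_eq_0_iff)
  define c where "c = -2 / (1 + z)"
  define Y where "Y = inv_sqrt_fps 1"
  define A where "A = fps_binomial (-1/2 :: complex)"
  have "fps_nth (Y * (A oo (fps_const c * tau_fps))) m = (\<Sum>i=0..m. fps_nth Y i * (\<Sum>k=0..m-i. fps_nth A k * fps_nth ((fps_const c * tau_fps) ^ k) (m - i)))"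
    by (simp only: fps_mult_nth fps_compose_nth)
  also have "\<dots> = (\<Sum>i=0..m. fps_nth Y i * (\<Sum>k=0..m. fps_nth A k * fps_nth ((fps_const c * tau_fps) ^ k) (m - i)))"
  proof (intro sum.cong[OF refl] arg_cong2[where f="(*)"] refl sum.mono_neutral_left)
    fix i show "\<forall>k\<in>{0..m} - {0..m - i}. fps_nth A k * fps_nth ((fps_const c * tau_fps) ^ k) (m - i) = 0"
      by (auto intro!: startsby_zero_power_prefix[rule_format] simp: tau_fps_nth_0)
  qed auto
  also have "\<dots> = (\<Sum>k=0..m. fps_nth A k * fps_nth (Y * (fps_const c * tau_fps) ^ k) m)"
    unfolding fps_mult_nth sum_distrib_left
    by (subst sum.swap) (simp only: mult_ac)
  also have "\<dots> = (\<Sum>k\<le>m. ((-1/2) gchoose k) * (c ^ k * (of_nat ((2 * m - k) choose m) / 4 ^ m)))"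
  proof (intro sum.cong)
    fix k assume k: "k \<in> {..m}"
    have "Y * (fps_const c * tau_fps) ^ k = fps_const (c ^ k) * (inv_sqrt_fps 1 * tau_fps ^ k)"
      by (simp add: Y_def power_mult_distrib fps_const_power mult_ac)
    then have "fps_nth (Y * (fps_const c * tau_fps) ^ k) m = c ^ k * (of_nat ((2 * m - k) choose m) / 4 ^ m)"
      using k by (simp only: fps_mult_left_const_nth inv_sqrt_tau_nth) simp
    then show "fps_nth A k * fps_nth (Y * (fps_const c * tau_fps) ^ k) m =
         ((-1/2) gchoose k) * (c ^ k * (of_nat ((2 * m - k) choose m) / 4 ^ m))"
      by (simp only: A_def fps_binomial_nth)
  qed auto
  also have "\<dots> = poly (jacobi_P m) z / (2 * (1 + z)) ^ m"
    unfolding jacobi_P_expansion sum_divide_distrib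
  proof (intro sum.cong refl)
    fix k assume "k \<in> {..m}"
    then have p: "(1 + z) ^ m = (1 + z) ^ (m - k) * (1 + z) ^ k" by (simp flip: power_add)
    have f: "(4::complex) ^ m = 2 ^ m * 2 ^ m" by (simp flip: power_mult_distrib)
    show "((-1/2) gchoose k) * (c ^ k * (of_nat ((2 * m - k) choose m) / 4 ^ m)) =
       ((-1/2) gchoose k) * (-2) ^ k * of_nat ((2 * m - k) choose m) * (1 + z) ^ (m - k) / 2 ^ m / (2 * (1 + z)) ^ m"
      unfolding c_def power_mult_distrib power_divide f p using z1 by simp
  qed
  finally have "fps_nth (Y * (A oo (fps_const c * tau_fps))) m = poly (jacobi_P m) z / (2 * (1 + z)) ^ m" .
  moreover have "fps_expansion (jacobi_gf z) 0 = fps_const (csqrt (1 - z)) * (Y * (A oo (fps_const c * tau_fps)))"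
    unfolding A_def Y_def c_def by (rule fps_expansion_eqI[OF jacobi_gf_has_fps_expansion[OF z]])
  ultimately show ?thesis by simp
qed

section \<open>Coefficients of families with square root singularities\<close>

definition sing_weight :: "complex \<Rightarrow> complex \<Rightarrow> real" where
  "sing_weight w x = 1 / cmod (csqrt (1 - x)) + 1 / cmod (csqrt (1 - w * x))"

lemma sing_weight_nonneg: "sing_weight w x \<ge> 0" by (simp add: sing_weight_def)

lemma sing_weight_ge:
  "1 / cmod (csqrt (1 - x)) \<le> sing_weight w x" "1 / cmod (csqrt (1 - w * x)) \<le> sing_weight w x"
  by (simp_all add: sing_weight_def)

lemma one_minus_pos: assumes "cmod x < 1" "cmod w \<le> 1" shows "Re (1 - w * x) > 0"
proof -
  have "cmod (w * x) < 1" unfolding norm_mult using assms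
    by (metis mult_le_cancel_right1 mult_le_one norm_ge_zero order_le_less_trans mult.commute mult_left_le)
  then show ?thesis using complex_Re_le_cmod[of "w * x"] by simp
qed

text \<open>On the circle, the conjugate of x is r^2/x, which turns the integrand into a rational function with
  one pole inside, at the conjugate of w times r^2.\<close>

lemma mean_inverse_square:
  assumes r: "0 < r" "r < 1" and w: "cmod w \<le> 1"
  shows "((\<lambda>t. 1 / (cmod (1 - w * circlepath 0 r t))\<^sup>2) has_integral 1 / (1 - (cmod w * r)\<^sup>2)) {0..1}"
proof -
  define a where "a = cnj w * of_real (r\<^sup>2)"
  have "cmod a \<le> r\<^sup>2" using w r by (simp add: a_def norm_mult norm_power mult_left_le_one_le)
  then have a: "cmod a < r" using r by (smt (verit) power2_eq_square mult_less_cancel_left2)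
  have pos: "1 - w * x \<noteq> 0" if "cmod x \<le> r" for x
    using one_minus_pos[of x w] that r w by force
  have "(\<lambda>x. 1 / (1 - w * x)) holomorphic_on cball 0 r"
    using pos by (intro holomorphic_intros) auto
  then have "((\<lambda>x. 1 / (1 - w * x) / (x - a)) has_contour_integral (2 * of_real pi * \<i> * (1 / (1 - w * a)))) (circlepath 0 r)"
    using a by (intro Cauchy_integral_circlepath holomorphic_on_imp_continuous_on) (auto intro: holomorphic_on_subset)
  then have I: "((\<lambda>t. 1 / (1 - w * circlepath 0 r t) / (circlepath 0 r t - a) *
      vector_derivative (circlepath 0 r) (at t within {0..1})) has_integral (2 * of_real pi * \<i> * (1 / (1 - w * a)))) {0..1}"
    by (simp add: has_contour_integral_def)
  have E: "1 / (1 - w * circlepath 0 r t) / (circlepath 0 r t - a) * vector_derivative (circlepath 0 r) (at t within {0..1})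
      = 2 * of_real pi * \<i> * of_real (1 / (cmod (1 - w * circlepath 0 r t))\<^sup>2)" if t: "t \<in> {0..1}" for t
  proof -
    define x where "x = circlepath 0 r t"
    have x: "x = of_real r * exp (2 * of_real pi * \<i> * of_real t)" by (simp add: x_def circlepath)
    have cx: "cmod x = r" using r by (simp add: x norm_mult norm_exp_imaginary)
    then have x0: "x \<noteq> 0" using r by auto
    have vd: "vector_derivative (circlepath 0 r) (at t within {0..1}) = 2 * of_real pi * \<i> * x"
      using t by (simp add: vector_derivative_circlepath01 x)
    have "x * cnj x = of_real (r\<^sup>2)" using cx by (metis complex_norm_square)
    then have "x - a = x * cnj (1 - w * x)" by (simp add: a_def algebra_simps)
    moreover have "(1 - w * x) * cnj (1 - w * x) = of_real ((cmod (1 - w * x))\<^sup>2)" by (metis complex_norm_square)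
    ultimately show ?thesis unfolding vd x_def[symmetric] using x0 by (simp flip: of_real_power)
  qed
  have W: "1 / (1 - w * a) = of_real (1 / (1 - (cmod w * r)\<^sup>2))"
  proof -
    have "w * a = of_real ((cmod w * r)\<^sup>2)"
      by (simp add: a_def power_mult_distrib complex_norm_square[symmetric] mult.assoc[symmetric] del: of_real_power)
    then show ?thesis by simp
  qed
  have "((\<lambda>t. 2 * of_real pi * \<i> * of_real (1 / (cmod (1 - w * circlepath 0 r t))\<^sup>2)) has_integral (2 * of_real pi * \<i> * of_real (1 / (1 - (cmod w * r)\<^sup>2)))) {0..1}"
    using I E unfolding W by (subst has_integral_cong[symmetric]) auto
  then have "((\<lambda>t. Re ((2 * of_real pi * \<i> * of_real (1 / (cmod (1 - w * circlepath 0 r t))\<^sup>2)) / (2 * of_real pi * \<i>)))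
     has_integral Re ((2 * of_real pi * \<i> * of_real (1 / (1 - (cmod w * r)\<^sup>2))) / (2 * of_real pi * \<i>))) {0..1}"
    by (intro has_integral_Re has_integral_divide)
  then show ?thesis by simp
qed

lemma inverse_root_le:
  fixes l a :: real
  assumes "l > 0" "a > 0"
  shows "1 / a \<le> l + (1 / a ^ 4) / l ^ 3"
proof (cases "1 / a \<le> l")
  case True
  moreover have "0 \<le> (1 / a ^ 4) / l ^ 3" using assms by simp
  ultimately show ?thesis by linarith
next
  case False
  then have "l ^ 3 \<le> (1 / a) ^ 3" using assms by (intro power_mono) auto
  then have "l ^ 3 * (1 / a) \<le> (1 / a) ^ 3 * (1 / a)" using assms by (intro mult_right_mono) auto
  then have "l ^ 3 * (1 / a) \<le> 1 / a ^ 4" by (simp add: power_divide eval_nat_numeral)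
  then have "1 / a \<le> (1 / a ^ 4) / l ^ 3" using assms by (simp add: field_simps)
  then show ?thesis using assms by linarith
qed

lemma norm_csqrt_power4: "cmod (csqrt u) ^ 4 = (cmod u)\<^sup>2"
proof -
  have "a ^ 4 = (a\<^sup>2)\<^sup>2" for a :: real by (simp flip: power_mult)
  from this[of "cmod (csqrt u)"] show ?thesis by simp
qed

text \<open>Cauchy's formula for the derivative of f on the circle of radius 1 - 1/(2m). Integrating the weight
  itself would give O(1/m). For the cheaper bound here, the inverse roots are compared with l and
  l^(-3) times an inverse square, whose mean is explicit; l = m^(1/4) balances the two.\<close>

lemma coeff_bound_of_deriv_bound:
  assumes holo: "f holomorphic_on ball 0 1" and w: "cmod w \<le> 1" and C: "C \<ge> 0"
    and bound: "\<And>x. cmod x < 1 \<Longrightarrow> cmod (deriv f x) \<le> C * sing_weight w x" and m: "m \<ge> 1"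
  shows "cmod (fps_nth (fps_expansion f 0) m) \<le> 12 * C * real m powr (-3/4)"
proof -
  obtain k where k: "m = Suc k" using m by (cases m) auto
  define r where "r = 1 - 1 / (2 * real m)"
  have r: "0 < r" "r < 1" "1/2 \<le> r" using m by (auto simp: r_def field_simps)
  (* the bound for the weight has mean at most 2 l + 4 m / l^3 = 6 l *)
  define l where "l = real m powr (1/4)"
  have l: "l > 0" using m by (simp add: l_def)
  have l4: "l ^ 4 = real m" using m by (simp add: l_def powr_powr flip: powr_numeral)
  define S where "S t = 2 * l + (1 / (cmod (1 - 1 * circlepath 0 r t))\<^sup>2 + 1 / (cmod (1 - w * circlepath 0 r t))\<^sup>2) / l ^ 3" for t
  define K where "K = 2 * l + (1 / (1 - (cmod 1 * r)\<^sup>2) + 1 / (1 - (cmod w * r)\<^sup>2)) / l ^ 3"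
  have S: "(S has_integral K) {0..1}"
  proof -
    have "((\<lambda>t::real. 2 * l) has_integral 2 * l) {0..1}" using has_integral_const_real[of "2*l" 0 1] by simp
    then show ?thesis unfolding S_def K_def
      by (intro has_integral_add has_integral_divide mean_inverse_square r w) simp_all
  qed
  have cp: "cmod (circlepath 0 r t) = r" for t using r by (simp add: circlepath norm_mult norm_exp_imaginary)
  have SW: "sing_weight w (circlepath 0 r t) \<le> S t" for t
  proof -
    define x where "x = circlepath 0 r t"
    have x: "cmod x < 1" using cp r by (simp add: x_def)
    have "1 / cmod (csqrt u) \<le> l + (1 / (cmod u)\<^sup>2) / l ^ 3" if "Re u > 0" for u
      using inverse_root_le[OF l, of "cmod (csqrt u)"] that unfolding norm_csqrt_power4 by force
    from this[of "1 - 1 * x"] this[of "1 - w * x"] show ?thesis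
      using one_minus_pos[OF x w] one_minus_pos[of x 1] x
      unfolding sing_weight_def S_def x_def[symmetric] by (simp add: add_divide_distrib)
  qed
  have holo': "deriv f holomorphic_on ball 0 1" using holo by (rule holomorphic_deriv) simp
  have sub: "cball 0 r \<subseteq> ball (0::complex) 1" using r by auto
  have "((\<lambda>u. deriv f u / (u - 0) ^ Suc k) has_contour_integral ((2 * pi * \<i>) / (fact k) * (deriv ^^ k) (deriv f) 0)) (circlepath 0 r)"
    using r by (intro Cauchy_has_contour_integral_higher_derivative_circlepath holomorphic_on_imp_continuous_on
         holomorphic_on_subset[OF holo']) auto
  then have I: "((\<lambda>t. deriv f (circlepath 0 r t) / circlepath 0 r t ^ Suc k * vector_derivative (circlepath 0 r) (at t within {0..1}))
      has_integral ((2 * pi * \<i>) / (fact k) * (deriv ^^ k) (deriv f) 0)) {0..1}"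
    by (simp add: has_contour_integral_def)
  have "cmod ((2 * pi * \<i>) / (fact k) * (deriv ^^ k) (deriv f) 0) \<le> integral {0..1} (\<lambda>t. 2 * pi * C / r ^ k * S t)"
    unfolding integral_unique[OF I, symmetric]
  proof (rule integral_norm_bound_integral)
    show "(\<lambda>t. deriv f (circlepath 0 r t) / circlepath 0 r t ^ Suc k * vector_derivative (circlepath 0 r) (at t within {0..1})) integrable_on {0..1}"
      using I by blast
    show "(\<lambda>t. 2 * pi * C / r ^ k * S t) integrable_on {0..1}" using S by (intro integrable_on_mult_right) blast
  next
    fix t :: real assume t: "t \<in> {0..1}"
    have vd: "cmod (vector_derivative (circlepath 0 r) (at t within {0..1})) = 2 * pi * r"
      using t r by (simp add: vector_derivative_circlepath01 norm_mult norm_exp_imaginary)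
    have "cmod (deriv f (circlepath 0 r t)) \<le> C * sing_weight w (circlepath 0 r t)" using bound cp r by simp
    also have "\<dots> \<le> C * S t" using SW C by (rule mult_left_mono)
    finally have "cmod (deriv f (circlepath 0 r t)) \<le> C * S t" .
    then have "cmod (deriv f (circlepath 0 r t)) / r ^ Suc k * (2 * pi * r) \<le> C * S t / r ^ Suc k * (2 * pi * r)"
      using r by (intro mult_right_mono divide_right_mono) auto
    also have "\<dots> = 2 * pi * C / r ^ k * S t" using r by (simp add: field_simps)
    finally show "cmod (deriv f (circlepath 0 r t) / circlepath 0 r t ^ Suc k * vector_derivative (circlepath 0 r) (at t within {0..1}))
       \<le> 2 * pi * C / r ^ k * S t"
      unfolding norm_mult norm_divide norm_power cp vd .
  qed
  also have "\<dots> = 2 * pi * C / r ^ k * K" using integral_unique[OF S] by simp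
  finally have "2 * pi * (cmod ((deriv ^^ k) (deriv f) 0) / fact k) \<le> 2 * pi * (C / r ^ k * K)"
    by (simp add: norm_mult norm_divide)
  then have main: "cmod ((deriv ^^ k) (deriv f) 0) / fact k \<le> C / r ^ k * K"
    by (subst (asm) mult_le_cancel_left_pos) auto
  have rk: "1 / r ^ k \<le> 2"
  proof -
    have "1 + real m * (- (1 / (2 * real m))) \<le> (1 + (- (1 / (2 * real m)))) ^ m"
      using m by (intro Bernoulli_inequality) (simp add: field_simps)
    then have "1/2 \<le> r ^ m" using m by (simp add: r_def)
    also have "r ^ m \<le> r ^ k" using r k by (intro power_decreasing) auto
    finally show ?thesis using r by (simp add: field_simps)
  qed
  have mean: "1 / (1 - (v * r)\<^sup>2) \<le> 2 * real m" if "0 \<le> v" "v \<le> 1" for v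
  proof -
    have "(v * r)\<^sup>2 \<le> r\<^sup>2" using that r by (intro power_mono) (auto simp: mult_left_le_one_le)
    also have "\<dots> \<le> r" using r by (simp add: power2_eq_square mult_left_le_one_le)
    finally have "1 / (2 * real m) \<le> 1 - (v * r)\<^sup>2" by (simp add: r_def)
    moreover have "0 < 1 / (2 * real m)" using m by simp
    ultimately have "1 / (1 - (v * r)\<^sup>2) \<le> 1 / (1 / (2 * real m))" by (intro frac_le) auto
    then show ?thesis by simp
  qed
  have "K \<le> 2 * l + (2 * real m + 2 * real m) / l ^ 3"
    unfolding K_def using mean[of "cmod 1"] mean[of "cmod w"] w l
    by (intro add_left_mono divide_right_mono add_mono) auto
  also have "\<dots> = 6 * l" using l by (simp add: l4[symmetric] eval_nat_numeral)
  finally have K: "K \<le> 6 * l" .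
  have "cmod ((deriv ^^ k) (deriv f) 0) / fact k \<le> C * (1 / r ^ k) * K" using main by simp
  also have "\<dots> \<le> C * 2 * (6 * l)"
  proof (rule mult_mono)
    show "C * (1 / r ^ k) \<le> C * 2" using rk C by (rule mult_left_mono)
    show "0 \<le> K" unfolding K_def using l r w 
      by (intro add_nonneg_nonneg divide_nonneg_nonneg) (auto intro!: power_le_one mult_le_one)
  qed (use K C in auto)
  finally have fin: "cmod ((deriv ^^ k) (deriv f) 0) / fact k \<le> 12 * C * l" by simp
  have "cmod (fps_nth (fps_expansion f 0) m) = cmod ((deriv ^^ k) (deriv f) 0) / fact k / real m"
    by (simp add: fps_expansion_def k funpow_Suc_right norm_divide norm_mult del: funpow.simps of_nat_Suc)
  also have "\<dots> \<le> 12 * C * l / real m" using fin by (rule divide_right_mono) simp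
  also have "\<dots> = 12 * C * (l / real m)" by simp
  also have "l / real m = real m powr (-3/4)"
    using m powr_diff[of "real m" "1/4" 1] by (simp add: l_def)
  finally show ?thesis .
qed

text \<open>Bounds for f z and its derivative, uniform in the parameter z. The derivative may grow like the
  inverse square roots of 1 - x and 1 - w z x at the two singular points. The algebraic closure
  properties below make it unnecessary to differentiate the remainder of the singular parts.\<close>

definition tame :: "complex set \<Rightarrow> (complex \<Rightarrow> complex) \<Rightarrow> (complex \<Rightarrow> complex \<Rightarrow> complex) \<Rightarrow> bool" where
  "tame Z w f \<longleftrightarrow> (\<exists>C\<ge>0. \<forall>z\<in>Z. \<forall>x. cmod x < 1 \<longrightarrow> cmod (f z x) \<le> C \<and>
     (\<exists>d. (f z has_field_derivative d) (at x) \<and> cmod d \<le> C * sing_weight (w z) x))"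

lemma tameI:
  assumes "\<And>z x. z \<in> Z \<Longrightarrow> cmod x < 1 \<Longrightarrow> cmod (f z x) \<le> B"
    and "\<And>z x. z \<in> Z \<Longrightarrow> cmod x < 1 \<Longrightarrow> (f z has_field_derivative f' z x) (at x) \<and> cmod (f' z x) \<le> D * sing_weight (w z) x"
  shows "tame Z w f"
  unfolding tame_def
proof (intro exI[of _ "max 0 (max B D)"] conjI ballI allI impI)
  fix z x assume zx: "z \<in> Z" "cmod x < 1"
  show "cmod (f z x) \<le> max 0 (max B D)" using assms(1)[OF zx] by simp
  have "D * sing_weight (w z) x \<le> max 0 (max B D) * sing_weight (w z) x"
    using sing_weight_nonneg by (intro mult_right_mono) auto
  then show "\<exists>d. (f z has_field_derivative d) (at x) \<and> cmod d \<le> max 0 (max B D) * sing_weight (w z) x"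
    using assms(2)[OF zx] by (intro exI[of _ "f' z x"]) auto
qed simp

lemma tameE:
  assumes "tame Z w f"
  obtains C f' where "C \<ge> 0" "\<And>z x. z \<in> Z \<Longrightarrow> cmod x < 1 \<Longrightarrow> cmod (f z x) \<le> C"
    "\<And>z x. z \<in> Z \<Longrightarrow> cmod x < 1 \<Longrightarrow> (f z has_field_derivative f' z x) (at x)"
    "\<And>z x. z \<in> Z \<Longrightarrow> cmod x < 1 \<Longrightarrow> cmod (f' z x) \<le> C * sing_weight (w z) x"
proof -
  from assms obtain C where C: "C \<ge> 0" "\<And>z x. z \<in> Z \<Longrightarrow> cmod x < 1 \<Longrightarrow> cmod (f z x) \<le> C \<and>
     (\<exists>d. (f z has_field_derivative d) (at x) \<and> cmod d \<le> C * sing_weight (w z) x)"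
    unfolding tame_def by blast
  define f' where "f' z x = (SOME d. (f z has_field_derivative d) (at x) \<and> cmod d \<le> C * sing_weight (w z) x)" for z x
  have "(f z has_field_derivative f' z x) (at x) \<and> cmod (f' z x) \<le> C * sing_weight (w z) x" if "z \<in> Z" "cmod x < 1" for z x
    unfolding f'_def by (rule someI_ex) (use C(2)[OF that] in blast)
  then show ?thesis using that[of C f'] C by blast
qed

lemma tame_const: assumes "\<And>z. z \<in> Z \<Longrightarrow> cmod (c z) \<le> B" shows "tame Z w (\<lambda>z x. c z)"
  by (rule tameI[where B=B and f'="\<lambda>_ _. 0" and D=0]) (use assms in auto)

lemma tame_add: assumes "tame Z w f" "tame Z w g" shows "tame Z w (\<lambda>z x. f z x + g z x)"
proof -
  obtain C f' where f: "C \<ge> 0" "\<And>z x. z \<in> Z \<Longrightarrow> cmod x < 1 \<Longrightarrow> cmod (f z x) \<le> C"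
    "\<And>z x. z \<in> Z \<Longrightarrow> cmod x < 1 \<Longrightarrow> (f z has_field_derivative f' z x) (at x)"
    "\<And>z x. z \<in> Z \<Longrightarrow> cmod x < 1 \<Longrightarrow> cmod (f' z x) \<le> C * sing_weight (w z) x"
    using tameE[OF assms(1)] by blast
  obtain D g' where g: "D \<ge> 0" "\<And>z x. z \<in> Z \<Longrightarrow> cmod x < 1 \<Longrightarrow> cmod (g z x) \<le> D"
    "\<And>z x. z \<in> Z \<Longrightarrow> cmod x < 1 \<Longrightarrow> (g z has_field_derivative g' z x) (at x)"
    "\<And>z x. z \<in> Z \<Longrightarrow> cmod x < 1 \<Longrightarrow> cmod (g' z x) \<le> D * sing_weight (w z) x"
    using tameE[OF assms(2)] by blast
  show ?thesis
  proof (rule tameI[where B="C + D" and f'="\<lambda>z x. f' z x + g' z x" and D="C + D"])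
    fix z x assume zx: "z \<in> Z" "cmod x < 1"
    show "cmod (f z x + g z x) \<le> C + D" by (rule norm_triangle_mono) (use f(2) g(2) zx in auto)
    have "cmod (f' z x + g' z x) \<le> C * sing_weight (w z) x + D * sing_weight (w z) x"
      by (rule norm_triangle_mono) (use f(4) g(4) zx in auto)
    then show "((\<lambda>x. f z x + g z x) has_field_derivative f' z x + g' z x) (at x) \<and>
        cmod (f' z x + g' z x) \<le> (C + D) * sing_weight (w z) x"
      using f(3)[OF zx] g(3)[OF zx] by (auto intro: DERIV_add simp: algebra_simps)
  qed
qed

lemma tame_mult: assumes "tame Z w f" "tame Z w g" shows "tame Z w (\<lambda>z x. f z x * g z x)"
proof -
  obtain C f' where f: "C \<ge> 0" "\<And>z x. z \<in> Z \<Longrightarrow> cmod x < 1 \<Longrightarrow> cmod (f z x) \<le> C"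
    "\<And>z x. z \<in> Z \<Longrightarrow> cmod x < 1 \<Longrightarrow> (f z has_field_derivative f' z x) (at x)"
    "\<And>z x. z \<in> Z \<Longrightarrow> cmod x < 1 \<Longrightarrow> cmod (f' z x) \<le> C * sing_weight (w z) x"
    using tameE[OF assms(1)] by blast
  obtain D g' where g: "D \<ge> 0" "\<And>z x. z \<in> Z \<Longrightarrow> cmod x < 1 \<Longrightarrow> cmod (g z x) \<le> D"
    "\<And>z x. z \<in> Z \<Longrightarrow> cmod x < 1 \<Longrightarrow> (g z has_field_derivative g' z x) (at x)"
    "\<And>z x. z \<in> Z \<Longrightarrow> cmod x < 1 \<Longrightarrow> cmod (g' z x) \<le> D * sing_weight (w z) x"
    using tameE[OF assms(2)] by blast
  show ?thesis
  proof (rule tameI[where B="C * D" and f'="\<lambda>z x. f' z x * g z x + g' z x * f z x" and D="2 * (C * D)"])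
    fix z x assume zx: "z \<in> Z" "cmod x < 1"
    show "cmod (f z x * g z x) \<le> C * D" unfolding norm_mult by (rule mult_mono) (use f g zx in auto)
    have "cmod (f' z x * g z x + g' z x * f z x) \<le> C * sing_weight (w z) x * D + D * sing_weight (w z) x * C"
      by (intro norm_triangle_mono; unfold norm_mult; intro mult_mono)
         (use f g zx sing_weight_nonneg in auto)
    then have "cmod (f' z x * g z x + g' z x * f z x) \<le> 2 * (C * D) * sing_weight (w z) x"
      by (simp add: algebra_simps)
    then show "((\<lambda>x. f z x * g z x) has_field_derivative f' z x * g z x + g' z x * f z x) (at x) \<and>
        cmod (f' z x * g z x + g' z x * f z x) \<le> 2 * (C * D) * sing_weight (w z) x"
      using DERIV_mult[OF f(3)[OF zx] g(3)[OF zx]] by blast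
  qed
qed

lemma tame_inverse:
  assumes "tame Z w f" "c > 0" "\<And>z x. z \<in> Z \<Longrightarrow> cmod x < 1 \<Longrightarrow> c \<le> cmod (f z x)"
  shows "tame Z w (\<lambda>z x. inverse (f z x))"
proof -
  obtain C f' where f: "C \<ge> 0" "\<And>z x. z \<in> Z \<Longrightarrow> cmod x < 1 \<Longrightarrow> cmod (f z x) \<le> C"
    "\<And>z x. z \<in> Z \<Longrightarrow> cmod x < 1 \<Longrightarrow> (f z has_field_derivative f' z x) (at x)"
    "\<And>z x. z \<in> Z \<Longrightarrow> cmod x < 1 \<Longrightarrow> cmod (f' z x) \<le> C * sing_weight (w z) x"
    using tameE[OF assms(1)] by blast
  show ?thesis
  proof (rule tameI[where B="inverse c" and f'="\<lambda>z x. - (inverse (f z x) * f' z x * inverse (f z x))" and D="inverse c * C * inverse c"])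
    fix z x assume zx: "z \<in> Z" "cmod x < 1"
    show i: "cmod (inverse (f z x)) \<le> inverse c"
      unfolding norm_inverse using assms(2) assms(3)[OF zx] by (intro le_imp_inverse_le) auto
    have "cmod (inverse (f z x) * f' z x * inverse (f z x)) \<le> inverse c * (C * sing_weight (w z) x) * inverse c"
      unfolding norm_mult using i f(1,4) zx assms(2) sing_weight_nonneg by (intro mult_mono) auto
    moreover have "f z x \<noteq> 0" using assms(2) assms(3)[OF zx] by auto
    ultimately show "((\<lambda>x. inverse (f z x)) has_field_derivative - (inverse (f z x) * f' z x * inverse (f z x))) (at x) \<and>
        cmod (- (inverse (f z x) * f' z x * inverse (f z x))) \<le> inverse c * C * inverse c * sing_weight (w z) x"
      using DERIV_inverse'[OF f(3)[OF zx]] unfolding norm_minus_cancel by (simp add: mult_ac)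
  qed
qed

lemma has_field_derivative_csqrt_comp:
  assumes "(f has_field_derivative d) (at x)" "Re (f x) > 0"
  shows "((\<lambda>x. csqrt (f x)) has_field_derivative d * inverse (2 * csqrt (f x))) (at x)"
proof -
  have "f x \<notin> \<real>\<^sub>\<le>\<^sub>0" using assms(2) by (auto simp: complex_nonpos_Reals_iff)
  from DERIV_chain2[OF has_field_derivative_csqrt[OF this] assms(1)] show ?thesis
    by (simp add: field_simps)
qed

lemma tame_csqrt:
  assumes "tame Z w f" "c > 0" "\<And>z x. z \<in> Z \<Longrightarrow> cmod x < 1 \<Longrightarrow> c \<le> cmod (f z x)"
    "\<And>z x. z \<in> Z \<Longrightarrow> cmod x < 1 \<Longrightarrow> Re (f z x) > 0"
  shows "tame Z w (\<lambda>z x. csqrt (f z x))"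
proof -
  obtain C f' where f: "C \<ge> 0" "\<And>z x. z \<in> Z \<Longrightarrow> cmod x < 1 \<Longrightarrow> cmod (f z x) \<le> C"
    "\<And>z x. z \<in> Z \<Longrightarrow> cmod x < 1 \<Longrightarrow> (f z has_field_derivative f' z x) (at x)"
    "\<And>z x. z \<in> Z \<Longrightarrow> cmod x < 1 \<Longrightarrow> cmod (f' z x) \<le> C * sing_weight (w z) x"
    using tameE[OF assms(1)] by blast
  show ?thesis
  proof (rule tameI[where B="sqrt C" and f'="\<lambda>z x. f' z x * inverse (2 * csqrt (f z x))" and D="C * inverse (2 * sqrt c)"])
    fix z x assume zx: "z \<in> Z" "cmod x < 1"
    show "cmod (csqrt (f z x)) \<le> sqrt C" using f(2)[OF zx] by simp
    have "inverse (2 * sqrt (cmod (f z x))) \<le> inverse (2 * sqrt c)"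
      using assms(2) assms(3)[OF zx] by (intro le_imp_inverse_le) auto
    then have "cmod (f' z x * inverse (2 * csqrt (f z x))) \<le> (C * sing_weight (w z) x) * inverse (2 * sqrt c)"
      unfolding norm_mult norm_inverse using f(1) f(4)[OF zx] sing_weight_nonneg by (intro mult_mono) auto
    then show "((\<lambda>x. csqrt (f z x)) has_field_derivative f' z x * inverse (2 * csqrt (f z x))) (at x) \<and>
        cmod (f' z x * inverse (2 * csqrt (f z x))) \<le> C * inverse (2 * sqrt c) * sing_weight (w z) x"
      using has_field_derivative_csqrt_comp[OF f(3)[OF zx] assms(4)[OF zx]] by (auto simp: mult_ac)
  qed
qed

lemma norm_one_minus_le: assumes "cmod x < 1" "cmod w \<le> 1" shows "cmod (1 - w * x) \<le> 2"
proof -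
  have "cmod (w * x) \<le> 1" unfolding norm_mult using assms by (intro mult_le_one) auto
  then show ?thesis using norm_triangle_ineq4[of 1 "w * x"] by simp
qed

lemma norm_half_inverse_le:
  fixes a s :: complex
  assumes "cmod a \<le> 1" shows "cmod (a * inverse (2 * s)) \<le> 1 / cmod s"
proof -
  have "cmod (a * inverse (2 * s)) = (cmod a / 2) * (1 / cmod s)"
    by (simp add: norm_mult norm_inverse norm_divide field_simps)
  also have "\<dots> \<le> 1 * (1 / cmod s)" using assms by (intro mult_right_mono) auto
  finally show ?thesis by simp
qed

lemma tame_sqrt_one_minus: "tame Z w (\<lambda>z x. csqrt (1 - x))"
proof (rule tameI[where B="sqrt 2" and f'="\<lambda>z x. (-1) * inverse (2 * csqrt (1 - x))" and D=1])
  fix z x :: complex assume x: "cmod x < 1"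
  show "cmod (csqrt (1 - x)) \<le> sqrt 2" using norm_one_minus_le[of x 1] x by simp
  have "((\<lambda>x. 1 - x) has_field_derivative -1) (at x)" by (auto intro!: derivative_eq_intros)
  then have "((\<lambda>x. csqrt (1 - x)) has_field_derivative (-1) * inverse (2 * csqrt (1 - x))) (at x)"
    using one_minus_pos[of x 1] x by (intro has_field_derivative_csqrt_comp) auto
  moreover have "cmod ((-1) * inverse (2 * csqrt (1 - x))) \<le> 1 * sing_weight (w z) x"
    unfolding mult_1 by (rule order_trans[OF norm_half_inverse_le sing_weight_ge(1)]) simp
  ultimately show "((\<lambda>x. csqrt (1 - x)) has_field_derivative (-1) * inverse (2 * csqrt (1 - x))) (at x) \<and>
     cmod ((-1) * inverse (2 * csqrt (1 - x))) \<le> 1 * sing_weight (w z) x" by blast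
qed

lemma tame_sqrt_one_minus_scaled:
  assumes "\<And>z. z \<in> Z \<Longrightarrow> cmod (w z) \<le> 1" shows "tame Z w (\<lambda>z x. csqrt (1 - w z * x))"
proof (rule tameI[where B="sqrt 2" and f'="\<lambda>z x. (- w z) * inverse (2 * csqrt (1 - w z * x))" and D=1])
  fix z x :: complex assume z: "z \<in> Z" and x: "cmod x < 1"
  show "cmod (csqrt (1 - w z * x)) \<le> sqrt 2" using norm_one_minus_le[OF x assms[OF z]] by simp
  have "((\<lambda>x. 1 - w z * x) has_field_derivative - w z) (at x)" by (auto intro!: derivative_eq_intros)
  then have "((\<lambda>x. csqrt (1 - w z * x)) has_field_derivative (- w z) * inverse (2 * csqrt (1 - w z * x))) (at x)"
    using one_minus_pos[OF x assms[OF z]] by (intro has_field_derivative_csqrt_comp) auto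
  moreover have "cmod ((- w z) * inverse (2 * csqrt (1 - w z * x))) \<le> 1 * sing_weight (w z) x"
    unfolding mult_1 by (rule order_trans[OF norm_half_inverse_le sing_weight_ge(2)]) (use assms[OF z] in simp)
  ultimately show "((\<lambda>x. csqrt (1 - w z * x)) has_field_derivative (- w z) * inverse (2 * csqrt (1 - w z * x))) (at x) \<and>
     cmod ((- w z) * inverse (2 * csqrt (1 - w z * x))) \<le> 1 * sing_weight (w z) x" by blast
qed

theorem tame_coeff_bound:
  assumes "tame Z w f" "\<And>z. z \<in> Z \<Longrightarrow> cmod (w z) \<le> 1"
  obtains C where "\<And>z m. z \<in> Z \<Longrightarrow> m \<ge> 1 \<Longrightarrow> cmod (fps_nth (fps_expansion (f z) 0) m) \<le> C * real m powr (-3/4)"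
    "\<And>z. z \<in> Z \<Longrightarrow> f z holomorphic_on ball 0 1"
proof -
  obtain C f' where f: "C \<ge> 0" "\<And>z x. z \<in> Z \<Longrightarrow> cmod x < 1 \<Longrightarrow> cmod (f z x) \<le> C"
    "\<And>z x. z \<in> Z \<Longrightarrow> cmod x < 1 \<Longrightarrow> (f z has_field_derivative f' z x) (at x)"
    "\<And>z x. z \<in> Z \<Longrightarrow> cmod x < 1 \<Longrightarrow> cmod (f' z x) \<le> C * sing_weight (w z) x"
    using tameE[OF assms(1)] by blast
  have h: "f z holomorphic_on ball 0 1" if "z \<in> Z" for z
    unfolding holomorphic_on_open[OF open_ball]
  proof (intro ballI exI)
    fix x :: complex assume "x \<in> ball 0 1"
    then show "(f z has_field_derivative f' z x) (at x)" using f(3)[OF that] by simp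
  qed
  show ?thesis
  proof (rule that[of "12 * C"])
    fix z m assume z: "z \<in> Z" and m: "(m::nat) \<ge> 1"
    show "cmod (fps_nth (fps_expansion (f z) 0) m) \<le> 12 * C * real m powr (-3/4)"
      by (rule coeff_bound_of_deriv_bound[OF h[OF z] assms(2)[OF z] f(1) _ m])
         (use f(3,4)[OF z] DERIV_imp_deriv in metis)
  qed (rule h)
qed

section \<open>Asymptotics of the Jacobi polynomials\<close>

text \<open>Principal square roots of numbers in the closed right half-plane satisfy |Im u| \<le> Re u. This sector
  has a right angle at 0, so two of its elements, or one of its elements and a number in the right
  half-plane, cannot cancel.\<close>

lemma csqrt_sector: assumes "Re u \<ge> 0" shows "\<bar>Im (csqrt u)\<bar> \<le> Re (csqrt u)"
proof -
  have "Re ((csqrt u)\<^sup>2) \<ge> 0" using assms by simp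
  then have "\<bar>Im (csqrt u)\<bar>\<^sup>2 \<le> (Re (csqrt u))\<^sup>2" unfolding Re_power2 by simp
  then show ?thesis by (rule power2_le_imp_le) (rule Re_csqrt)
qed

lemma sector_add_norm_ge:
  assumes "\<bar>Im a\<bar> \<le> Re a" "\<bar>Im b\<bar> \<le> Re b" shows "cmod a \<le> cmod (b + a)"
proof (rule power2_le_imp_le)
  have "\<bar>Im a * Im b\<bar> \<le> Re a * Re b" unfolding abs_mult using assms by (intro mult_mono) auto
  then have "0 \<le> Re a * Re b + Im a * Im b" by linarith
  moreover have "(cmod (b + a))\<^sup>2 = (cmod a)\<^sup>2 + (cmod b)\<^sup>2 + 2 * (Re a * Re b) + 2 * (Im a * Im b)"
    unfolding cmod_power2 by (simp add: power2_eq_square algebra_simps)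
  ultimately show "(cmod a)\<^sup>2 \<le> (cmod (b + a))\<^sup>2"
    using zero_le_power2[of "cmod b"] by linarith
qed simp

lemma sector_add_half_plane_norm_ge:
  assumes "\<bar>Im y\<bar> \<le> Re y" "0 \<le> Re p" shows "cmod p / 2 \<le> cmod (y + p)"
proof (rule power2_le_imp_le)
  have "(Im y)\<^sup>2 \<le> (Re y)\<^sup>2" using assms(1) by (metis abs_le_square_iff abs_of_nonneg order_trans abs_ge_zero)
  moreover have "0 \<le> Re y * Re p" using assms by simp
  moreover have "0 \<le> (Re p)\<^sup>2 + (2 * Im y + Im p)\<^sup>2" by simp
  moreover have "2 * (cmod (y + p))\<^sup>2 - (cmod p)\<^sup>2 =
      2 * (Re y)\<^sup>2 - 2 * (Im y)\<^sup>2 + 4 * (Re y * Re p) + ((Re p)\<^sup>2 + (2 * Im y + Im p)\<^sup>2)"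
    unfolding cmod_power2 by (simp add: power2_eq_square algebra_simps)
  moreover have "A \<le> 2 * B" if "2 * B - A = 2 * c - 2 * d + 4 * u + v" "d \<le> c" "0 \<le> u" "0 \<le> v" for A B c d u v :: real
    using that by linarith
  ultimately have "(cmod p)\<^sup>2 \<le> 2 * (cmod (y + p))\<^sup>2" by blast
  moreover have "(cmod p / 2)\<^sup>2 = (cmod p)\<^sup>2 / 4" by (simp add: power_divide)
  moreover have "A / 4 \<le> B" if "A \<le> 2 * B" "0 \<le> B" for A B :: real using that by linarith
  ultimately show "(cmod p / 2)\<^sup>2 \<le> (cmod (y + p))\<^sup>2" by (metis zero_le_power2)
qed simp

text \<open>Each difference of roots is rationalised: the difference of their squares is a multiple of y^2 or V^2,
  which cancels the singular denominator. What is left has only denominators that the sector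
  estimates bound away from 0.\<close>

lemma singular_parts:
  fixes y V S p w V1 S1 T :: complex
  assumes V: "V\<^sup>2 = w * (y\<^sup>2 - p\<^sup>2)" and V1: "V1\<^sup>2 = - w * p\<^sup>2"
    and S: "S\<^sup>2 = y + p" and S1: "S1\<^sup>2 = p" and T: "T = of_real (sqrt 2) * S1"
    and nz: "y \<noteq> 0" "V \<noteq> 0" "p \<noteq> 0" "V1 \<noteq> 0" "V + V1 \<noteq> 0" "y + p \<noteq> 0" "S + S1 \<noteq> 0" "T + S1 \<noteq> 0" "S + T \<noteq> 0" "w \<noteq> 0"
  shows "S / (y * V) = (S1 / V1) / y + (T / p) / V +
     (S1 * (- ((p * V * inverse (y + p) + V1) * inverse p * inverse V1 * inverse (V + V1))) +
      (- (V * inverse w * inverse (S + S1) * inverse (T + S1) * inverse (S + T) * inverse (y + p))))"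
proof -
  have S10: "S1 \<noteq> 0" using S1 nz by auto
  have ymp: "y - p = V\<^sup>2 / (w * (y + p))"
  proof -
    have "w * (y\<^sup>2 - p\<^sup>2) = (y - p) * (w * (y + p))" by (simp add: algebra_simps power2_eq_square)
    then show ?thesis unfolding V using nz by simp
  qed
  have a: "S / (y * V) = S1 * (1 / (y * V)) + 1 / (V * (S + S1))"
  proof -
    have "(S - S1) * (S + S1) = y" using S S1 by (simp add: algebra_simps power2_eq_square)
    then have "S = S1 + y / (S + S1)" using nz(7) by (metis add.commute diff_add_cancel nonzero_mult_div_cancel_right)
    then have "S / (y * V) = (S1 + y / (S + S1)) / (y * V)" by simp
    also have "\<dots> = S1 * (1 / (y * V)) + 1 / (V * (S + S1))" using nz by (simp add: add_divide_distrib)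
    finally show ?thesis .
  qed
  have b: "1 / (y * V) = 1 / (V1 * y) + 1 / (p * V) - (p * V / (y + p) + V1) / (p * V1 * (V + V1))"
  proof -
    have e1: "(V1 - V) * (V + V1) = - w * y\<^sup>2" using V V1 by (simp add: algebra_simps power2_eq_square)
    have "w * y * p + V1 * (V + V1) = w * p * (y - p) + V1 * V"
      using V1 by (simp add: algebra_simps power2_eq_square)
    also have "\<dots> = V * (p * V / (y + p) + V1)"
    proof -
      have "w * p * (V\<^sup>2 / (w * (y + p))) = V * (p * V / (y + p))" using nz by (simp add: power2_eq_square)
      then show ?thesis unfolding ymp by (simp add: algebra_simps)
    qed
    finally have e2: "w * y * p + V1 * (V + V1) = V * (p * V / (y + p) + V1)" .
    have "1 / (y * V) - 1 / (V1 * y) = (V1 - V) / (y * V * V1)" using nz by (simp add: field_simps)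
    also have "\<dots> = ((V1 - V) * (V + V1)) / (y * V * V1 * (V + V1))" using nz by simp
    also have "\<dots> = - (w * y / (V * V1 * (V + V1)))" 
    proof -
      have "y * V * V1 * (V + V1) = y * (V * V1 * (V + V1))" "- w * y\<^sup>2 = y * (- (w * y))"
        by (simp_all add: power2_eq_square)
      then have "- w * y\<^sup>2 / (y * V * V1 * (V + V1)) = y * (- (w * y)) / (y * (V * V1 * (V + V1)))" by metis
      also have "\<dots> = - (w * y / (V * V1 * (V + V1)))"
        using nz(1) by (simp only: mult_divide_mult_cancel_left_if if_False minus_divide_left)
      finally show ?thesis unfolding e1 .
    qed
    finally have "1 / (y * V) - 1 / (V1 * y) - 1 / (p * V) = - (w * y / (V * V1 * (V + V1))) - 1 / (p * V)" by simp
    also have "\<dots> = - ((w * y * p + V1 * (V + V1)) / (V * (p * V1 * (V + V1))))"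
      using nz by (simp add: divide_simps) (simp add: algebra_simps)?
    also have "\<dots> = - ((p * V / (y + p) + V1) / (p * V1 * (V + V1)))" unfolding e2 using nz by simp
    finally show ?thesis by (simp add: algebra_simps)
  qed
  have c: "1 / (V * (S + S1)) = 1 / (V * (T + S1)) - V / (w * (S + S1) * (T + S1) * (S + T) * (y + p))"
  proof -
    have s2: "(complex_of_real (sqrt 2))\<^sup>2 = 2" by (simp flip: of_real_power)
    have "T\<^sup>2 = 2 * p" unfolding T power_mult_distrib s2 S1 ..
    then have "(T - S) * (S + T) = - (y - p)" using S by (simp add: algebra_simps power2_eq_square)
    then have e: "T - S = - V\<^sup>2 / (w * (y + p)) / (S + T)" using nz(9) ymp
      by (metis minus_divide_left nonzero_mult_div_cancel_right)
    have "1 / (V * (S + S1)) - 1 / (V * (T + S1)) = (T - S) / (V * (S + S1) * (T + S1))"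
      using nz by (simp add: divide_simps) (simp add: algebra_simps)?
    also have "\<dots> = - (V / (w * (S + S1) * (T + S1) * (S + T) * (y + p)))"
      unfolding e using nz by (simp add: power2_eq_square mult_ac)
    finally show ?thesis by (simp add: algebra_simps)
  qed
  have d: "S1 * (1 / (p * V)) + 1 / (V * (T + S1)) = (T / p) / V"
  proof -
    have "S1 * (T + S1) + p = T * (T + S1)"
    proof -
      have s2: "(complex_of_real (sqrt 2))\<^sup>2 = 2" by (simp flip: of_real_power)
      have "T\<^sup>2 = 2 * p" unfolding T power_mult_distrib s2 S1 ..
      then show ?thesis using S1 by (simp add: algebra_simps power2_eq_square)
    qed
    then have "(S1 * (T + S1) + p) / (p * V * (T + S1)) = T * (T + S1) / (p * V * (T + S1))" by simp
    moreover have "(S1 * (T + S1) + p) / (p * V * (T + S1)) = S1 * (1 / (p * V)) + 1 / (V * (T + S1))"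
      using nz by (simp add: add_divide_distrib)
    moreover have "T * (T + S1) / (p * V * (T + S1)) = (T / p) / V" using nz by simp
    ultimately show ?thesis by simp
  qed
  have "S / (y * V) = (S1 / V1) / y + (S1 * (1 / (p * V)) + 1 / (V * (T + S1))) +
     (S1 * (- ((p * V / (y + p) + V1) / (p * V1 * (V + V1)))) - V / (w * (S + S1) * (T + S1) * (S + T) * (y + p)))"
    unfolding a b c by (simp add: algebra_simps)
  then show ?thesis unfolding d by (simp add: divide_inverse mult_ac)
qed

definition left_exterior :: "complex set" where
  "left_exterior = {z. Re z < 0 \<and> cmod (1 - z\<^sup>2) > 1}"

lemma left_exterior_facts:
  assumes "z \<in> left_exterior"
  shows "Re z < 0" "1 - z\<^sup>2 \<noteq> 0" "cmod (1 / (1 - z\<^sup>2)) < 1" "z \<noteq> 0" "1 + z \<noteq> 0" "1 - z \<noteq> 0"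
proof -
  show z: "Re z < 0" "1 - z\<^sup>2 \<noteq> 0" using assms by (auto simp: left_exterior_def)
  show "cmod (1 / (1 - z\<^sup>2)) < 1" using assms by (auto simp: left_exterior_def norm_divide divide_less_eq)
  show "z \<noteq> 0" "1 + z \<noteq> 0" "1 - z \<noteq> 0" using z by (auto simp: power2_eq_square add_eq_0_iff)
qed

lemma left_exterior_not_nonneg: assumes "z \<in> left_exterior" shows "1 - z\<^sup>2 \<notin> \<real>\<^sub>\<ge>\<^sub>0"
proof
  assume "1 - z\<^sup>2 \<in> \<real>\<^sub>\<ge>\<^sub>0"
  then obtain r where r: "1 - z\<^sup>2 = of_real r" "r \<ge> 0" by (metis nonneg_Reals_cases)
  then have "r > 1" using assms by (auto simp: left_exterior_def)
  have "z\<^sup>2 = of_real (1 - r)" using r(1) by (simp add: algebra_simps)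
  then have "Re (z\<^sup>2) < 0" "Im (z\<^sup>2) = 0" using \<open>r > 1\<close> by auto
  then have "Re z * Im z = 0" "(Re z)\<^sup>2 < (Im z)\<^sup>2" by (auto simp: Re_power2 Im_power2)
  then show False using assms by (auto simp: left_exterior_def)
qed

text \<open>On this domain 1 - z^2 avoids the nonnegative axis, so half its argument lies strictly between 0 and
  \<pi>, and i times the branch has positive real part.\<close>

lemma root_prod_exterior: assumes "z \<in> left_exterior" shows "root_prod z = - \<i> * csqrt (z\<^sup>2 - 1)"
proof -
  note z = left_exterior_facts[OF assms]
  define t where "t = Arg2pi (1 - z\<^sup>2)"
  have "t \<noteq> 0" using left_exterior_not_nonneg[OF assms] Arg2pi_eq_0[of "1 - z\<^sup>2"]
    by (auto simp: t_def complex_nonneg_Reals_iff complex_is_Real_iff)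
  then have t: "0 < t" "t < 2 * pi" using Arg2pi_ge_0[of "1 - z\<^sup>2"] Arg2pi_lt_2pi[of "1 - z\<^sup>2"] by (auto simp: t_def)
  have "csqrt (z\<^sup>2 - 1) = \<i> * root_prod z"
  proof (rule csqrt_unique)
    show "(\<i> * root_prod z)\<^sup>2 = z\<^sup>2 - 1" by (simp add: power_mult_distrib root_prod_square)
    have "Re (\<i> * root_prod z) = sqrt (cmod (1 - z\<^sup>2)) * sin (t / 2)"
      using root_prod_left[OF z(1,2)] by (simp add: t_def)
    moreover have "sin (t / 2) > 0" using t by (intro sin_gt_zero) auto
    ultimately show "0 < Re (\<i> * root_prod z) \<or> Re (\<i> * root_prod z) = 0 \<and> 0 \<le> Im (\<i> * root_prod z)"
      using z(2) by simp
  qed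
  then show ?thesis by simp
qed

lemma z2m1_not_nonpos: assumes "z \<in> left_exterior" shows "z\<^sup>2 - 1 \<notin> \<real>\<^sub>\<le>\<^sub>0"
  using left_exterior_not_nonneg[OF assms] by (auto simp: complex_nonneg_Reals_iff complex_nonpos_Reals_iff)

text \<open>With s the root of z^2 - 1, both sides have the same square. As (-z)^2 and s^2 have equal imaginary
  parts, Im (-z) and Im s do not have opposite signs, so -z/s has positive real part.\<close>

lemma csqrt_one_minus_inverse:
  assumes "z \<in> left_exterior" shows "csqrt (1 - 1 / (1 - z\<^sup>2)) = - z / csqrt (z\<^sup>2 - 1)"
proof (rule csqrt_unique)
  note z = left_exterior_facts[OF assms]
  define s where "s = csqrt (z\<^sup>2 - 1)"
  have s2: "s\<^sup>2 = z\<^sup>2 - 1" by (simp add: s_def)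
  have Res: "Re s > 0" unfolding s_def by (rule Re_csqrt_pos[OF z2m1_not_nonpos[OF assms]])
  then have s0: "s \<noteq> 0" by auto
  show "(- z / csqrt (z\<^sup>2 - 1))\<^sup>2 = 1 - 1 / (1 - z\<^sup>2)"
    using z(2) by (simp add: power_divide divide_simps) (simp add: algebra_simps)?
  have "Im (s\<^sup>2) = Im (z\<^sup>2)" unfolding s2 by simp
  then have im: "Re s * Im s = Re z * Im z" by (simp add: Im_power2)
  have "0 \<le> (- Im z) * Im s"
  proof -
    have "0 \<le> (Re z * Im z) * (Re z * Im z)" by simp
    also have "\<dots> = (Re s * Im s) * (Re z * Im z)" unfolding im ..
    also have "\<dots> = (Re s * (- Re z)) * ((- Im z) * Im s)" by simp
    finally have "0 \<le> (Re s * (- Re z)) * ((- Im z) * Im s)" .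
    moreover have "0 < Re s * (- Re z)" using Res z(1) by (simp add: mult_pos_neg)
    ultimately show ?thesis by (metis zero_le_mult_iff not_less)
  qed
  moreover have "0 < (- Re z) * Re s" using Res z(1) by (simp add: mult_neg_pos)
  ultimately have "0 < Re ((- z) * cnj s)" by simp
  moreover have "Re (- z / s) = Re ((- z) * cnj s) / (cmod s)\<^sup>2"
    unfolding complex_div_cnj[of "- z" s] by (simp only: Re_divide_of_real flip: of_real_power)
  ultimately have "0 < Re (- z / s)" using s0 by simp
  then show "0 < Re (- z / csqrt (z\<^sup>2 - 1)) \<or> Re (- z / csqrt (z\<^sup>2 - 1)) = 0 \<and> 0 \<le> Im (- z / csqrt (z\<^sup>2 - 1))"
    by (simp add: s_def)
qed

definition exterior_range :: "real \<Rightarrow> real \<Rightarrow> complex set" where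
  "exterior_range e R = {z \<in> left_exterior. e \<le> cmod z \<and> cmod z \<le> R}"

text \<open>The coefficients of the two singular parts: the values of \<^const>\<open>jacobi_gf\<close> z times (1 - x)^(1/2) at
  x = 1, and of \<^const>\<open>jacobi_gf\<close> z times (1 - x/(1 - z^2))^(1/2) at x = 1 - z^2, where y = -z.\<close>

definition sing_a :: "complex \<Rightarrow> complex" where "sing_a z = csqrt (- z) / csqrt (1 - 1 / (1 - z\<^sup>2))"
definition sing_b :: "complex \<Rightarrow> complex" where "sing_b z = of_real (sqrt 2) * csqrt (- z) / (- z)"

text \<open>The remainder is assembled from square roots by sums, products and inverses. Uniform lower bounds
  for the denominators come from the sector lemmas and from |z| \<ge> e; the bound |z| \<le> R keeps w away from
  0.\<close>

lemma jacobi_gf_decomposition: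
  assumes e: "e > 0"
  shows "\<exists>f. tame (exterior_range e R) (\<lambda>z. 1 / (1 - z\<^sup>2)) f \<and>
    (\<forall>z\<in>exterior_range e R. \<forall>x. cmod x < 1 \<longrightarrow>
       jacobi_gf z x = sing_a z * (1 / csqrt (1 - 1 * x)) + sing_b z * (1 / csqrt (1 - 1 / (1 - z\<^sup>2) * x)) + f z x)"
proof -
  define Z where "Z = exterior_range e R"
  define w where "w z = 1 / (1 - z\<^sup>2)" for z :: complex
  define V1 where "V1 z = csqrt (1 - w z)" for z
  define S1 where "S1 z = csqrt (- z)" for z :: complex
  define T where "T z = of_real (sqrt 2) * S1 z" for z
  define y where "y x = csqrt (1 - x)" for x :: complex
  define V where "V z x = csqrt (1 - w z * x)" for z x
  define S where "S z x = csqrt (y x + (- z))" for z x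
  define f where "f z x =
     (S1 z * ((-1) * (((- z) * V z x * inverse (y x + (- z)) + V1 z) * inverse (- z) * inverse (V1 z) * inverse (V z x + V1 z))) +
      ((-1) * (V z x * inverse (w z) * inverse (S z x + S1 z) * inverse (T z + S1 z) * inverse (S z x + T z) * inverse (y x + (- z)))))" for z x
  have Z: "z \<in> left_exterior" "e \<le> cmod z" "cmod z \<le> R" if "z \<in> Z" for z
    using that by (auto simp: Z_def exterior_range_def)
  have w1: "cmod (w z) \<le> 1" if "z \<in> Z" for z
    using left_exterior_facts(3)[OF Z(1)[OF that]] by (simp add: w_def)
  have w0: "w z \<noteq> 0" if "z \<in> Z" for z
    using left_exterior_facts(2)[OF Z(1)[OF that]] by (simp add: w_def)
  have z2: "cmod (1 - z\<^sup>2) \<le> 1 + R\<^sup>2" if "z \<in> Z" for z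
  proof -
    have "cmod (1 - z\<^sup>2) \<le> 1 + cmod z ^ 2" by (metis norm_one norm_power norm_triangle_ineq4)
    also have "\<dots> \<le> 1 + R\<^sup>2" using Z(3)[OF that] by (intro add_left_mono power_mono) auto
    finally show ?thesis .
  qed
  have secy: "\<bar>Im (y x)\<bar> \<le> Re (y x)" if "cmod x < 1" for x
    unfolding y_def using one_minus_pos[of x 1] that by (intro csqrt_sector) auto
  have secV: "\<bar>Im (V z x)\<bar> \<le> Re (V z x)" if "z \<in> Z" "cmod x < 1" for z x
    unfolding V_def using one_minus_pos[OF that(2) w1[OF that(1)]] by (intro csqrt_sector) auto
  have secV1: "\<bar>Im (V1 z)\<bar> \<le> Re (V1 z)" if "z \<in> Z" for z
    unfolding V1_def using w1[OF that] complex_Re_le_cmod[of "w z"] by (intro csqrt_sector) auto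
  have secS1: "\<bar>Im (S1 z)\<bar> \<le> Re (S1 z)" if "z \<in> Z" for z
    unfolding S1_def using left_exterior_facts(1)[OF Z(1)[OF that]] by (intro csqrt_sector) auto
  have secT: "\<bar>Im (T z)\<bar> \<le> Re (T z)" if "z \<in> Z" for z
    unfolding T_def using secS1[OF that] by (simp add: abs_mult)
  have ReyP: "Re (y x + (- z)) > 0" if "z \<in> Z" "cmod x < 1" for z x
    using secy[OF that(2)] left_exterior_facts(1)[OF Z(1)[OF that(1)]] by simp
  have secS: "\<bar>Im (S z x)\<bar> \<le> Re (S z x)" if "z \<in> Z" "cmod x < 1" for z x
    unfolding S_def using ReyP[OF that] by (intro csqrt_sector) auto
  have nS1: "sqrt e \<le> cmod (S1 z)" "cmod (S1 z) \<le> sqrt R" if "z \<in> Z" for z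
    using Z(2,3)[OF that] by (simp_all add: S1_def)
  have nT: "sqrt e \<le> cmod (T z)" if "z \<in> Z" for z
  proof -
    have "1 * cmod (S1 z) \<le> sqrt 2 * cmod (S1 z)" by (intro mult_right_mono) auto
    then show ?thesis using nS1[OF that] by (simp add: T_def norm_mult)
  qed
  (* a lower bound for |V1|, because V1^2 = z^2 / (z^2 - 1) *)
  define v where "v = sqrt (e\<^sup>2 / (1 + R\<^sup>2))"
  have pos: "1 + R\<^sup>2 > 0" by (simp add: add_pos_nonneg)
  have v: "v > 0" using e pos by (simp add: v_def)
  have V1sq: "(V1 z)\<^sup>2 = - w z * (- z)\<^sup>2" if "z \<in> Z" for z
    using left_exterior_facts(2)[OF Z(1)[OF that]] by (simp add: V1_def w_def field_simps)
  have nV1: "v \<le> cmod (V1 z)" "cmod (V1 z) \<le> sqrt 2" if "z \<in> Z" for z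
  proof -
    have "e\<^sup>2 / (1 + R\<^sup>2) \<le> cmod z ^ 2 / cmod (1 - z\<^sup>2)"
      using z2[OF that] Z(2)[OF that] e left_exterior_facts(2)[OF Z(1)[OF that]] by (intro frac_le power_mono) auto
    also have "\<dots> = cmod ((V1 z)\<^sup>2)" unfolding V1sq[OF that] by (simp add: w_def norm_divide norm_mult norm_power)
    finally have "sqrt (e\<^sup>2 / (1 + R\<^sup>2)) \<le> sqrt (cmod ((V1 z)\<^sup>2))" by (rule real_sqrt_le_mono)
    then show "v \<le> cmod (V1 z)" by (simp add: v_def norm_power)
    have "cmod (1 - w z) \<le> 2" using norm_triangle_ineq4[of 1 "w z"] w1[OF that] by simp
    then show "cmod (V1 z) \<le> sqrt 2" by (simp add: V1_def)
  qed
  have lyp: "e / 2 \<le> cmod (y x + (- z))" if "z \<in> Z" "cmod x < 1" for z x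
    using sector_add_half_plane_norm_ge[OF secy[OF that(2)], of "- z"] left_exterior_facts(1)[OF Z(1)[OF that(1)]] Z(2)[OF that(1)] by simp
  have lV: "v \<le> cmod (V z x + V1 z)" if "z \<in> Z" "cmod x < 1" for z x
    using sector_add_norm_ge[OF secV1[OF that(1)] secV[OF that]] nV1[OF that(1)] by simp
  have lS: "sqrt e \<le> cmod (S z x + S1 z)" "sqrt e \<le> cmod (S z x + T z)" if "z \<in> Z" "cmod x < 1" for z x
    using sector_add_norm_ge[OF secS1[OF that(1)] secS[OF that]] sector_add_norm_ge[OF secT[OF that(1)] secS[OF that]]
      nS1[OF that(1)] nT[OF that(1)] by simp_all
  have lT: "sqrt e \<le> cmod (T z + S1 z)" if "z \<in> Z" for z
    using sector_add_norm_ge[OF secS1[OF that] secT[OF that]] nS1[OF that] by simp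
  have se: "sqrt e > 0" using e by simp
  have inv_le: "cmod (inverse u) \<le> inverse c" if "0 < c" "c \<le> cmod u" for u c
    unfolding norm_inverse using that by (intro le_imp_inverse_le)
  have ty: "tame Z w (\<lambda>z x. y x)" unfolding y_def by (rule tame_sqrt_one_minus)
  have tV: "tame Z w V" unfolding V_def by (rule tame_sqrt_one_minus_scaled) (rule w1)
  have tz: "tame Z w (\<lambda>z x. - z)" by (rule tame_const[where B=R]) (simp add: Z)
  have tyz: "tame Z w (\<lambda>z x. y x + (- z))" by (rule tame_add[OF ty tz])
  have tS: "tame Z w S" unfolding S_def by (rule tame_csqrt[OF tyz, of "e/2"]) (use e lyp ReyP in auto)
  have tV1: "tame Z w (\<lambda>z x. V1 z)" by (rule tame_const) (rule nV1(2))
  have tS1: "tame Z w (\<lambda>z x. S1 z)" by (rule tame_const) (rule nS1(2))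
  have tT: "tame Z w (\<lambda>z x. T z)"
    by (rule tame_const[where B="sqrt 2 * sqrt R"]) (simp add: T_def norm_mult nS1(2))
  have m1: "tame Z w (\<lambda>z x. -1)" by (rule tame_const[where B=1]) simp
  have iz: "tame Z w (\<lambda>z x. inverse (- z))" by (rule tame_inverse[OF tz e]) (simp add: Z)
  have iV1: "tame Z w (\<lambda>z x. inverse (V1 z))" by (rule tame_inverse[OF tV1 v]) (rule nV1(1))
  have iw: "tame Z w (\<lambda>z x. inverse (w z))" by (rule tame_const[where B="1 + R\<^sup>2"]) (simp add: w_def z2)
  have iT: "tame Z w (\<lambda>z x. inverse (T z + S1 z))" by (rule tame_inverse[OF tame_add[OF tT tS1] se]) (rule lT)
  have "tame Z w f"
    unfolding f_def
    by (intro tame_add tame_mult m1 tS1 tV tz tV1 iz iV1 iw iT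
        tame_inverse[OF tyz, of "e/2"] tame_inverse[OF tame_add[OF tV tV1] v]
        tame_inverse[OF tame_add[OF tS tS1] se] tame_inverse[OF tame_add[OF tS tT] se])
       (use e lyp lV lS in auto)
  moreover have "jacobi_gf z x = sing_a z * (1 / csqrt (1 - 1 * x)) + sing_b z * (1 / csqrt (1 - 1 / (1 - z\<^sup>2) * x)) + f z x"
    if z: "z \<in> Z" and x: "cmod x < 1" for z x
  proof -
    have "jacobi_gf z x = S z x / (y x * V z x)" by (simp add: jacobi_gf_def S_def y_def V_def w_def)
    also have "\<dots> = (S1 z / V1 z) / y x + (T z / (- z)) / V z x +
     (S1 z * (- (((- z) * V z x * inverse (y x + (- z)) + V1 z) * inverse (- z) * inverse (V1 z) * inverse (V z x + V1 z))) +
      (- (V z x * inverse (w z) * inverse (S z x + S1 z) * inverse (T z + S1 z) * inverse (S z x + T z) * inverse (y x + (- z)))))"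
    proof (rule singular_parts)
      show "(V z x)\<^sup>2 = w z * ((y x)\<^sup>2 - (- z)\<^sup>2)"
        using left_exterior_facts(2)[OF Z(1)[OF z]] by (simp add: V_def w_def y_def field_simps)
      show "(V1 z)\<^sup>2 = - w z * (- z)\<^sup>2" by (rule V1sq[OF z])
      show "(S z x)\<^sup>2 = y x + (- z)" by (simp add: S_def)
      show "(S1 z)\<^sup>2 = - z" by (simp add: S1_def)
      show "T z = of_real (sqrt 2) * S1 z" by (simp add: T_def)
      show "y x \<noteq> 0" using one_minus_pos[of x 1] x by (auto simp: y_def)
      have "1 - w z * x \<noteq> 0" using one_minus_pos[OF x w1[OF z]] by (metis less_irrefl zero_complex.simps(1))
      then show "V z x \<noteq> 0" by (simp add: V_def)
      show "- z \<noteq> 0" using Z(2)[OF z] e by auto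
      show "V1 z \<noteq> 0" using nV1(1)[OF z] v by auto
      show "V z x + V1 z \<noteq> 0" using lV[OF z x] v by auto
      show "y x + (- z) \<noteq> 0" using lyp[OF z x] e by auto
      show "S z x + S1 z \<noteq> 0" using lS(1)[OF z x] se by auto
      show "T z + S1 z \<noteq> 0" using lT[OF z] se by auto
      show "S z x + T z \<noteq> 0" using lS(2)[OF z x] se by auto
      show "w z \<noteq> 0" by (rule w0[OF z])
    qed
    also have "\<dots> = sing_a z * (1 / y x) + sing_b z * (1 / V z x) + f z x"
      by (simp add: sing_a_def sing_b_def f_def S1_def V1_def T_def w_def)
    finally show ?thesis by (simp add: y_def V_def w_def)
  qed
  ultimately show ?thesis unfolding Z_def w_def by blast
qed

text \<open>The singular parts have the coefficients of the binomial series; the remainder is tame.\<close>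

lemma jacobi_gf_coeff_asymptotics:
  assumes e: "e > 0"
  obtains C where "\<And>z m. z \<in> exterior_range e R \<Longrightarrow> m \<ge> 1 \<Longrightarrow>
    cmod (fps_nth (fps_expansion (jacobi_gf z) 0) m - of_real (half_coeff m) * (sing_a z + sing_b z * (1 / (1 - z\<^sup>2)) ^ m))
      \<le> C * real m powr (-3/4)"
proof -
  obtain f where f: "tame (exterior_range e R) (\<lambda>z. 1 / (1 - z\<^sup>2)) f"
    "\<And>z x. z \<in> exterior_range e R \<Longrightarrow> cmod x < 1 \<Longrightarrow>
       jacobi_gf z x = sing_a z * (1 / csqrt (1 - 1 * x)) + sing_b z * (1 / csqrt (1 - 1 / (1 - z\<^sup>2) * x)) + f z x"
    using jacobi_gf_decomposition[OF e] by blast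
  have w: "cmod (1 / (1 - z\<^sup>2)) \<le> 1" if "z \<in> exterior_range e R" for z
    using left_exterior_facts(3)[of z] that by (simp add: exterior_range_def)
  obtain C where C: "\<And>z m. z \<in> exterior_range e R \<Longrightarrow> m \<ge> 1 \<Longrightarrow> cmod (fps_nth (fps_expansion (f z) 0) m) \<le> C * real m powr (-3/4)"
    "\<And>z. z \<in> exterior_range e R \<Longrightarrow> f z holomorphic_on ball 0 1"
    using tame_coeff_bound[OF f(1)] w by blast
  show ?thesis
  proof (rule that)
    fix z and m :: nat assume z: "z \<in> exterior_range e R" and m: "m \<ge> 1"
    have "f z has_fps_expansion fps_expansion (f z) 0"
      by (rule has_fps_expansion_fps_expansion[OF open_ball _ C(2)[OF z]]) simp
    then have "(\<lambda>x. sing_a z * (1 / csqrt (1 - 1 * x)) + sing_b z * (1 / csqrt (1 - 1 / (1 - z\<^sup>2) * x)) + f z x)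
       has_fps_expansion (fps_const (sing_a z) * inv_sqrt_fps 1 + fps_const (sing_b z) * inv_sqrt_fps (1 / (1 - z\<^sup>2)) + fps_expansion (f z) 0)"
      by (intro has_fps_expansion_add has_fps_expansion_mult has_fps_expansion_const has_fps_expansion_inv_csqrt)
    moreover have "eventually (\<lambda>x. sing_a z * (1 / csqrt (1 - 1 * x)) + sing_b z * (1 / csqrt (1 - 1 / (1 - z\<^sup>2) * x)) + f z x = jacobi_gf z x) (nhds 0)"
    proof -
      have "eventually (\<lambda>x::complex. x \<in> ball 0 1) (nhds 0)" by (intro eventually_nhds_in_open) auto
      then show ?thesis by eventually_elim (use f(2)[OF z] in simp)
    qed
    ultimately have "jacobi_gf z has_fps_expansion (fps_const (sing_a z) * inv_sqrt_fps 1 + fps_const (sing_b z) * inv_sqrt_fps (1 / (1 - z\<^sup>2)) + fps_expansion (f z) 0)"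
      by (rule iffD1[OF has_fps_expansion_cong[OF _ refl], rotated])
    from fps_expansion_eqI[OF this] have "fps_nth (fps_expansion (jacobi_gf z) 0) m = sing_a z * of_real (half_coeff m) +
       sing_b z * (of_real (half_coeff m) * (1 / (1 - z\<^sup>2)) ^ m) + fps_nth (fps_expansion (f z) 0) m"
      by (simp only: fps_add_nth fps_mult_left_const_nth inv_sqrt_fps_nth power_one mult_1_right)
    then have "fps_nth (fps_expansion (jacobi_gf z) 0) m - of_real (half_coeff m) * (sing_a z + sing_b z * (1 / (1 - z\<^sup>2)) ^ m)
        = fps_nth (fps_expansion (f z) 0) m" by (simp add: algebra_simps)
    then show "cmod (fps_nth (fps_expansion (jacobi_gf z) 0) m - of_real (half_coeff m) * (sing_a z + sing_b z * (1 / (1 - z\<^sup>2)) ^ m))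
      \<le> C * real m powr (-3/4)" using C(1)[OF z m] by simp
  qed
qed

text \<open>The Jacobi polynomial divided by the contribution of the singularity x = 1. The factors are free of
  zeros and singularities on the exterior domain.\<close>

definition normalized_P :: "nat \<Rightarrow> complex \<Rightarrow> complex" where
  "normalized_P m z = csqrt (1 - z) * csqrt (- z) * poly (jacobi_P m) z /
     (of_real (half_coeff m) * (2 * (1 + z)) ^ m * csqrt (z\<^sup>2 - 1))"

text \<open>The two singular contributions are in the ratio b w^m / a, and 1 + b w^m / a is q. Dividing the
  error O(m^(-3/4)) by the coefficient of (1 - x)^(-1/2), of order m^(-1/2), leaves O(m^(-1/4)).\<close>

theorem normalized_P_asymptotics:
  assumes e: "e > 0"
  obtains C where "\<And>z m. z \<in> exterior_range e R \<Longrightarrow> m \<ge> 1 \<Longrightarrow>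
    cmod (normalized_P m z - q m z) \<le> C * real m powr (-1/4)"
proof -
  obtain C where C: "\<And>z m. z \<in> exterior_range e R \<Longrightarrow> m \<ge> 1 \<Longrightarrow>
    cmod (fps_nth (fps_expansion (jacobi_gf z) 0) m - of_real (half_coeff m) * (sing_a z + sing_b z * (1 / (1 - z\<^sup>2)) ^ m))
      \<le> C * real m powr (-3/4)"
    using jacobi_gf_coeff_asymptotics[OF e] by blast
  show ?thesis
  proof (rule that)
    fix z and m :: nat assume z: "z \<in> exterior_range e R" and m: "m \<ge> 1"
    have zl: "z \<in> left_exterior" "e \<le> cmod z" using z by (auto simp: exterior_range_def)
    note zD = left_exterior_facts[OF zl(1)]
    define s where "s = csqrt (z\<^sup>2 - 1)"
    have s0: "s \<noteq> 0" using z2m1_not_nonpos[OF zl(1)] by (auto simp: s_def)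
    define S1 where "S1 = csqrt (- z)"
    have S1: "S1 \<noteq> 0" "S1\<^sup>2 = - z" using zD(4) by (auto simp: S1_def)
    define \<beta> where "\<beta> = complex_of_real (half_coeff m)"
    have \<beta>: "\<beta> \<noteq> 0" using half_coeff_pos[of m] by (simp add: \<beta>_def)
    define w where "w = 1 / (1 - z\<^sup>2)"
    define g where "g = fps_nth (fps_expansion (jacobi_gf z) 0) m"
    have a: "sing_a z = s / S1"
    proof -
      have "sing_a z = S1 / (S1\<^sup>2 / s)" 
        unfolding sing_a_def csqrt_one_minus_inverse[OF zl(1)] S1(2) by (simp add: S1_def s_def)
      also have "\<dots> = s / S1" using S1(1) s0 by (simp add: power2_eq_square)
      finally show ?thesis .
    qed
    have b: "sing_b z = of_real (sqrt 2) / S1"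
    proof -
      have "sing_b z = of_real (sqrt 2) * S1 / S1\<^sup>2" unfolding S1(2) by (simp add: sing_b_def S1_def)
      then show ?thesis using S1(1) by (simp add: power2_eq_square)
    qed
    have nP: "normalized_P m z = g / (\<beta> * sing_a z)"
    proof -
      have "A * S1 * B / (\<beta> * D * s) = A * B / D / (\<beta> * (s / S1))" for A B D
        using S1(1) s0 \<beta> by (cases "D = 0") (simp_all add: field_simps)
      then show ?thesis
        unfolding normalized_P_def g_def jacobi_gf_coeff[OF zD(1,2)] a S1_def[symmetric] s_def[symmetric] \<beta>_def[symmetric] .
    qed
    have qz: "q m z = (\<beta> * (sing_a z + sing_b z * w ^ m)) / (\<beta> * sing_a z)"
    proof -
      have "q m z = 1 - \<i> * of_real (sqrt 2) / ((1 - z\<^sup>2) ^ m * (- \<i> * s))"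
        unfolding q_altdef root_prod_exterior[OF zl(1)] s_def ..
      also have "\<dots> = 1 + of_real (sqrt 2) * w ^ m / s" using s0 zD(2) by (simp add: w_def field_simps power_one_over)
      also have "\<dots> = (\<beta> * (sing_a z + sing_b z * w ^ m)) / (\<beta> * sing_a z)"
        unfolding a b using S1 s0 \<beta> by (simp add: field_simps)
      finally show ?thesis .
    qed
    have "normalized_P m z - q m z = (g - \<beta> * (sing_a z + sing_b z * w ^ m)) / (\<beta> * sing_a z)"
      unfolding nP qz by (simp add: diff_divide_distrib)
    then have "cmod (normalized_P m z - q m z) = cmod (g - \<beta> * (sing_a z + sing_b z * w ^ m)) * (cmod S1 / cmod s) / half_coeff m"
      using half_coeff_pos[of m] by (simp add: norm_divide norm_mult a \<beta>_def)
    also have "\<dots> \<le> (C * real m powr (-3/4)) * sqrt \<bar>R\<bar> / (1 / (2 * sqrt (real m)))"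
    proof (rule frac_le)
      have g1: "cmod (g - \<beta> * (sing_a z + sing_b z * w ^ m)) \<le> C * real m powr (-3/4)"
        using C[OF z m] by (simp add: g_def \<beta>_def w_def)
      have g0: "0 \<le> C * real m powr (-3/4)" using g1 norm_ge_zero order_trans by blast
      have "cmod s \<ge> 1"
      proof -
        have "cmod s = sqrt (cmod (1 - z\<^sup>2))" by (simp add: s_def norm_minus_commute)
        then show ?thesis using zl(1) by (simp add: left_exterior_def)
      qed
      moreover have "cmod S1 \<le> sqrt \<bar>R\<bar>" using z by (auto simp: S1_def exterior_range_def)
      ultimately have "cmod S1 / cmod s \<le> sqrt \<bar>R\<bar> / 1" by (intro frac_le) auto
      then show "cmod (g - \<beta> * (sing_a z + sing_b z * w ^ m)) * (cmod S1 / cmod s) \<le> C * real m powr (-3/4) * sqrt \<bar>R\<bar>"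
        using g0 by (intro mult_mono[OF g1]) auto
      show "0 \<le> C * real m powr (-3/4) * sqrt \<bar>R\<bar>" using g0 by (rule mult_nonneg_nonneg) simp
      show "1 / (2 * sqrt (real m)) \<le> half_coeff m" by (rule half_coeff_lower[OF m])
    qed (use m in auto)
    also have "\<dots> = 2 * C * sqrt \<bar>R\<bar> * (real m powr (-3/4) * real m powr (1/2))"
      by (simp add: powr_half_sqrt)
    also have "real m powr (-3/4) * real m powr (1/2) = real m powr (-1/4)"
      by (subst powr_add[symmetric]) simp
    finally show "cmod (normalized_P m z - q m z) \<le> 2 * C * sqrt \<bar>R\<bar> * real m powr (-1/4)" .
  qed
qed

section \<open>Exactly one zero near each approximate zero of q\<close>

text \<open>By Rouche's theorem the zeros of f in the disc have total multiplicity 1, as for g(z) (z - z0).\<close>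

lemma Rouche_unique_zero:
  assumes r: "0 < r" "r < R" and f: "f holomorphic_on ball z0 R" and g: "g holomorphic_on ball z0 R"
      "\<And>z. z \<in> ball z0 R \<Longrightarrow> g z \<noteq> 0"
    and less: "\<And>z. dist z0 z = r \<Longrightarrow> cmod (f z - g z * (z - z0)) < cmod (g z * (z - z0))"
  shows "\<exists>!z. z \<in> cball z0 r \<and> f z = 0"
proof -
  define h where "h z = g z * (z - z0)" for z
  (* a radius strictly between r and R, so that only finitely many zeros of f lie in s *)
  define s where "s = ball z0 ((r + R) / 2)"
  define \<gamma> where "\<gamma> = circlepath z0 r"
  have s: "open s" "connected s" "s \<subseteq> ball z0 R" "z0 \<in> s" using r by (auto simp: s_def)
  have im: "path_image \<gamma> = sphere z0 r" using r by (simp add: \<gamma>_def)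
  have z1: "z0 + of_real r \<in> sphere z0 r" "z0 + of_real r \<in> s" using r by (auto simp: dist_norm s_def)
  then have f1: "f (z0 + of_real r) \<noteq> 0" using less[of "z0 + of_real r"] by auto
  have h: "h holomorphic_on ball z0 R" unfolding h_def by (intro holomorphic_intros g)
  have hs: "f holomorphic_on s" "h holomorphic_on s" "g holomorphic_on s"
    using f h g(1) s(3) holomorphic_on_subset by blast+
  have zh: "{p \<in> s. h p = 0} = {z0}" using g(2) s by (auto simp: h_def)
  define A where "A = {p \<in> s. f p = 0}"
  have finA: "finite A"
  proof (cases "f constant_on ball z0 R")
    case True
    then have "A = {}" using f1 z1(2) s(3) unfolding A_def constant_on_def by (metis (mono_tags, lifting) Collect_empty_eq subsetD)
    then show ?thesis by simp
  next
    case False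
    have "cball z0 ((r + R) / 2) \<subseteq> ball z0 R" using r by auto
    then have "finite {p \<in> cball z0 ((r + R) / 2). f p = 0}"
      by (rule holomorphic_compact_finite_zeros[OF f open_ball connected_ball compact_cball _ False])
    then show ?thesis by (rule rev_finite_subset) (auto simp: A_def s_def)
  qed
  have fh: "h p + (f p - h p) = f p" for p by simp
  have "(\<Sum>p\<in>{p \<in> s. h p + (f p - h p) = 0}. winding_number \<gamma> p * zorder (\<lambda>p. h p + (f p - h p)) p)
      = (\<Sum>p\<in>{p \<in> s. h p = 0}. winding_number \<gamma> p * zorder h p)"
  proof (rule Rouche_theorem)
    show "finite {p \<in> s. h p + (f p - h p) = 0}" unfolding fh using finA by (simp add: A_def)
    show "finite {p \<in> s. h p = 0}" unfolding zh by simp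
    show "(\<lambda>p. f p - h p) holomorphic_on s" by (intro holomorphic_intros hs)
    show "path_image \<gamma> \<subseteq> s" unfolding im s_def using r by auto
    show "\<forall>z\<in>path_image \<gamma>. cmod (f z - h z) < cmod (h z)" unfolding im h_def using less by auto
    show "\<forall>z. z \<notin> s \<longrightarrow> winding_number \<gamma> z = 0"
    proof (intro allI impI)
      fix z assume "z \<notin> s"
      then have "z \<notin> cball z0 r" using r by (auto simp: s_def)
      then show "winding_number \<gamma> z = 0"
        by (intro winding_number_zero_outside[of \<gamma> "cball z0 r"]) (use r in \<open>auto simp: \<gamma>_def\<close>)
    qed
  qed (use s hs in \<open>auto simp: \<gamma>_def\<close>)
  then have "(\<Sum>p\<in>A. winding_number \<gamma> p * zorder f p) = (\<Sum>p\<in>{p \<in> s. h p = 0}. winding_number \<gamma> p * zorder h p)"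
    unfolding fh A_def .
  also have "\<dots> = 1"
  proof -
    have "zorder h z0 = 1"
      by (rule zorder_eqI[OF s(1,4) hs(3)]) (use g(2) s in \<open>auto simp: h_def\<close>)
    then show ?thesis unfolding zh using r by (simp add: \<gamma>_def winding_number_circlepath_centre)
  qed
  finally have sum1: "(\<Sum>p\<in>A. winding_number \<gamma> p * zorder f p) = 1" .
  define B where "B = {z \<in> cball z0 r. f z = 0}"
  have nsph: "f z \<noteq> 0" if "dist z0 z = r" for z using less[OF that] by auto
  have BA: "B = A \<inter> ball z0 r" using r nsph by (auto simp: A_def B_def s_def order_le_less)
  have "(\<Sum>p\<in>A. winding_number \<gamma> p * zorder f p) = (\<Sum>p\<in>B. winding_number \<gamma> p * zorder f p)"
  proof (rule sum.mono_neutral_right[OF finA])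
    show "\<forall>p\<in>A - B. winding_number \<gamma> p * zorder f p = 0"
    proof
      fix p assume p: "p \<in> A - B"
      then have "p \<notin> cball z0 r" by (auto simp: A_def B_def)
      then have "winding_number \<gamma> p = 0"
        by (intro winding_number_zero_outside[of \<gamma> "cball z0 r"]) (use r in \<open>auto simp: \<gamma>_def\<close>)
      then show "winding_number \<gamma> p * zorder f p = 0" by simp
    qed
  qed (auto simp: BA)
  also have "\<dots> = (\<Sum>p\<in>B. of_int (zorder f p))"
  proof (rule sum.cong[OF refl])
    fix p assume "p \<in> B"
    then have "winding_number \<gamma> p = 1"
      unfolding \<gamma>_def by (intro winding_number_circlepath) (simp add: BA dist_norm norm_minus_commute)
    then show "winding_number \<gamma> p * zorder f p = of_int (zorder f p)" by simp
  qed
  finally have "(of_int (\<Sum>p\<in>B. zorder f p) :: complex) = of_int 1" using sum1 by simp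
  then have sumB: "(\<Sum>p\<in>B. zorder f p) = 1" using of_int_eq_iff by blast
  have finB: "finite B" using finA by (simp add: BA)
  have "zorder f p \<ge> 1" if "p \<in> B" for p
  proof -
    have p: "p \<in> s" "f p = 0" using that by (auto simp: BA A_def)
    have "\<exists>w\<in>s. f w \<noteq> 0" using f1 z1 by blast
    from zorder_exist_zero[OF hs(1) s(1,2) p(1) this] p(2) show ?thesis by auto
  qed
  then have "(\<Sum>p\<in>B. 1) \<le> (\<Sum>p\<in>B. zorder f p)" by (intro sum_mono) auto
  then have "card B \<le> 1" using sumB by simp
  moreover have "card B \<noteq> 0" using sumB finB by auto
  ultimately have "card B = 1" by linarith
  then obtain z where "B = {z}" by (rule card_1_singletonE)
  then show ?thesis by (intro ex1I[of _ z]) (auto simp: B_def)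
qed

lemma holomorphic_csqrt_z2m1: "(\<lambda>z. csqrt (z\<^sup>2 - 1)) holomorphic_on left_exterior"
proof -
  have "csqrt \<circ> (\<lambda>z. z\<^sup>2 - 1) holomorphic_on left_exterior"
    by (rule holomorphic_on_compose_gen[of _ _ csqrt "- \<real>\<^sub>\<le>\<^sub>0"])
       (auto intro!: holomorphic_intros simp: z2m1_not_nonpos)
  then show ?thesis by (simp add: comp_def)
qed

lemma csqrt_z2m1_nz: assumes "z \<in> left_exterior" shows "csqrt (z\<^sup>2 - 1) \<noteq> 0"
  using z2m1_not_nonpos[OF assms] by auto

lemma root_prod_holomorphic: "root_prod holomorphic_on left_exterior"
  by (rule holomorphic_transform[OF holomorphic_on_mult[OF holomorphic_on_const holomorphic_csqrt_z2m1]])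
     (rule root_prod_exterior[symmetric])

lemma root_prod_nz: assumes "z \<in> left_exterior" shows "root_prod z \<noteq> 0"
  using csqrt_z2m1_nz[OF assms] by (simp add: root_prod_exterior[OF assms])

lemma q_holomorphic: "q m holomorphic_on left_exterior"
  unfolding q_altdef[abs_def] using root_prod_nz left_exterior_facts(2)
  by (intro holomorphic_intros root_prod_holomorphic) auto

lemma normalized_P_denominator_nz:
  assumes "z \<in> left_exterior" shows "of_real (half_coeff m) * (2 * (1 + z)) ^ m * csqrt (z\<^sup>2 - 1) \<noteq> 0"
proof -
  have "2 * (1 + z) \<noteq> 0" using left_exterior_facts(5)[OF assms] by (metis mult_eq_0_iff zero_neq_numeral)
  then show ?thesis using csqrt_z2m1_nz[OF assms] half_coeff_pos[of m]
    by (metis less_irrefl mult_eq_0_iff of_real_eq_0_iff power_not_zero)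
qed

lemma normalized_P_holomorphic: "normalized_P m holomorphic_on left_exterior"
proof -
  have n: "1 - z \<notin> \<real>\<^sub>\<le>\<^sub>0" "- z \<notin> \<real>\<^sub>\<le>\<^sub>0" if "z \<in> left_exterior" for z
    using left_exterior_facts(1)[OF that] by (auto simp: complex_nonpos_Reals_iff complex_nonneg_Reals_iff)
  show ?thesis unfolding normalized_P_def[abs_def]
    by (intro holomorphic_intros; rule n z2m1_not_nonpos normalized_P_denominator_nz; assumption)
qed

lemma normalized_P_eq_0_iff:
  assumes "z \<in> left_exterior" shows "normalized_P m z = 0 \<longleftrightarrow> poly (jacobi_P m) z = 0"
proof -
  have "csqrt (1 - z) \<noteq> 0" "csqrt (- z) \<noteq> 0" using left_exterior_facts(4,6)[OF assms] by auto
  then show ?thesis unfolding normalized_P_def using normalized_P_denominator_nz[OF assms]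
    by (simp only: divide_eq_0_iff mult_eq_0_iff) blast
qed

text \<open>The quotient of the two sides is continuous in z and has square 1, so it is constant.\<close>

lemma root_prod_local:
  assumes z0: "z0 \<in> left_exterior" and sub: "ball z0 r \<subseteq> left_exterior" and z: "z \<in> ball z0 r"
    and d: "\<And>z. z \<in> ball z0 r \<Longrightarrow> cmod ((z0\<^sup>2 - z\<^sup>2) / (1 - z0\<^sup>2)) < 1"
  shows "root_prod z = root_prod z0 * exp (Ln (1 + (z0\<^sup>2 - z\<^sup>2) / (1 - z0\<^sup>2)) / 2)"
proof -
  define \<delta> where "\<delta> z = (z0\<^sup>2 - z\<^sup>2) / (1 - z0\<^sup>2)" for z
  define h where "h z = root_prod z / (root_prod z0 * exp (Ln (1 + \<delta> z) / 2))" for z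
  have u0: "1 - z0\<^sup>2 \<noteq> 0" by (rule left_exterior_facts(2)[OF z0])
  have r: "r > 0" using z by (metis ball_eq_empty empty_iff not_le)
  have Re: "Re (1 + \<delta> z) > 0" if "z \<in> ball z0 r" for z
    using d[OF that] abs_Re_le_cmod[of "\<delta> z"] by (simp add: \<delta>_def)
  then have nz: "1 + \<delta> z \<noteq> 0" if "z \<in> ball z0 r" for z using that by (metis less_irrefl zero_complex.simps(1))
  have u: "1 - z\<^sup>2 = (1 - z0\<^sup>2) * (1 + \<delta> z)" for z using u0 by (simp add: \<delta>_def field_simps)
  have sq: "(h z)\<^sup>2 = 1" if "z \<in> ball z0 r" for z
  proof -
    have "(exp (Ln (1 + \<delta> z) / 2))\<^sup>2 = 1 + \<delta> z" using nz[OF that] exp_double[of "Ln (1 + \<delta> z) / 2"] by simp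
    then have "(h z)\<^sup>2 = (1 - z\<^sup>2) / ((1 - z0\<^sup>2) * (1 + \<delta> z))"
      unfolding h_def power_divide power_mult_distrib root_prod_square by simp
    then show ?thesis using u0 nz[OF that] by (simp add: u[of z])
  qed
  have "continuous_on (ball z0 r) h"
    unfolding h_def
  proof (intro continuous_intros)
    show "continuous_on (ball z0 r) root_prod"
      by (rule holomorphic_on_imp_continuous_on[OF holomorphic_on_subset[OF root_prod_holomorphic sub]])
    show "continuous_on (ball z0 r) \<delta>" unfolding \<delta>_def using u0 by (intro continuous_intros) auto
    show "\<forall>z\<in>ball z0 r. root_prod z0 * exp (Ln (1 + \<delta> z) / 2) \<noteq> 0" using root_prod_nz[OF z0] by simp
    show "1 + \<delta> z \<notin> \<real>\<^sub>\<le>\<^sub>0" if "z \<in> ball z0 r" for z using Re[OF that] by (auto simp: complex_nonpos_Reals_iff)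
  qed auto
  moreover have "finite (h ` ball z0 r)"
  proof (rule finite_subset)
    show "h ` ball z0 r \<subseteq> {1, -1}"
    proof
      fix v assume "v \<in> h ` ball z0 r"
      then have "v\<^sup>2 = 1" using sq by blast
      then show "v \<in> {1, -1}" by (simp add: power2_eq_1_iff)
    qed
  qed simp
  ultimately have "h constant_on ball z0 r" by (intro continuous_finite_range_constant) auto
  then have "h z = h z0" using z r unfolding constant_on_def by (metis centre_in_ball)
  also have "h z0 = 1" using root_prod_nz[OF z0] by (simp add: h_def \<delta>_def)
  finally show ?thesis using root_prod_nz[OF z0] by (simp add: h_def \<delta>_def divide_eq_eq)
qed

text \<open>With N = m + 1/2, the product (1 - z^2)^m (1 - z^2)^(1/2) picks up the factor (1 + d)^N when 1 - z^2 is
  multiplied by 1 + d.\<close>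

lemma q_local:
  assumes z0: "z0 \<in> left_exterior" and sub: "ball z0 r \<subseteq> left_exterior" and z: "z \<in> ball z0 r"
    and d: "\<And>z. z \<in> ball z0 r \<Longrightarrow> cmod ((z0\<^sup>2 - z\<^sup>2) / (1 - z0\<^sup>2)) < 1"
  shows "q m z = 1 - (1 - q m z0) * exp (- (of_real (real m + 1/2) * Ln (1 + (z0\<^sup>2 - z\<^sup>2) / (1 - z0\<^sup>2))))"
proof -
  define \<delta> where "\<delta> = (z0\<^sup>2 - z\<^sup>2) / (1 - z0\<^sup>2)"
  have u0: "1 - z0\<^sup>2 \<noteq> 0" by (rule left_exterior_facts(2)[OF z0])
  have "Re (1 + \<delta>) > 0" using d[OF z] abs_Re_le_cmod[of \<delta>] by (simp add: \<delta>_def)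
  then have nz: "1 + \<delta> \<noteq> 0" by (metis less_irrefl zero_complex.simps(1))
  have u: "1 - z\<^sup>2 = (1 - z0\<^sup>2) * (1 + \<delta>)" using u0 by (simp add: \<delta>_def field_simps)
  have pw: "(1 + \<delta>) ^ m = exp (of_nat m * Ln (1 + \<delta>))" using nz by (simp add: exp_of_nat_mult)
  have rp: "root_prod z = root_prod z0 * exp (Ln (1 + \<delta>) / 2)"
    unfolding \<delta>_def using root_prod_local[OF z0 sub z] d by blast
  have "(1 - z\<^sup>2) ^ m * root_prod z = (1 - z0\<^sup>2) ^ m * root_prod z0 * (exp (of_nat m * Ln (1 + \<delta>)) * exp (Ln (1 + \<delta>) / 2))"
    unfolding u power_mult_distrib pw rp by (simp only: mult_ac)
  also have "exp (of_nat m * Ln (1 + \<delta>)) * exp (Ln (1 + \<delta>) / 2) = exp (of_real (real m + 1/2) * Ln (1 + \<delta>))"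
    by (simp add: exp_add[symmetric] algebra_simps)
  finally have e: "(1 - z\<^sup>2) ^ m * root_prod z = (1 - z0\<^sup>2) ^ m * root_prod z0 * exp (of_real (real m + 1/2) * Ln (1 + \<delta>))" .
  have g: "1 - c / (X * E) = 1 - (1 - (1 - c / X)) * inverse E" for c X E :: complex
    by (simp add: divide_inverse)
  have "q m z = 1 - (1 - q m z0) * exp (- (of_real (real m + 1/2) * Ln (1 + \<delta>)))"
    unfolding q_altdef e exp_minus by (rule g)
  then show ?thesis by (simp add: \<delta>_def)
qed

text \<open>If q is small, then |1 - z^2|^(m + 1/2) is close to 2^(1/2), in particular between 4/3 and 3/2.\<close>

lemma approx_zero_modulus:
  assumes q: "cmod (q m z) \<le> 1/100" and m: "m \<ge> 1"
  shows "1 + 1 / (6 * real m) \<le> cmod (1 - z\<^sup>2)" "cmod (1 - z\<^sup>2) \<le> 1 + 1 / real m"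
proof -
  define N where "N = real m + 1/2"
  have N: "N > 0" "N \<le> 3/2 * real m" "N \<ge> 3/2" using m by (auto simp: N_def)
  define X where "X = (1 - z\<^sup>2) ^ m * root_prod z"
  have qX: "q m z = 1 - \<i> * of_real (sqrt 2) / X" by (simp add: q_altdef X_def)
  have X0: "X \<noteq> 0" using q qX by auto
  have u: "cmod (1 - z\<^sup>2) > 0" 
  proof -
    have "root_prod z \<noteq> 0" using X0 by (simp add: X_def)
    then have "(root_prod z)\<^sup>2 \<noteq> 0" by simp
    then show ?thesis unfolding root_prod_square by simp
  qed
  have cX: "cmod X = cmod (1 - z\<^sup>2) powr N"
  proof -
    have "(cmod (root_prod z))\<^sup>2 = cmod (1 - z\<^sup>2)" by (metis norm_power root_prod_square)
    then have "cmod (root_prod z) = cmod (1 - z\<^sup>2) powr (1/2)"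
      using powr_half_sqrt real_sqrt_unique by (metis norm_ge_zero)
    then show ?thesis using u by (simp add: X_def norm_mult norm_power N_def powr_add powr_realpow)
  qed
  have "cmod (\<i> * of_real (sqrt 2) / X) = sqrt 2 / cmod X" by (simp add: norm_divide norm_mult)
  moreover have "\<bar>cmod (\<i> * of_real (sqrt 2) / X) - 1\<bar> \<le> 1/100"
    using norm_triangle_ineq3[of "\<i> * of_real (sqrt 2) / X" 1] q qX by (simp add: norm_minus_commute)
  ultimately have "\<bar>sqrt 2 / cmod X - 1\<bar> \<le> 1/100" by metis
  then have r: "99/100 \<le> sqrt 2 / cmod X" "sqrt 2 / cmod X \<le> 101/100" by linarith+
  have Xp: "cmod X > 0" using X0 by simp
  (* the margins 1.01 and 0.99 keep |X| between 4/3 and 3/2 *)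
  have s2: "1414/1000 \<le> sqrt 2" by (rule real_le_rsqrt) (simp add: power2_eq_square)
  have s2': "sqrt 2 \<le> 1415/1000" by (rule real_le_lsqrt) (simp_all add: power2_eq_square)
  have X1: "4/3 \<le> cmod X" "cmod X \<le> 3/2"
    using r Xp s2 s2' by (auto simp: field_simps)
  define l where "l = ln (cmod (1 - z\<^sup>2))"
  have lN: "N * l = ln (cmod X)" unfolding cX l_def using u by (simp add: ln_powr)
  have ex: "cmod (1 - z\<^sup>2) = exp l" using u by (simp add: l_def)
  have "1/4 \<le> ln (4/3 :: real)" using ln_le_minus_one[of "3/4::real"] ln_div[of 1 "4/3::real"] by (simp add: ln_div)
  also have "\<dots> \<le> ln (cmod X)" using X1 Xp by simp
  finally have l1: "1/4 \<le> N * l" using lN by simp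
  then have "0 < N * l" by linarith
  then have l0: "l > 0" using N by (simp add: zero_less_mult_iff)
  have "N * l \<le> 3/2 * real m * l" using N l0 by (intro mult_right_mono) auto
  then have "1 / (6 * real m) \<le> l" using l1 m by (simp add: field_simps)
  then show "1 + 1 / (6 * real m) \<le> cmod (1 - z\<^sup>2)" unfolding ex using exp_ge_add_one_self[of l] by linarith
  have "ln (cmod X) \<le> 1/2" using ln_le_minus_one[OF Xp] X1 by simp
  moreover have "real m * l \<le> N * l" using l0 by (intro mult_right_mono) (auto simp: N_def)
  ultimately have l2: "l \<le> 1 / (2 * real m)" using lN m by (simp add: field_simps)
  also have "\<dots> \<le> 1/2" using m by (simp add: field_simps)
  finally have "exp l \<le> 1 + 2 * l" using l0 by (intro real_exp_bound_lemma) auto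
  then show "cmod (1 - z\<^sup>2) \<le> 1 + 1 / real m" unfolding ex using l2 by (simp add: field_simps)
qed

text \<open>By |1 - z^2|^2 = 1 + |z|^4 - 2 Re (z^2), a point with |z| \<ge> e and |1 - z^2| close to 1 has Re (z^2) \<ge> 0,
  so it stays away from the imaginary axis.\<close>

lemma exterior_near_circle_Re:
  assumes z: "Re z \<le> 0" and e: "0 < e" "e \<le> cmod z" and u: "cmod (1 - z\<^sup>2) \<le> 1 + 1 / real m" and m: "m \<ge> 1" "3 / e ^ 4 \<le> real m"
  shows "Re z \<le> - (e / 2)"
proof -
  have "(cmod (1 - z\<^sup>2))\<^sup>2 \<le> (1 + 1 / real m)\<^sup>2" using u by (intro power_mono) auto
  also have "\<dots> \<le> 1 + 3 / real m"
  proof -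
    have "(1 / real m)\<^sup>2 \<le> 1 / real m" using m by (simp add: power2_eq_square field_simps)
    then show ?thesis by (simp add: power2_sum)
  qed
  also have "\<dots> \<le> 1 + e ^ 4" using m e by (simp add: field_simps)
  also have "\<dots> \<le> 1 + cmod z ^ 4" using e by (intro add_left_mono power_mono) auto
  finally have "(cmod (1 - z\<^sup>2))\<^sup>2 \<le> 1 + cmod z ^ 4" .
  moreover have "(cmod (1 - z\<^sup>2))\<^sup>2 = 1 + cmod z ^ 4 - 2 * Re (z\<^sup>2)"
  proof -
    have "cmod z ^ 4 = (cmod (z\<^sup>2))\<^sup>2" by (simp add: norm_power flip: power_mult)
    then show ?thesis unfolding cmod_power2 by (simp add: power2_eq_square algebra_simps)
  qed
  ultimately have "0 \<le> Re (z\<^sup>2)" by linarith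
  then have "(Im z)\<^sup>2 \<le> (Re z)\<^sup>2" unfolding Re_power2 by linarith
  moreover have "e\<^sup>2 \<le> (Re z)\<^sup>2 + (Im z)\<^sup>2" using e power_mono[of e "cmod z" 2] by (simp add: cmod_power2)
  moreover have "(e/2)\<^sup>2 = e\<^sup>2 / 4" by (simp add: power_divide)
  moreover have "E / 4 \<le> A" if "B \<le> A" "E \<le> A + B" "0 \<le> E" for A B E :: real using that by linarith
  ultimately have "(e/2)\<^sup>2 \<le> (- Re z)\<^sup>2" by (metis power2_minus zero_le_power2)
  then have "e / 2 \<le> - Re z" by (rule power2_le_imp_le) (use z in simp)
  then show ?thesis by linarith
qed

text \<open>Here N d is the linear part of 1 - (1 + d)^(-N). With w = N Ln (1 + d) the error is
  q0 e^(-w) + (w - N d) - (e^(-w) - 1 + w), and the last two terms are small relative to N d because d and w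
  are small.\<close>

lemma exp_Ln_linear:
  fixes d q0 :: complex and N :: real
  assumes N: "N > 0" "N * cmod d \<le> 135/1000" and d: "cmod d \<le> 9/100" and q0: "cmod q0 \<le> \<eta>"
  shows "cmod ((1 - (1 - q0) * exp (- (of_real N * Ln (1 + d)))) - of_real N * d) \<le> 2 * \<eta> + (4/10) * (N * cmod d)"
proof -
  define w where "w = of_real N * Ln (1 + d)"
  define D where "D = N * cmod d"
  have "cmod (Ln (1 + d) - d) \<le> (cmod d)\<^sup>2 / (1 - cmod d)" using d by (intro Ln_approx_linear) simp
  also have "\<dots> \<le> (cmod d)\<^sup>2 / (91/100)" using d by (intro divide_left_mono) auto
  also have "\<dots> \<le> (1/10) * cmod d"
  proof -
    have "cmod d * cmod d \<le> (9/100) * cmod d" using d by (intro mult_right_mono) auto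
    then have "(cmod d)\<^sup>2 \<le> (9/100) * cmod d" by (simp add: power2_eq_square)
    then have "(cmod d)\<^sup>2 / (91/100) \<le> (9/100) * cmod d / (91/100)" by (intro divide_right_mono) auto
    also have "\<dots> \<le> (1/10) * cmod d" by simp
    finally show ?thesis .
  qed
  finally have "N * cmod (Ln (1 + d) - d) \<le> N * ((1/10) * cmod d)" using N by (intro mult_left_mono) auto
  then have wd: "cmod (w - of_real N * d) \<le> D / 10"
    using N by (simp add: w_def D_def right_diff_distrib[symmetric] norm_mult)
  have "cmod w \<le> cmod (w - of_real N * d) + cmod (of_real N * d)" by (metis diff_add_cancel norm_triangle_ineq)
  then have w1: "cmod w \<le> (11/10) * D" using wd N by (simp add: D_def norm_mult)
  have D: "D \<le> 135/1000" "D \<ge> 0" using N by (auto simp: D_def)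
  have w2: "cmod w \<le> 15/100" using w1 D by linarith
  have e1: "exp \<bar>Re (- w)\<bar> \<le> 13/10"
  proof -
    have "\<bar>Re (- w)\<bar> \<le> 15/100" using abs_Re_le_cmod[of w] w2 by simp
    moreover have "exp \<bar>Re (- w)\<bar> \<le> 1 + 2 * \<bar>Re (- w)\<bar>" using calculation by (intro real_exp_bound_lemma) auto
    ultimately show ?thesis by linarith
  qed
  have "cmod (exp (- w) - (1 + - w)) \<le> exp \<bar>Re (- w)\<bar> * cmod (- w) ^ 2"
    using Taylor_exp[of "- w" 1] by (simp add: numeral_2_eq_2)
  also have "\<dots> \<le> (13/10) * ((15/100) * ((11/10) * D))"
  proof (rule mult_mono[OF e1])
    show "cmod (- w) ^ 2 \<le> (15/100) * ((11/10) * D)"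
      unfolding power2_eq_square norm_minus_cancel by (rule mult_mono[OF w2 w1]) auto
  qed (use D in auto)
  also have "\<dots> \<le> (22/100) * D" using D by simp
  finally have e2: "cmod (exp (- w) - (1 + - w)) \<le> (22/100) * D" .
  have "cmod (exp (- w)) \<le> 1 + 2 * cmod w" using exp_bound_lemma[of "- w"] w2 by simp
  then have e3: "cmod (exp (- w)) \<le> 2" using w2 by linarith
  have "(1 - (1 - q0) * exp (- w)) - of_real N * d = q0 * exp (- w) + (w - of_real N * d) - (exp (- w) - (1 + - w))"
    by (simp add: algebra_simps)
  then have "cmod ((1 - (1 - q0) * exp (- w)) - of_real N * d) =
      cmod (q0 * exp (- w) + (w - of_real N * d) - (exp (- w) - (1 + - w)))" by (rule arg_cong)
  also have "\<dots> \<le> cmod (q0 * exp (- w)) + cmod (w - of_real N * d) + cmod (exp (- w) - (1 + - w))"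
    using norm_triangle_ineq4[of "q0 * exp (- w) + (w - of_real N * d)" "exp (- w) - (1 + - w)"]
      norm_triangle_ineq[of "q0 * exp (- w)" "w - of_real N * d"] by linarith
  also have "\<dots> \<le> \<eta> * 2 + D / 10 + (22/100) * D"
    unfolding norm_mult using q0 e3 wd e2 by (intro add_mono mult_mono) (auto intro: order_trans[OF norm_ge_zero])
  also have "\<dots> \<le> 2 * \<eta> + (4/10) * D" using D by simp
  finally show ?thesis by (simp add: w_def D_def)
qed

text \<open>On the scale 1/m, q is close to the function N d(z), where d(z) = (z0^2 - z^2)/(1 - z0^2) and
  N = m + 1/2, whose only zero near z0 is z0 itself; and so is every F that is close to q. Rouche's
  theorem applies. The radius 1/(40 m) is small enough for two purposes: N d stays small, and the disc
  stays in the exterior domain, as |1 - z0^2| exceeds 1 by at least 1/(6 m). The lemma serves in both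
  directions: for a zero of q and F the Jacobi polynomial, and for a zero of the Jacobi polynomial
  and F = q.\<close>

theorem unique_zero_near_approx_zero:
  assumes e: "0 < e" "e \<le> 1" and m: "m \<ge> 1" "3 / e ^ 4 \<le> real m"
    and z0: "z0 \<in> left_exterior" "e \<le> cmod z0" and q0: "cmod (q m z0) \<le> e / 1000"
    and F: "F holomorphic_on left_exterior"
    and close: "\<And>z. z \<in> exterior_range (e/2) 3 \<Longrightarrow> cmod (F z - q m z) \<le> e / 1000"
  shows "cball z0 (1 / (40 * real m)) \<subseteq> left_exterior" "\<exists>!z. z \<in> cball z0 (1 / (40 * real m)) \<and> F z = 0"
proof -
  define r where "r = 1 / (40 * real m)"
  (* the radius R > r only provides an open neighbourhood of the disc inside the domain *)
  define R where "R = 1 / (30 * real m)"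
  define u where "u = 1 - z0\<^sup>2"
  define N where "N = real m + 1/2"
  define \<delta> where "\<delta> z = (z0\<^sup>2 - z\<^sup>2) / u" for z
  have rm: "real m \<ge> 1" using m by simp
  have rR: "0 < r" "r < R" "R \<le> 1/30" using m by (auto simp: r_def R_def field_simps)
  have N: "N > 0" "N \<le> 3/2 * real m" "real m \<le> N" using m by (auto simp: N_def)
  have q01: "cmod (q m z0) \<le> 1/100" using q0 e by simp
  have u1: "1 + 1 / (6 * real m) \<le> cmod u" "cmod u \<le> 1 + 1 / real m"
    using approx_zero_modulus[OF q01 m(1)] by (auto simp: u_def)
  have u2: "cmod u \<le> 2" "1 \<le> cmod u"
  proof -
    have "1 / real m \<le> 1" using rm by simp
    then show "cmod u \<le> 2" using u1 by linarith
    have "0 \<le> 1 / (6 * real m)" by simp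
    then show "1 \<le> cmod u" using u1 by linarith
  qed
  have Re0: "Re z0 \<le> - (e / 2)"
    by (rule exterior_near_circle_Re[OF _ e(1) z0(2) u1(2)[unfolded u_def] m]) (use left_exterior_facts(1)[OF z0(1)] in simp)
  have em: "3 \<le> e * real m"
  proof -
    have "3 \<le> e ^ 4 * real m" using m e by (simp add: field_simps)
    also have "\<dots> \<le> e * real m" using e power_decreasing[of 1 4 e] by (intro mult_right_mono) auto
    finally show ?thesis .
  qed
  have Re': "R \<le> e / 90" using em rm by (simp add: R_def field_simps)
  have z0n: "cmod z0 \<le> 7/4"
  proof -
    have "z0\<^sup>2 = 1 - u" by (simp add: u_def)
    then have "cmod z0 ^ 2 \<le> 1 + cmod u" using norm_triangle_ineq4[of 1 u] by (simp flip: norm_power)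
    also have "\<dots> \<le> (7/4)\<^sup>2" using u2 by (simp add: power2_eq_square)
    finally show ?thesis by (rule power2_le_imp_le) simp
  qed
  have near: "cmod (z0\<^sup>2 - z\<^sup>2) \<le> (36/10) * dist z0 z" "cmod (z0 + z) \<ge> e / 2" "z \<in> exterior_range (e/2) 3"
    "cmod (\<delta> z) \<le> (36/10) * dist z0 z" if z: "z \<in> ball z0 R" for z
  proof -
    have dz: "cmod (z0 - z) < R" using z by (simp add: dist_norm)
    have zn: "cmod z \<le> cmod z0 + R" "cmod z0 \<le> cmod z + R"
      using dz norm_triangle_ineq2[of z z0] norm_triangle_ineq2[of z0 z] by (auto simp: norm_minus_commute)
    have "cmod (z0 + z) \<le> 36/10" using norm_triangle_ineq[of z0 z] zn z0n rR by linarith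
    then have "cmod (z0 - z) * cmod (z0 + z) \<le> cmod (z0 - z) * (36/10)" by (intro mult_left_mono) auto
    moreover have "z0\<^sup>2 - z\<^sup>2 = (z0 - z) * (z0 + z)" by (simp add: algebra_simps power2_eq_square)
    ultimately show zz: "cmod (z0\<^sup>2 - z\<^sup>2) \<le> (36/10) * dist z0 z" by (simp add: norm_mult dist_norm mult.commute)
    have "\<bar>Re (z0 - z)\<bar> < R" using abs_Re_le_cmod[of "z0 - z"] dz by linarith
    then have Rez: "Re z < 0" using Re0 Re' e(1) by simp
    have "e / 2 \<le> - Re (z0 + z)" using Re0 Rez by simp
    then show "e / 2 \<le> cmod (z0 + z)" using abs_Re_le_cmod[of "z0 + z"] by linarith
    have "(36/10) * dist z0 z < (36/10) * R" using z by simp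
    also have "\<dots> < 1 / (6 * real m)" using rm by (simp add: R_def field_simps)
    finally have "cmod (z0\<^sup>2 - z\<^sup>2) < 1 / (6 * real m)" using zz by linarith
    moreover have "u = (1 - z\<^sup>2) - (z0\<^sup>2 - z\<^sup>2)" by (simp add: u_def)
    then have "cmod u \<le> cmod (1 - z\<^sup>2) + cmod (z0\<^sup>2 - z\<^sup>2)" by (metis norm_triangle_ineq4)
    ultimately have "cmod (1 - z\<^sup>2) > 1" using u1(1) by linarith
    then show "z \<in> exterior_range (e/2) 3"
      using Rez zn z0n rR z0(2) Re' e by (auto simp: exterior_range_def left_exterior_def)
    have "cmod (\<delta> z) \<le> cmod (z0\<^sup>2 - z\<^sup>2) / 1" unfolding \<delta>_def norm_divide using u2 by (intro divide_left_mono) auto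
    then show "cmod (\<delta> z) \<le> (36/10) * dist z0 z" using zz by simp
  qed
  have sub: "ball z0 R \<subseteq> left_exterior" using near(3) by (auto simp: exterior_range_def)
  show "cball z0 (1 / (40 * real m)) \<subseteq> left_exterior" using sub rR by (auto simp: r_def[symmetric])
  have u0: "u \<noteq> 0" using u2 by auto
  have "\<exists>!z. z \<in> cball z0 r \<and> F z = 0"
  proof (rule Rouche_unique_zero[OF rR(1,2)])
    show "F holomorphic_on ball z0 R" by (rule holomorphic_on_subset[OF F sub])
    show "(\<lambda>z. - (of_real N / u) * (z0 + z)) holomorphic_on ball z0 R" by (intro holomorphic_intros)
    show "- (of_real N / u) * (z0 + z) \<noteq> 0" if "z \<in> ball z0 R" for z
      using near(2)[OF that] e(1) N u0 by auto
    fix z assume zr: "dist z0 z = r"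
    have zb: "z \<in> ball z0 R" using zr rR by simp
    define D where "D = N * cmod (\<delta> z)"
    have h: "- (of_real N / u) * (z0 + z) * (z - z0) = of_real N * \<delta> z"
      using u0 by (simp add: \<delta>_def field_simps power2_eq_square)
    have dl: "cmod (\<delta> z) \<le> (9/100) / real m" using near(4)[OF zb] zr by (simp add: r_def)
    also have "\<dots> \<le> 9/100" using rm by (simp add: field_simps)
    finally have d9: "cmod (\<delta> z) \<le> 9/100" .
    have "D \<le> (3/2 * real m) * ((9/100) / real m)" unfolding D_def using dl N by (intro mult_mono) auto
    then have D1: "D \<le> 135/1000" using rm by simp
    (* D is the size of the comparison function on the circle; it dominates the errors of order e / 1000 *)
    have D2: "e / 160 \<le> D"
    proof -
      have "cmod (\<delta> z) = r * cmod (z0 + z) / cmod u"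
      proof -
        have "z0\<^sup>2 - z\<^sup>2 = (z0 - z) * (z0 + z)" by (simp add: algebra_simps power2_eq_square)
        then show ?thesis using zr by (simp add: \<delta>_def norm_divide norm_mult dist_norm)
      qed
      also have "\<dots> \<ge> r * (e/2) / 2" using near(2)[OF zb] u2 rR e by (intro frac_le mult_left_mono) auto
      finally have "real m * (r * (e/2) / 2) \<le> D" unfolding D_def using N rR e by (intro mult_mono) auto
      then show ?thesis using rm by (simp add: r_def)
    qed
    have dsmall: "cmod ((z0\<^sup>2 - v\<^sup>2) / (1 - z0\<^sup>2)) < 1" if "v \<in> ball z0 R" for v
      using near(4)[OF that] that rR(3) unfolding \<delta>_def u_def by simp
    have "q m z = 1 - (1 - q m z0) * exp (- (of_real N * Ln (1 + \<delta> z)))"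
      unfolding N_def \<delta>_def u_def using q_local[OF z0(1) sub zb] dsmall by blast
    then have "cmod (q m z - of_real N * \<delta> z) \<le> 2 * (e / 1000) + (4/10) * D"
      using exp_Ln_linear[OF N(1) D1[unfolded D_def] d9 q0] by (simp add: D_def)
    moreover have "cmod (F z - q m z) \<le> e / 1000" by (rule close[OF near(3)[OF zb]])
    moreover have "cmod (F z - of_real N * \<delta> z) \<le> cmod (F z - q m z) + cmod (q m z - of_real N * \<delta> z)"
      using norm_triangle_ineq[of "F z - q m z" "q m z - of_real N * \<delta> z"] by simp
    ultimately have "cmod (F z - of_real N * \<delta> z) \<le> 3 * (e / 1000) + (4/10) * D" by linarith
    also have "\<dots> < D" using D2 e by linarith
    also have "D = cmod (of_real N * \<delta> z)" using N by (simp add: D_def norm_mult)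
    finally show "cmod (F z - - (of_real N / u) * (z0 + z) * (z - z0)) < cmod (- (of_real N / u) * (z0 + z) * (z - z0))"
      unfolding h .
  qed
  then show "\<exists>!z. z \<in> cball z0 (1 / (40 * real m)) \<and> F z = 0" by (simp add: r_def)
qed

section \<open>The region\<close>

text \<open>On the imaginary axis 1 - z^2 \<ge> 1, so this part of the frontier is only the origin.\<close>

lemma frontier_left_lobe:
  "frontier {z. Re z < 0 \<and> cmod (1 - z\<^sup>2) < 1} \<subseteq> Sigma_minus1" (is "frontier ?W \<subseteq> _")
proof
  fix x assume x: "x \<in> frontier ?W"
  have "?W = {z. Re z < 0} \<inter> {z. cmod (1 - z\<^sup>2) < 1}" by auto
  moreover have "open {z::complex. cmod (1 - z\<^sup>2) < 1}" by (intro open_Collect_less continuous_intros)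
  ultimately have op: "open ?W" using open_halfspace_Re_lt by (metis open_Int)
  have cl: "closed {z::complex. Re z \<le> 0 \<and> cmod (1 - z\<^sup>2) \<le> 1}"
    by (intro closed_Collect_conj closed_Collect_le continuous_intros)
  have "closure ?W \<subseteq> {z. Re z \<le> 0 \<and> cmod (1 - z\<^sup>2) \<le> 1}" by (rule closure_minimal[OF _ cl]) auto
  then have c: "Re x \<le> 0" "cmod (1 - x\<^sup>2) \<le> 1" using x by (auto simp: frontier_def)
  have "x \<notin> ?W" using x interior_open[OF op] by (simp add: frontier_def)
  then have "Re x = 0 \<or> cmod (1 - x\<^sup>2) = 1" using c by auto
  moreover have "1 \<le> cmod (1 - x\<^sup>2)" if "Re x = 0"
    using complex_Re_le_cmod[of "1 - x\<^sup>2"] that by (simp add: Re_power2) (smt (verit) zero_le_power2)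
  ultimately show "x \<in> Sigma_minus1" using c by (auto simp: Sigma_minus1_def)
qed

text \<open>The component of a point of the left lobe of |1 - z^2| < 1 cannot leave the lobe without meeting the
  curve, so it is bounded.\<close>

lemma outside_Sigma_minus1: assumes "z \<in> outside Sigma_minus1" "Re z < 0" shows "cmod (1 - z\<^sup>2) > 1"
proof (rule ccontr)
  assume n: "\<not> cmod (1 - z\<^sup>2) > 1"
  have "z \<notin> Sigma_minus1" using assms(1) outside_no_overlap by blast
  then have lt: "cmod (1 - z\<^sup>2) < 1" using n assms(2) by (auto simp: Sigma_minus1_def)
  define W where "W = {z. Re z < 0 \<and> cmod (1 - z\<^sup>2) < 1}"
  define C where "C = connected_component_set (- Sigma_minus1) z"
  have zC: "z \<in> C" "\<not> bounded C" using assms(1) by (auto simp: C_def outside_def)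
  have "W \<subseteq> cball 0 2"
  proof
    fix x assume "x \<in> W"
    then have "cmod (x\<^sup>2) < 2" using norm_triangle_ineq4[of 1 "1 - x\<^sup>2"] by (simp add: W_def)
    then have "cmod x ^ 2 \<le> 2 ^ 2" by (simp add: norm_power)
    then have "cmod x \<le> 2" by (rule power2_le_imp_le) simp
    then show "x \<in> cball 0 2" by simp
  qed
  then have "bounded W" using bounded_subset bounded_cball by blast
  then have "C - W \<noteq> {}" using zC(2) bounded_subset by blast
  moreover have "C \<inter> W \<noteq> {}" using zC(1) lt assms(2) by (auto simp: W_def)
  ultimately have "C \<inter> frontier W \<noteq> {}" by (intro connected_Int_frontier) (auto simp: C_def)
  moreover have "frontier W \<subseteq> Sigma_minus1" unfolding W_def by (rule frontier_left_lobe)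
  moreover have "C \<subseteq> - Sigma_minus1" unfolding C_def by (rule connected_component_subset)
  ultimately show False by blast
qed

text \<open>The curve lies in the closed left half-plane, which is convex, so the open set inside it lies in the
  open left half-plane.\<close>

lemma inside_Sigma_r:
  assumes "outer_arc \<epsilon> \<gamma>"
  shows "bounded (inside (Sigma_r \<epsilon> \<gamma>))" "inside (Sigma_r \<epsilon> \<gamma>) \<subseteq> {z. Re z < 0}"
proof -
  have arc: "arc \<gamma>" and ends: "{pathstart \<gamma>, pathfinish \<gamma>} = {\<i> * of_real \<epsilon>, - (\<i> * of_real \<epsilon>)}"
    and neg: "\<And>t. 0 < t \<Longrightarrow> t < 1 \<Longrightarrow> Re (\<gamma> t) < 0" using assms by (auto simp: outer_arc_def)
  have comp: "compact (Sigma_r \<epsilon> \<gamma>)"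
    unfolding Sigma_r_def by (intro compact_Un compact_segment compact_path_image arc_imp_path arc)
  then show "bounded (inside (Sigma_r \<epsilon> \<gamma>))" by (intro bounded_inside compact_imp_bounded)
  have conv: "convex {z. Re z \<le> 0}" by (rule convex_halfspace_Re_le)
  have "path_image \<gamma> \<subseteq> {z. Re z \<le> 0}"
  proof
    fix z assume "z \<in> path_image \<gamma>"
    then obtain t where t: "z = \<gamma> t" "0 \<le> t" "t \<le> 1" by (auto simp: path_image_def)
    have "Re (\<gamma> 0) = 0" "Re (\<gamma> 1) = 0" using ends by (auto simp: pathstart_def pathfinish_def doubleton_eq_iff)
    then show "z \<in> {z. Re z \<le> 0}" using t neg[of t] by (cases "t = 0 \<or> t = 1") auto
  qed
  moreover have "closed_segment (- (\<i> * of_real \<epsilon>)) (\<i> * of_real \<epsilon>) \<subseteq> {z. Re z \<le> 0}"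
    by (intro closed_segment_subset conv) auto
  ultimately have "Sigma_r \<epsilon> \<gamma> \<subseteq> {z. Re z \<le> 0}" by (simp add: Sigma_r_def)
  then have "- {z. Re z \<le> 0} \<subseteq> outside (Sigma_r \<epsilon> \<gamma>)" by (rule outside_subset_convex[OF conv])
  then have le: "inside (Sigma_r \<epsilon> \<gamma>) \<subseteq> {z. Re z \<le> 0}" using inside_Int_outside by blast
  show "inside (Sigma_r \<epsilon> \<gamma>) \<subseteq> {z. Re z < 0}"
  proof
    fix z assume z: "z \<in> inside (Sigma_r \<epsilon> \<gamma>)"
    have "open (inside (Sigma_r \<epsilon> \<gamma>))" by (rule open_inside[OF compact_imp_closed[OF comp]])
    then obtain e where e: "e > 0" "ball z e \<subseteq> inside (Sigma_r \<epsilon> \<gamma>)" using z open_contains_ball by blast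
    then have "z + of_real (e/2) \<in> ball z e" by (simp add: dist_norm)
    then have "Re (z + of_real (e/2)) \<le> 0" using e le by blast
    then show "z \<in> {z. Re z < 0}" using e(1) by simp
  qed
qed

lemma Omega_minus_subset:
  assumes "outer_arc \<epsilon> \<gamma>" shows "Omega_minus \<epsilon> \<gamma> \<subseteq> left_exterior" "bounded (Omega_minus \<epsilon> \<gamma>)"
proof -
  show "Omega_minus \<epsilon> \<gamma> \<subseteq> left_exterior"
    using inside_Sigma_r(2)[OF assms] outside_Sigma_minus1 by (auto simp: Omega_minus_def left_exterior_def)
  show "bounded (Omega_minus \<epsilon> \<gamma>)"
    using inside_Sigma_r(1)[OF assms] by (rule bounded_subset) (auto simp: Omega_minus_def)
qed

section \<open>Zeros of the Jacobi polynomials\<close>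

text \<open>At z = -1 only the last term of the expansion in powers of 1 + z survives.\<close>

lemma jacobi_P_nz: "jacobi_P m \<noteq> 0"
proof
  assume "jacobi_P m = 0"
  then have "(\<Sum>j\<le>m. ((-1/2) gchoose j) * (-2) ^ j * of_nat ((2 * m - j) choose m) * (1 + (-1)) ^ (m - j)) = (0 :: complex)"
    using jacobi_P_expansion[of m "-1"] by simp
  moreover have "(\<Sum>j\<le>m. ((-1/2) gchoose j) * (-2) ^ j * of_nat ((2 * m - j) choose m) * (1 + (-1)) ^ (m - j)) =
      (\<Sum>j\<in>{m}. ((-1/2) gchoose j) * (-2) ^ j * of_nat ((2 * m - j) choose m) * (1 + (-1)) ^ (m - j) :: complex)"
    by (rule sum.mono_neutral_right) auto
  ultimately have "((-1/2 :: complex) gchoose m) = 0" by (simp add: mult_2)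
  then show False using gbinomial_minus_half[of m] half_coeff_pos[of m] by simp
qed

lemma poly_pi_poly_eq_0_iff: "poly (pi_poly m) z = 0 \<longleftrightarrow> poly (jacobi_P m) z = 0"
proof -
  have "kappa m \<noteq> 0" by (simp add: kappa_def)
  then show ?thesis by (simp add: pi_poly_def)
qed

lemma finite_zeros_pi_poly: "finite {z. poly (pi_poly m) z = 0}"
  unfolding poly_pi_poly_eq_0_iff by (rule poly_roots_finite[OF jacobi_P_nz])

lemma max_dist_to_le:
  assumes "finite A" "0 \<le> B" "\<And>z. z \<in> A \<Longrightarrow> infdist z Z \<le> B"
  shows "0 \<le> max_dist_to A Z" "max_dist_to A Z \<le> B"
  using assms by (auto simp: max_dist_to_def intro: Max_ge)

text \<open>Both statements are instances of the local lemma, with the roles of q and the Jacobi polynomial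
  exchanged.\<close>

theorem zeros_near_zeros_of_q:
  assumes \<epsilon>: "0 < \<epsilon>" "\<epsilon> < 1" and \<gamma>: "outer_arc \<epsilon> \<gamma>"
  obtains M :: nat where "M > 0"
    "\<And>m z. m \<ge> M \<Longrightarrow> z \<in> Omega_minus \<epsilon> \<gamma> - u_disc \<epsilon> \<Longrightarrow> poly (pi_poly m) z = 0 \<Longrightarrow> infdist z {z. q m z = 0} \<le> (1/40) / real m"
    "\<And>m z0. m \<ge> M \<Longrightarrow> z0 \<in> Omega_minus \<epsilon> \<gamma> - u_disc \<epsilon> \<Longrightarrow> q m z0 = 0 \<Longrightarrow>
       \<exists>!z. poly (pi_poly m) z = 0 \<and> cmod (z0 - z) \<le> (1/40) / real m"
proof -
  obtain R0 where R0: "\<And>z. z \<in> Omega_minus \<epsilon> \<gamma> \<Longrightarrow> cmod z \<le> R0"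
    using Omega_minus_subset(2)[OF \<gamma>] by (auto simp: bounded_iff)
  define R where "R = max R0 3"
  obtain C where C: "\<And>z m. z \<in> exterior_range (\<epsilon>/2) R \<Longrightarrow> m \<ge> 1 \<Longrightarrow> cmod (normalized_P m z - q m z) \<le> C * real m powr (-1/4)"
    using normalized_P_asymptotics[of "\<epsilon>/2" R] \<epsilon> by auto
  have "((\<lambda>m. real m powr (-1/4)) \<longlongrightarrow> 0) sequentially"
    by (rule tendsto_neg_powr[OF _ filterlim_real_sequentially]) simp
  then have "((\<lambda>m. C * real m powr (-1/4)) \<longlongrightarrow> 0) sequentially" by (rule tendsto_mult_right_zero)
  then have "eventually (\<lambda>m. C * real m powr (-1/4) < \<epsilon> / 1000) sequentially"
    using \<epsilon> by (intro order_tendstoD(2)) auto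
  then obtain M0 where M0: "\<And>m. m \<ge> M0 \<Longrightarrow> C * real m powr (-1/4) < \<epsilon> / 1000"
    unfolding eventually_sequentially by blast
  define M where "M = max 1 (max M0 (nat \<lceil>3 / \<epsilon> ^ 4\<rceil>))"
  have M: "m \<ge> 1" "3 / \<epsilon> ^ 4 \<le> real m" "C * real m powr (-1/4) < \<epsilon> / 1000" if "m \<ge> M" for m
    using that M0[of m] by (auto simp: M_def nat_le_iff ceiling_le_iff)
  have Om: "z \<in> left_exterior" "\<epsilon> \<le> cmod z" "z \<in> exterior_range (\<epsilon>/2) R" if "z \<in> Omega_minus \<epsilon> \<gamma> - u_disc \<epsilon>" for z
    using that Omega_minus_subset(1)[OF \<gamma>] R0[of z] \<epsilon> by (auto simp: u_disc_def exterior_range_def R_def)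
  have r40: "(1/40) / real m = 1 / (40 * real m)" for m by simp
  show ?thesis
  proof (rule that)
    show "M > 0" by (simp add: M_def)
  next
    fix m z assume m: "m \<ge> M" and z: "z \<in> Omega_minus \<epsilon> \<gamma> - u_disc \<epsilon>" and P: "poly (pi_poly m) z = 0"
    have "normalized_P m z = 0" using P normalized_P_eq_0_iff[OF Om(1)[OF z]] poly_pi_poly_eq_0_iff by blast
    then have q: "cmod (q m z) \<le> \<epsilon> / 1000" using C[OF Om(3)[OF z] M(1)[OF m]] M(3)[OF m] by simp
    have "\<exists>!v. v \<in> cball z (1 / (40 * real m)) \<and> q m v = 0"
      by (rule unique_zero_near_approx_zero(2)[OF \<epsilon>(1) _ M(1,2)[OF m] Om(1,2)[OF z] q q_holomorphic]) (use \<epsilon> in auto)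
    then obtain v where v: "dist z v \<le> 1 / (40 * real m)" "q m v = 0" by auto
    have "infdist z {z. q m z = 0} \<le> dist z v" by (rule infdist_le) (simp add: v)
    then show "infdist z {z. q m z = 0} \<le> (1/40) / real m" using v(1) r40 by simp
  next
    fix m z0 assume m: "m \<ge> M" and z0: "z0 \<in> Omega_minus \<epsilon> \<gamma> - u_disc \<epsilon>" and q: "q m z0 = 0"
    have close: "cmod (normalized_P m z - q m z) \<le> \<epsilon> / 1000" if "z \<in> exterior_range (\<epsilon>/2) 3" for z
    proof -
      have "z \<in> exterior_range (\<epsilon>/2) R" using that by (auto simp: exterior_range_def R_def)
      from C[OF this M(1)[OF m]] M(3)[OF m] show ?thesis by simp
    qed
    have q0: "cmod (q m z0) \<le> \<epsilon> / 1000" using q \<epsilon> by simp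
    note * = unique_zero_near_approx_zero[OF \<epsilon>(1) less_imp_le[OF \<epsilon>(2)] M(1,2)[OF m] Om(1,2)[OF z0] q0 normalized_P_holomorphic close]
    have "z \<in> cball z0 (1 / (40 * real m)) \<and> normalized_P m z = 0 \<longleftrightarrow> poly (pi_poly m) z = 0 \<and> cmod (z0 - z) \<le> (1/40) / real m" for z
    proof (cases "z \<in> cball z0 (1 / (40 * real m))")
      case True
      then have "z \<in> left_exterior" using *(1) by blast
      then show ?thesis using True normalized_P_eq_0_iff poly_pi_poly_eq_0_iff r40 by (simp add: dist_norm)
    next
      case False
      then show ?thesis using r40 by (simp add: dist_norm)
    qed
    then show "\<exists>!z. poly (pi_poly m) z = 0 \<and> cmod (z0 - z) \<le> (1/40) / real m" using *(2) by simp
  qed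
qed

theorem theorem1p7:
  shows "(\<forall>m::nat. m \<ge> 1 \<longrightarrow>
            (\<forall>z. q m z = 0 \<longrightarrow> cmod (1 - z\<^sup>2) = 2 powr (1 / (2 * real m + 1))) \<and>
            (\<exists>zs. enumerates_left_zeros m zs) \<and>
            (\<exists>zs. enumerates_right_zeros m zs)) \<and>
         (\<exists>\<epsilon>0::real. \<epsilon>0 > 0 \<and>
            (\<forall>\<epsilon> \<gamma>. 0 < \<epsilon> \<and> \<epsilon> < \<epsilon>0 \<and> outer_arc \<epsilon> \<gamma> \<longrightarrow>
               (\<lambda>m. max_dist_to {z \<in> Omega_minus \<epsilon> \<gamma> - u_disc \<epsilon>. poly (pi_poly m) z = 0}
                                {z. q m z = 0}) \<longlonglongrightarrow> 0 \<and>
               (\<exists>M::nat. \<exists>C::real. M > 0 \<and> C > 0 \<and>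
                  (\<forall>m\<ge>M. \<forall>zstar \<in> Omega_minus \<epsilon> \<gamma> - u_disc \<epsilon>. q m zstar = 0 \<longrightarrow>
                     (\<exists>!z. poly (pi_poly m) z = 0 \<and> cmod (zstar - z) \<le> C / real m)))))"
proof (rule conjI)
  show "\<forall>m::nat. m \<ge> 1 \<longrightarrow>
            (\<forall>z. q m z = 0 \<longrightarrow> cmod (1 - z\<^sup>2) = 2 powr (1 / (2 * real m + 1))) \<and>
            (\<exists>zs. enumerates_left_zeros m zs) \<and>
            (\<exists>zs. enumerates_right_zeros m zs)"
    using q_zero_modulus ex_left_enumeration ex_right_enumeration by blast
  show "\<exists>\<epsilon>0::real. \<epsilon>0 > 0 \<and>
            (\<forall>\<epsilon> \<gamma>. 0 < \<epsilon> \<and> \<epsilon> < \<epsilon>0 \<and> outer_arc \<epsilon> \<gamma> \<longrightarrow>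
               (\<lambda>m. max_dist_to {z \<in> Omega_minus \<epsilon> \<gamma> - u_disc \<epsilon>. poly (pi_poly m) z = 0}
                                {z. q m z = 0}) \<longlonglongrightarrow> 0 \<and>
               (\<exists>M::nat. \<exists>C::real. M > 0 \<and> C > 0 \<and>
                  (\<forall>m\<ge>M. \<forall>zstar \<in> Omega_minus \<epsilon> \<gamma> - u_disc \<epsilon>. q m zstar = 0 \<longrightarrow>
                     (\<exists>!z. poly (pi_poly m) z = 0 \<and> cmod (zstar - z) \<le> C / real m))))"
  proof (rule exI[of _ 1], intro conjI allI impI)
    show "(0::real) < 1" by simp
next
  fix \<epsilon> :: real and \<gamma> assume "0 < \<epsilon> \<and> \<epsilon> < 1 \<and> outer_arc \<epsilon> \<gamma>"
  then have \<epsilon>: "0 < \<epsilon>" "\<epsilon> < 1" "outer_arc \<epsilon> \<gamma>" by auto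
  obtain M where M: "M > 0"
    "\<And>m z. m \<ge> M \<Longrightarrow> z \<in> Omega_minus \<epsilon> \<gamma> - u_disc \<epsilon> \<Longrightarrow> poly (pi_poly m) z = 0 \<Longrightarrow> infdist z {z. q m z = 0} \<le> (1/40) / real m"
    "\<And>m z0. m \<ge> M \<Longrightarrow> z0 \<in> Omega_minus \<epsilon> \<gamma> - u_disc \<epsilon> \<Longrightarrow> q m z0 = 0 \<Longrightarrow>
       \<exists>!z. poly (pi_poly m) z = 0 \<and> cmod (z0 - z) \<le> (1/40) / real m"
    using zeros_near_zeros_of_q[OF \<epsilon>] by blast
  let ?A = "\<lambda>m. {z \<in> Omega_minus \<epsilon> \<gamma> - u_disc \<epsilon>. poly (pi_poly m) z = 0}"
  have bnd: "0 \<le> max_dist_to (?A m) {z. q m z = 0}" "max_dist_to (?A m) {z. q m z = 0} \<le> (1/40) / real m"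
    if "m \<ge> M" for m
  proof -
    have "finite (?A m)" by (rule finite_subset[OF _ finite_zeros_pi_poly[of m]]) auto
    moreover have "infdist z {z. q m z = 0} \<le> (1/40) / real m" if "z \<in> ?A m" for z
      using M(2)[OF \<open>m \<ge> M\<close>, of z] that by blast
    ultimately show "0 \<le> max_dist_to (?A m) {z. q m z = 0}" "max_dist_to (?A m) {z. q m z = 0} \<le> (1/40) / real m"
      using max_dist_to_le[of "?A m" "(1/40) / real m"] by simp_all
  qed
  show "(\<lambda>m. max_dist_to (?A m) {z. q m z = 0}) \<longlonglongrightarrow> 0"
  proof (rule tendsto_sandwich)
    show "eventually (\<lambda>m. 0 \<le> max_dist_to (?A m) {z. q m z = 0}) sequentially"
      using bnd(1) by (auto simp: eventually_sequentially)
    show "eventually (\<lambda>m. max_dist_to (?A m) {z. q m z = 0} \<le> (1/40) / real m) sequentially"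
      using bnd(2) by (auto simp only: eventually_sequentially)
    show "(\<lambda>m. (1/40) / real m) \<longlonglongrightarrow> 0" by (rule lim_const_over_n)
  qed simp
  show "\<exists>M::nat. \<exists>C::real. M > 0 \<and> C > 0 \<and> (\<forall>m\<ge>M. \<forall>zstar \<in> Omega_minus \<epsilon> \<gamma> - u_disc \<epsilon>. q m zstar = 0 \<longrightarrow>
      (\<exists>!z. poly (pi_poly m) z = 0 \<and> cmod (zstar - z) \<le> C / real m))"
    using M(1,3) by (intro exI[of _ M] exI[of _ "1/40"]) auto
qed
qed

end
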